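(* Let $0<\lambda<n$ and let $I_\lambda f(x)=\int_{\mathbb R^n}\frac{f(y)}{|x-y|^{\lambda}}\,dy$ be the fractional integral operator on $\mathbb R^n$. Then there exist a constant $C$ depending only on $\lambda$ and $n$ and, for every $\omega\in(\{0,1\}^n)^{\mathbb Z}$ and all integers $i,j\ge 0$, a fractional dyadic shift $S^{i,j}_{\lambda,\omega}$ associated with $(i,j)$ and the dyadic system $\mathscr D^\omega$, such that for all $f,g\in L^\infty_c(\mathbb R^n)$ (bounded, compactly supported functions), $$\langle g, I_\lambda f\rangle = C\cdot \mathbb E_\omega \sum_{i,j=0}^{\infty} 2^{-\max(i,j)/2}\,\langle g, S^{i,j}_{\lambda,\omega}f\rangle .$$
   Context: Pairing: $\langle g,f\rangle=\int g f$. Random dyadic systems. $\mathscr D^0=\bigcup_{k\in\mathbb Z}\mathscr D^0_k$, where $\mathscr D^0_k=\{2^{-k}([0,1)^n+m): m\in\mathbb Z^n\}$. For $\omega=(\omega_j)_{j\in\mathbb Z}\in(\{0,1\}^n)^{\mathbb Z}$ and a cube $I$ with side length $\ell(I)$, put $I\dotplus\omega := I+\sum_{j:\,2^{-j}<\ell(I)}2^{-j}\omega_j$ and $\mathscr D^\omega:=\{I\dotplus\omega: I\in\mathscr D^0\}$. $\mathbb E_\omega$ is the expectation when the coordinates $\omega_j$ are independent and uniformly distributed on $\{0,1\}^n$. For $I\in\mathscr D^\omega$ and an integer $i\ge0$, $I^{(i)}$ is the unique cube $P\in\mathscr D^\omega$ with $I\subset P$ and $\ell(P)=2^i\ell(I)$.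 Haar functions. For an interval $I$ with left and right halves $I_\ell,I_r$: $h_I^0=|I|^{-1/2}1_I$, $h_I^1=|I|^{-1/2}(1_{I_\ell}-1_{I_r})$. For a cube $I=I_1\times\cdots\times I_n$ and $\eta\in\{0,1\}^n\setminus\{0\}$, $h_I^\eta(x)=\prod_{k=1}^n h_{I_k}^{\eta_k}(x_k)$. The index $\eta$ is suppressed in the notation: $h_I$ stands for $h_I^\eta$, and sums over cubes involving $h_I$ implicitly include the sum over $\eta\in\{0,1\}^n\setminus\{0\}$ (e.g. $f=\sum_{I\in\mathscr D^\omega}\langle f,h_I\rangle h_I$ means $f=\sum_I\sum_\eta\langle f,h_I^\eta\rangle h_I^\eta$). Fractional dyadic shifts. Given integers $i,j\ge0$, a fractional dyadic shift associated with $(i,j)$ is an operator of the form $S^{i,j}_{\lambda,\omega}f=\sum_{K\in\mathscr D^\omega}A^{i,j}_{\lambda,K}f$, where $$A^{i,j}_{\lambda,K}f=\sum_{\substack{I,J\in\mathscr D^\omega\\ I^{(i)}=K,\ J^{(j)}=K}} a_{\lambda,I,J,K}\langle f,h_I\rangle h_J$$ with coefficients satisfying $|a_{\lambda,I,J,K}|\le |I|^{1/2}|J|^{1/2}/|K|^{\lambda/n}$. With the suppressed indices written out, the sum also runs over the Haar indices $\eta,\theta\in\{0,1\}^n\setminus\{0\}$ of $h_I^\eta$, $h_J^\theta$, the coefficients may depend on $\eta,\theta$, and each obeys the same bound. *)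

theory Defs
  imports "HOL-Probability.Probability"
begin

section \<open>Random dyadic systems\<close>

definition unit_cube :: "(real^'n) set" where
  "unit_cube = {x. \<forall>k. 0 \<le> x $ k \<and> x $ k < 1}"

definition std_dyadic_level :: "int \<Rightarrow> (real^'n) set set" where
  "std_dyadic_level k =
     {(\<lambda>x. (2 powi (- k)) *\<^sub>R (x + m)) ` unit_cube | m. \<forall>r. m $ r \<in> \<int>}"

definition std_dyadic :: "(real^'n) set set" where
  "std_dyadic = (\<Union>k. std_dyadic_level k)"

definition side_length :: "(real^'n) set \<Rightarrow> real" where
  "side_length I = (THE l. 0 < l \<and> (\<exists>c. I = (\<lambda>x. c + l *\<^sub>R x) ` unit_cube))"

text \<open>Elements of \<open>{0,1}^n\<close> are encoded as functions \<open>'n \<Rightarrow> bool\<close>, with \<open>True\<close> standing for 1;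
  thus \<open>({0,1}^n)^\<int>\<close> is the whole type \<open>int \<Rightarrow> 'n \<Rightarrow> bool\<close>.\<close>

definition bits_vec :: "('n \<Rightarrow> bool) \<Rightarrow> real^'n" where
  "bits_vec b = (\<chi> k. of_bool (b k))"

definition dyadic_translate :: "(int \<Rightarrow> 'n \<Rightarrow> bool) \<Rightarrow> (real^'n) set \<Rightarrow> (real^'n) set" where
  "dyadic_translate \<omega> I =
     (\<lambda>x. x + (\<Sum>\<^sub>\<infinity>j\<in>{j. 2 powi (- j) < side_length I}. (2 powi (- j)) *\<^sub>R bits_vec (\<omega> j))) ` I"

definition dyadic :: "(int \<Rightarrow> 'n \<Rightarrow> bool) \<Rightarrow> (real^'n) set set" where
  "dyadic \<omega> = dyadic_translate \<omega> ` std_dyadic"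

definition ancestor ::
    "(int \<Rightarrow> 'n \<Rightarrow> bool) \<Rightarrow> nat \<Rightarrow> (real^'n) set \<Rightarrow> (real^'n) set" where
  "ancestor \<omega> i I =
     (THE P. P \<in> dyadic \<omega> \<and> I \<subseteq> P \<and> side_length P = 2 ^ i * side_length I)"

definition omega_measure :: "(int \<Rightarrow> 'n::finite \<Rightarrow> bool) measure" where
  "omega_measure = PiM UNIV (\<lambda>_. measure_pmf (pmf_of_set UNIV))"

section \<open>Haar functions\<close>

definition left_half :: "real set \<Rightarrow> real set" where
  "left_half A = {t \<in> A. t < (Inf A + Sup A) / 2}"

definition right_half :: "real set \<Rightarrow> real set" where
  "right_half A = {t \<in> A. (Inf A + Sup A) / 2 \<le> t}"

definition haar_interval :: "bool \<Rightarrow> real set \<Rightarrow> real \<Rightarrow> real" where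
  "haar_interval e A t = measure lebesgue A powr (- 1 / 2) *
     (if e then indicator (left_half A) t - indicator (right_half A) t else indicator A t)"

definition haar :: "('n \<Rightarrow> bool) \<Rightarrow> (real^'n) set \<Rightarrow> real^'n \<Rightarrow> real" where
  "haar \<eta> I x = (\<Prod>k\<in>UNIV. haar_interval (\<eta> k) ((\<lambda>y. y $ k) ` I) (x $ k))"

definition haar_indices :: "('n \<Rightarrow> bool) set" where
  "haar_indices = UNIV - {\<lambda>_. False}"

section \<open>Pairing, fractional integral, and test functions\<close>

text \<open>Scalars are complex; the pairing is bilinear, without conjugation.\<close>

definition pairing :: "(real^'n \<Rightarrow> complex) \<Rightarrow> (real^'n \<Rightarrow> complex) \<Rightarrow> complex" where
  "pairing g f = (LINT x|lebesgue. g x * f x)"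

definition frac_integral :: "real \<Rightarrow> (real^'n \<Rightarrow> complex) \<Rightarrow> real^'n \<Rightarrow> complex" where
  "frac_integral lam f x = (LINT y|lebesgue. f y / of_real (norm (x - y) powr lam))"

text \<open>\<open>L\<^sup>\<infinity>\<^sub>c\<close>, with the usual almost-everywhere understanding of bounds and supports.\<close>

definition Linf_c :: "(real^'n \<Rightarrow> complex) set" where
  "Linf_c = {f. f \<in> borel_measurable lebesgue \<and>
     (\<exists>M. AE x in lebesgue. norm (f x) \<le> M) \<and>
     (\<exists>B. compact B \<and> (AE x in lebesgue. x \<notin> B \<longrightarrow> f x = 0))}"

section \<open>Fractional dyadic shifts\<close>

text \<open>Coefficients are written \<open>a \<eta> \<theta> I J K\<close>, where \<open>\<eta>\<close> and \<open>\<theta>\<close> are the Haar indices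
  belonging to \<open>I\<close> and \<open>J\<close>.\<close>

type_synonym 'n shift_coeffs =
  "('n \<Rightarrow> bool) \<Rightarrow> ('n \<Rightarrow> bool) \<Rightarrow> (real^'n) set \<Rightarrow> (real^'n) set \<Rightarrow> (real^'n) set \<Rightarrow> complex"

definition shift_pairs ::
    "(int \<Rightarrow> 'n \<Rightarrow> bool) \<Rightarrow> nat \<Rightarrow> nat \<Rightarrow> (real^'n) set \<Rightarrow> ((real^'n) set \<times> (real^'n) set) set" where
  "shift_pairs \<omega> i j K =
     {(I, J). I \<in> dyadic \<omega> \<and> J \<in> dyadic \<omega> \<and> ancestor \<omega> i I = K \<and> ancestor \<omega> j J = K}"

definition shift_coeff_bound ::
    "real \<Rightarrow> (int \<Rightarrow> 'n::finite \<Rightarrow> bool) \<Rightarrow> nat \<Rightarrow> nat \<Rightarrow> 'n shift_coeffs \<Rightarrow> bool" where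
  "shift_coeff_bound lam \<omega> i j a \<longleftrightarrow>
     (\<forall>K\<in>dyadic \<omega>. \<forall>(I, J)\<in>shift_pairs \<omega> i j K. \<forall>\<eta>\<in>haar_indices. \<forall>\<theta>\<in>haar_indices.
        norm (a \<eta> \<theta> I J K) \<le>
          measure lebesgue I powr (1 / 2) * measure lebesgue J powr (1 / 2)
            / measure lebesgue K powr (lam / real CARD('n)))"

text \<open>For \<open>K \<in> dyadic \<omega>\<close> the set of pairs below is finite, so this is a genuine finite sum.\<close>

definition shift_block ::
    "(int \<Rightarrow> 'n::finite \<Rightarrow> bool) \<Rightarrow> nat \<Rightarrow> nat \<Rightarrow> 'n shift_coeffs \<Rightarrow> (real^'n) set
      \<Rightarrow> (real^'n \<Rightarrow> complex) \<Rightarrow> real^'n \<Rightarrow> complex" where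
  "shift_block \<omega> i j a K f x =
     (\<Sum>(I, J)\<in>shift_pairs \<omega> i j K. \<Sum>\<eta>\<in>haar_indices. \<Sum>\<theta>\<in>haar_indices.
        a \<eta> \<theta> I J K * pairing f (\<lambda>y. of_real (haar \<eta> I y)) * of_real (haar \<theta> J x))"

text \<open>The sum over \<open>K\<close> is taken pointwise. For \<open>0 < lam < n\<close> and \<open>f \<in> Linf_c\<close> the coefficient bound
  makes it converge absolutely at every point: a block \<open>K\<close> contributes at most
  \<open>4^n |K|^{-lam/n} \<integral>\<^sub>K |f|\<close> at \<open>x \<in> K\<close> and nothing at \<open>x \<notin> K\<close>.\<close>

definition fractional_dyadic_shift ::
    "real \<Rightarrow> (int \<Rightarrow> 'n::finite \<Rightarrow> bool) \<Rightarrow> nat \<Rightarrow> nat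
      \<Rightarrow> ((real^'n \<Rightarrow> complex) \<Rightarrow> real^'n \<Rightarrow> complex) \<Rightarrow> bool" where
  "fractional_dyadic_shift lam \<omega> i j S \<longleftrightarrow>
     (\<exists>a. shift_coeff_bound lam \<omega> i j a \<and>
          S = (\<lambda>f x. \<Sum>\<^sub>\<infinity>K\<in>dyadic \<omega>. shift_block \<omega> i j a K f x))"

end

theory Submission
  imports Defs
begin

text \<open>
  Off the diagonal and up to a constant, \<open>\<bar>x - y\<bar>\<^sup>-\<^sup>l\<^sup>a\<^sup>m\<close> is the only kernel that is invariant under simultaneous
  translations and rotations of \<open>x\<close> and \<open>y\<close> and homogeneous of degree \<open>- lam\<close>. Let \<open>p\<close> be a radial
  Lipschitz function on the unit ball with integral 0 (\<open>wavelet\<close>). The superposition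
  \<open>\<integral>\<integral> s\<^sup>-\<^sup>l\<^sup>a\<^sup>m\<^sup>-\<^sup>1\<^sup>-\<^sup>n p((x - v)/s) p((y - v)/s) dv ds\<close> over all scales \<open>s > 0\<close> and all centres \<open>v\<close> has
  these invariances, so it equals \<open>c \<bar>x - y\<bar>\<^sup>-\<^sup>l\<^sup>a\<^sup>m\<close> (\<open>superposed_kernel_eq\<close>). The constant is not 0:
  integrated against \<open>f(x) f(y)\<close>, the superposition is a weighted integral of the squares
  \<open>\<langle>p((\<cdot> - v)/s), f\<rangle>\<^sup>2\<close>, which is positive for the indicator function of a ball
  (\<open>kernel_const_nonzero\<close>).

  It remains to distribute the pairs \<open>(s, v)\<close> over the cubes of a random grid. A cube \<open>K\<close> of side \<open>l\<close>
  receives the scales \<open>l/4 \<le> s < l/2\<close> and, with weight \<open>\<bar>K\<bar>\<close>, the single position \<open>v\<close> = centre of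
  \<open>K\<close>. In a random grid the centres are uniformly distributed (\<open>expectation_grid_offset\<close>), so the
  average over the grids restores the integral over \<open>v\<close> (\<open>expectation_series\<close>).

  For the chosen scales the wave \<open>p((\<cdot> - v)/s)\<close> is supported in \<open>K\<close> and has mean 0, so it is the sum
  of its Haar components on the subcubes of \<open>K\<close> (\<open>haar_level_sums\<close>). Expanding both waves, one over
  cubes \<open>I\<close> of generation \<open>i\<close> below \<open>K\<close> and the other over cubes \<open>J\<close> of generation \<open>j\<close>, produces
  the shift of type \<open>(i, j)\<close>. Since \<open>p\<close> is Lipschitz, its Haar coefficients are of size
  \<open>2\<^sup>-\<^sup>i \<bar>I\<bar>\<^sup>1\<^sup>/\<^sup>2\<close> and \<open>2\<^sup>-\<^sup>j \<bar>J\<bar>\<^sup>1\<^sup>/\<^sup>2\<close>, and \<open>2\<^sup>-\<^sup>i\<^sup>-\<^sup>j\<close> pays for the factor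
  \<open>2\<close> to the power \<open>max(i, j)/2\<close> taken out of the shift (\<open>shift_coeff_bounded\<close>).

  The interchanges of sums and integrals in the series of shifts are dominated by the sum over the cubes of
  \<open>l\<^sup>-\<^sup>l\<^sup>a\<^sup>m \<integral>\<^sub>K \<bar>f\<bar> \<integral>\<^sub>K \<bar>g\<bar>\<close>, which is bounded uniformly in the grid: the small cubes are controlled by
  the boundedness of \<open>f\<close> and \<open>lam < n\<close>, the large ones by the integrability of \<open>f\<close> and \<open>lam > 0\<close>
  (\<open>local_energy_summable\<close>).
\<close>

section \<open>Affine and orthogonal substitutions\<close>

lemma
  fixes f :: "'a::euclidean_space \<Rightarrow> 'b::{banach, second_countable_topology}"
  assumes [measurable]: "f \<in> borel_measurable borel" and c: "c \<noteq> 0"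
  shows integral_affine: "(LINT x|lborel. f (t + c *\<^sub>R x)) = (1 / \<bar>c\<bar> ^ DIM('a)) *\<^sub>R integral\<^sup>L lborel f"
    and integrable_affine: "integrable lborel (\<lambda>x. f (t + c *\<^sub>R x)) \<longleftrightarrow> integrable lborel f"
proof -
  have eq: "lborel = density (distr lborel borel (\<lambda>x. t + c *\<^sub>R x)) (\<lambda>_. ennreal (\<bar>c\<bar> ^ DIM('a)))"
    using lborel_affine[OF c, of t] by (simp add: ennreal_power)
  have "integral\<^sup>L lborel f = (LINT x|distr lborel borel (\<lambda>x. t + c *\<^sub>R x). \<bar>c\<bar> ^ DIM('a) *\<^sub>R f x)"
    by (subst eq, subst integral_density) auto
  also have "\<dots> = (LINT x|lborel. \<bar>c\<bar> ^ DIM('a) *\<^sub>R f (t + c *\<^sub>R x))"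
    by (subst integral_distr) auto
  finally have "integral\<^sup>L lborel f = \<bar>c\<bar> ^ DIM('a) *\<^sub>R (LINT x|lborel. f (t + c *\<^sub>R x))" by simp
  then show "(LINT x|lborel. f (t + c *\<^sub>R x)) = (1 / \<bar>c\<bar> ^ DIM('a)) *\<^sub>R integral\<^sup>L lborel f"
    using c by simp
  have "integrable lborel f \<longleftrightarrow> integrable (distr lborel borel (\<lambda>x. t + c *\<^sub>R x)) (\<lambda>x. \<bar>c\<bar> ^ DIM('a) *\<^sub>R f x)"
    by (subst eq, subst integrable_density) auto
  also have "\<dots> \<longleftrightarrow> integrable lborel (\<lambda>x. \<bar>c\<bar> ^ DIM('a) *\<^sub>R f (t + c *\<^sub>R x))"
    by (subst integrable_distr_eq) auto
  finally show "integrable lborel (\<lambda>x. f (t + c *\<^sub>R x)) \<longleftrightarrow> integrable lborel f"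
    using c integrable_scaleR_right[of "\<bar>c\<bar> ^ DIM('a)" lborel "\<lambda>x. f (t + c *\<^sub>R x)"]
      integrable_scaleR_right[of "1 / \<bar>c\<bar> ^ DIM('a)" lborel "\<lambda>x. \<bar>c\<bar> ^ DIM('a) *\<^sub>R f (t + c *\<^sub>R x)"]
    by auto
qed

lemma nn_integral_affine:
  fixes f :: "'a::euclidean_space \<Rightarrow> ennreal"
  assumes [measurable]: "f \<in> borel_measurable borel" and c: "c \<noteq> 0"
  shows "(\<integral>\<^sup>+x. f (t + c *\<^sub>R x) \<partial>lborel) = ennreal (1 / \<bar>c\<bar> ^ DIM('a)) * integral\<^sup>N lborel f"
proof -
  have eq: "lborel = density (distr lborel borel (\<lambda>x. t + c *\<^sub>R x)) (\<lambda>_. ennreal (\<bar>c\<bar> ^ DIM('a)))"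
    using lborel_affine[OF c, of t] by (simp add: ennreal_power)
  have "integral\<^sup>N lborel f = ennreal (\<bar>c\<bar> ^ DIM('a)) * (\<integral>\<^sup>+x. f (t + c *\<^sub>R x) \<partial>lborel)"
    by (subst eq) (simp add: nn_integral_density nn_integral_distr nn_integral_cmult)
  then have "ennreal (1 / \<bar>c\<bar> ^ DIM('a)) * integral\<^sup>N lborel f =
      ennreal (1 / \<bar>c\<bar> ^ DIM('a)) * ennreal (\<bar>c\<bar> ^ DIM('a)) * (\<integral>\<^sup>+x. f (t + c *\<^sub>R x) \<partial>lborel)"
    by (simp add: mult.assoc)
  also have "ennreal (1 / \<bar>c\<bar> ^ DIM('a)) * ennreal (\<bar>c\<bar> ^ DIM('a)) = 1"
    using c by (simp flip: ennreal_mult)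
  finally show ?thesis by simp
qed

text \<open>
  The image of Lebesgue measure under \<open>R\<close> is again translation invariant, hence a multiple of
  Lebesgue measure, and the unit ball \<open>B\<close>, which \<open>R\<close> preserves, fixes the factor. Concretely, the
  integral of \<open>1\<^sub>B(x) 1\<^sub>A(x + R y)\<close> is computed in both orders.
\<close>

lemma lborel_distr_orthogonal:
  fixes R :: "'a::euclidean_space \<Rightarrow> 'a"
  assumes R: "orthogonal_transformation R"
  shows "distr lborel borel R = lborel"
proof (rule measure_eqI)
  show "sets (distr lborel borel R) = sets lborel" by simp
  fix A assume "A \<in> sets (distr lborel borel R)"
  then have [measurable]: "A \<in> sets borel" by simp
  have lin: "linear R" using R by (simp add: orthogonal_transformation_linear)
  have [measurable]: "R \<in> borel_measurable borel"
    using lin by (intro borel_measurable_continuous_onI) (simp add: linear_continuous_on linear_linear)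
  define B where "B = ball (0::'a) 1"
  have [measurable]: "B \<in> sets borel" by (simp add: B_def)
  define b where "b = emeasure lborel B"
  have b: "b \<noteq> 0" "b \<noteq> \<infinity>"
    using emeasure_lborel_ball_finite[of "0::'a" 1] content_ball_pos[of 1 "0::'a"]
    unfolding b_def B_def measure_def by (auto simp del: zero_less_measure_iff)
  have surj: "\<exists>w. R w = z" for z
    using orthogonal_transformation_surj[OF R] by (metis surj_def)
  have ind: "indicator B (R w) = (indicator B w :: ennreal)" for w
    using orthogonal_transformation_norm[OF R] by (simp add: B_def indicator_def)
  have "b * emeasure (distr lborel borel R) A = b * (\<integral>\<^sup>+y. indicator A (R y) \<partial>lborel)"
    by (subst nn_integral_indicator[symmetric], simp, subst nn_integral_distr) auto
  also have "\<dots> = (\<integral>\<^sup>+x. indicator B x * (\<integral>\<^sup>+y. indicator A (R y) \<partial>lborel) \<partial>lborel)"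
    by (simp add: nn_integral_multc b_def)
  also have "\<dots> = (\<integral>\<^sup>+x. (\<integral>\<^sup>+y. indicator B x * indicator A (x + R y) \<partial>lborel) \<partial>lborel)"
  proof (rule nn_integral_cong)
    fix x
    obtain w where w: "R w = x" using surj by blast
    have "(\<integral>\<^sup>+y. indicator A (R y) \<partial>lborel) = (\<integral>\<^sup>+y. indicator A (R (w + 1 *\<^sub>R y)) \<partial>lborel)"
      by (subst nn_integral_affine[where f="\<lambda>y. indicator A (R y)"]) auto
    also have "\<dots> = (\<integral>\<^sup>+y. indicator A (x + R y) \<partial>lborel)"
      using w by (simp add: linear_add[OF lin])
    finally show "indicator B x * (\<integral>\<^sup>+y. indicator A (R y) \<partial>lborel)
        = (\<integral>\<^sup>+y. indicator B x * indicator A (x + R y) \<partial>lborel)"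
      by (simp add: nn_integral_cmult)
  qed
  also have "\<dots> = (\<integral>\<^sup>+y. (\<integral>\<^sup>+x. indicator B x * indicator A (x + R y) \<partial>lborel) \<partial>lborel)"
    by (rule lborel_pair.Fubini') measurable
  also have "\<dots> = (\<integral>\<^sup>+y. (\<integral>\<^sup>+z. indicator B (z - R y) * indicator A z \<partial>lborel) \<partial>lborel)"
  proof (rule nn_integral_cong)
    fix y
    show "(\<integral>\<^sup>+x. indicator B x * indicator A (x + R y) \<partial>lborel)
        = (\<integral>\<^sup>+z. indicator B (z - R y) * indicator A z \<partial>lborel)"
      using nn_integral_affine[where f="\<lambda>z. indicator B (z - R y) * indicator A z" and t="R y" and c=1]
      by (simp add: add.commute)
  qed
  also have "\<dots> = (\<integral>\<^sup>+z. (\<integral>\<^sup>+y. indicator B (z - R y) * indicator A z \<partial>lborel) \<partial>lborel)"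
    by (rule lborel_pair.Fubini') measurable
  also have "\<dots> = (\<integral>\<^sup>+z. b * indicator A z \<partial>lborel)"
  proof (rule nn_integral_cong)
    fix z
    obtain w where w: "R w = z" using surj by blast
    have "(\<integral>\<^sup>+y. indicator B (z - R y) \<partial>lborel) = (\<integral>\<^sup>+y. indicator B (w + (-1) *\<^sub>R y) \<partial>lborel)"
      by (intro nn_integral_cong) (simp add: w[symmetric] ind flip: linear_diff[OF lin])
    also have "\<dots> = b"
      by (subst nn_integral_affine[where f="indicator B"]) (auto simp: b_def)
    finally show "(\<integral>\<^sup>+y. indicator B (z - R y) * indicator A z \<partial>lborel) = b * indicator A z"
      by (simp add: nn_integral_multc)
  qed
  also have "\<dots> = b * emeasure lborel A"
    by (simp add: nn_integral_cmult)
  finally show "emeasure (distr lborel borel R) A = emeasure lborel A"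
    using b by (simp add: ennreal_mult_cancel_left)
qed

section \<open>A radial wavelet\<close>

definition tent :: "'a::real_normed_vector \<Rightarrow> real" where
  "tent z = max 0 (1 - norm z)"

text \<open>
  Two tents of the same integral and of different width: the difference has mean zero.
\<close>

definition wavelet :: "real^'n \<Rightarrow> real" where
  "wavelet z = tent z - 2 ^ CARD('n) * tent (2 *\<^sub>R z)"

lemma tent_measurable [measurable]: "tent \<in> borel_measurable (borel :: 'a::real_normed_vector measure)"
  unfolding tent_def[abs_def] by (intro borel_measurable_continuous_onI continuous_intros)

lemma wavelet_measurable [measurable]: "wavelet \<in> borel_measurable borel"
  unfolding wavelet_def[abs_def] by measurable

lemma tent_lipschitz: "\<bar>tent x - tent y\<bar> \<le> norm (x - y)"
  using norm_triangle_ineq3[of x y] unfolding tent_def by linarith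

lemma tent_range: "0 \<le> tent z" "tent z \<le> 1" 
  by (auto simp: tent_def)

lemma wavelet_lipschitz:
  "\<bar>wavelet x - wavelet (y :: real^'n)\<bar> \<le> (1 + 2 * 2 ^ CARD('n)) * norm (x - y)"
proof -
  have "\<bar>wavelet x - wavelet y\<bar> \<le> \<bar>tent x - tent y\<bar> + 2 ^ CARD('n) * \<bar>tent (2 *\<^sub>R x) - tent (2 *\<^sub>R y)\<bar>"
  proof -
    have "2 ^ CARD('n) * \<bar>tent (2 *\<^sub>R x) - tent (2 *\<^sub>R y)\<bar>
        = \<bar>2 ^ CARD('n) * tent (2 *\<^sub>R x) - 2 ^ CARD('n) * tent (2 *\<^sub>R y)\<bar>"
      by (simp add: abs_mult flip: right_diff_distrib)
    then show ?thesis unfolding wavelet_def by linarith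
  qed
  also have "\<dots> \<le> norm (x - y) + 2 ^ CARD('n) * norm (2 *\<^sub>R x - 2 *\<^sub>R y)"
    by (intro add_mono mult_left_mono tent_lipschitz) auto
  also have "norm (2 *\<^sub>R x - 2 *\<^sub>R y) = 2 * norm (x - y)"
    by (metis norm_scaleR scaleR_right_diff_distrib abs_numeral)
  finally show ?thesis by (simp add: algebra_simps)
qed

lemma wavelet_bound: "\<bar>wavelet (z :: real^'n)\<bar> \<le> 2 ^ CARD('n)"
proof -
  have "2 ^ CARD('n) * tent (2 *\<^sub>R z) \<le> 2 ^ CARD('n)" "0 \<le> 2 ^ CARD('n) * tent (2 *\<^sub>R z)"
    using tent_range[of "2 *\<^sub>R z"] by (auto intro: mult_left_le)
  moreover have "(1::real) \<le> 2 ^ CARD('n)" by simp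
  ultimately show ?thesis using tent_range[of z] unfolding wavelet_def by linarith
qed

lemma wavelet_outside: "1 \<le> norm z \<Longrightarrow> wavelet z = 0"
  by (simp add: wavelet_def tent_def)

lemma wavelet_radial: "norm x = norm y \<Longrightarrow> wavelet x = wavelet (y :: real^'n)" for x :: "real^'n"
  by (simp add: wavelet_def tent_def)

text \<open>
  The definite sign near the origin is what makes \<open>kernel_const\<close> nonzero.
\<close>

lemma wavelet_near_0:
  fixes z :: "real^'n"
  assumes "norm z \<le> 1 / 8"
  shows "wavelet z \<le> - 1 / 2"
proof -
  have "(2::real) ^ 1 \<le> 2 ^ CARD('n)" by (intro power_increasing) auto
  then have "2 * (3/4) \<le> 2 ^ CARD('n) * (1 - 2 * norm z)"
    using assms by (intro mult_mono) auto
  then have "3 / 2 \<le> 2 ^ CARD('n) * (1 - 2 * norm z)" by simp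
  moreover have "tent (2 *\<^sub>R z) = 1 - 2 * norm z" "tent z = 1 - norm z"
    using assms by (auto simp: tent_def)
  ultimately show ?thesis using norm_ge_zero[of z] unfolding wavelet_def by (simp only:)
qed

lemma integrable_tent: "integrable lborel (tent :: 'a::euclidean_space \<Rightarrow> real)"
proof (rule Bochner_Integration.integrable_bound)
  show "integrable lborel (indicator (cball 0 1) :: 'a \<Rightarrow> real)"
    using emeasure_lborel_cball_finite[of "0::'a" 1] by (intro integrable_real_indicator) auto
qed (auto simp: tent_def indicator_def)

lemma integrable_wavelet: "integrable lborel (wavelet :: real^'n \<Rightarrow> real)"
  using integrable_tent integrable_affine[of "tent :: real^'n \<Rightarrow> real" 2 0]
  unfolding wavelet_def[abs_def] by (intro Bochner_Integration.integrable_diff integrable_mult_right) auto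

lemma integral_wavelet: "(LINT z|lborel. wavelet (z :: real^'n)) = 0"
  using integrable_tent integrable_affine[of "tent :: real^'n \<Rightarrow> real" 2 0]
    integral_affine[of "tent :: real^'n \<Rightarrow> real" 2 0]
  unfolding wavelet_def[abs_def] by (subst Bochner_Integration.integral_diff) auto

section \<open>The fractional kernel as a superposition of wavelets\<close>

definition wave :: "real \<Rightarrow> real^'n \<Rightarrow> real^'n \<Rightarrow> real" where
  "wave s v x = wavelet ((1 / s) *\<^sub>R (x - v))"

text \<open>
  The exponent is the one that makes \<open>superposed_kernel\<close> homogeneous of degree \<open>- lam\<close>; the
  indicator function restricts integrals over all real \<open>s\<close> to positive scales.
\<close>

definition scale_weight :: "real \<Rightarrow> nat \<Rightarrow> real \<Rightarrow> real" where
  "scale_weight lam n s = indicator {0<..} s * s powr (- lam - 1 - real n)"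

text \<open>
  Representatives of the elements of \<open>Linf_c\<close> for which measurability, bound and support hold in
  the strict sense, so that Fubini applies with respect to \<open>lborel\<close>.
\<close>

definition test_function :: "(real^'n \<Rightarrow> complex) \<Rightarrow> bool" where
  "test_function f \<longleftrightarrow> f \<in> borel_measurable borel \<and> (\<exists>M. \<forall>x. norm (f x) \<le> M) \<and>
     (\<exists>R. \<forall>x. R < norm x \<longrightarrow> f x = 0)"

definition wave_coeff :: "real \<Rightarrow> real^'n \<Rightarrow> (real^'n \<Rightarrow> complex) \<Rightarrow> complex" where
  "wave_coeff s v f = (LINT x|lborel. of_real (wave s v x) * f x)"

lemma wave_measurable [measurable (raw)]:
  assumes [measurable]: "s \<in> borel_measurable M" "v \<in> borel_measurable M" "x \<in> borel_measurable M"
  shows "(\<lambda>a. wave (s a) (v a) (x a)) \<in> borel_measurable M"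
  unfolding wave_def by measurable

lemma scale_weight_measurable [measurable]: "scale_weight lam n \<in> borel_measurable borel"
  unfolding scale_weight_def[abs_def] by measurable

lemma scale_weight_nonneg: "0 \<le> scale_weight lam n s"
  by (simp add: scale_weight_def)

lemma test_functionD:
  assumes "test_function f"
  shows "f \<in> borel_measurable borel" "integrable lborel f" "\<exists>M\<ge>0. \<forall>x. norm (f x) \<le> M"
proof -
  obtain M R where [measurable]: "f \<in> borel_measurable borel"
    and M: "\<And>x. norm (f x) \<le> M" and R: "\<And>x. R < norm x \<Longrightarrow> f x = 0"
    using assms by (auto simp: test_function_def)
  show "f \<in> borel_measurable borel" by fact
  show "\<exists>M\<ge>0. \<forall>x. norm (f x) \<le> M" using M by (metis norm_ge_zero order_trans)
  show "integrable lborel f"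
  proof (rule Bochner_Integration.integrable_bound)
    show "integrable lborel (\<lambda>x::real^'a. M * indicator (cball 0 R) x)"
      using emeasure_lborel_cball_finite[of "0::real^'a" R]
      by (intro integrable_mult_right integrable_real_indicator) auto
    show "AE x in lborel. norm (f x) \<le> norm (M * indicator (cball 0 R) x :: real)"
    proof (rule AE_I2)
      fix x
      show "norm (f x) \<le> norm (M * indicator (cball 0 R) x :: real)"
        using M[of x] R[of x] norm_ge_zero[of "f x"] by (cases "norm x \<le> R") (auto simp: indicator_def)
    qed
  qed simp
qed

lemma wave_bound: "\<bar>wave s v (x :: real^'n)\<bar> \<le> 2 ^ CARD('n)"
  unfolding wave_def by (rule wavelet_bound)

lemma wave_lipschitz:
  assumes "0 < s"
  shows "\<bar>wave s v x - wave s v (y :: real^'n)\<bar> \<le> (1 + 2 * 2 ^ CARD('n)) / s * norm (x - y)"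
proof -
  have "norm ((1 / s) *\<^sub>R (x - v) - (1 / s) *\<^sub>R (y - v)) = norm (x - y) / s"
    using assms by (simp flip: scaleR_right_diff_distrib)
  then show ?thesis
    using wavelet_lipschitz[of "(1 / s) *\<^sub>R (x - v)" "(1 / s) *\<^sub>R (y - v)"]
    unfolding wave_def by simp
qed

lemma wave_outside: "0 < s \<Longrightarrow> s \<le> norm (x - v) \<Longrightarrow> wave s v x = 0"
  unfolding wave_def by (rule wavelet_outside) (simp add: le_divide_eq del: scaleR_right_diff_distrib)

lemma integral_wave:
  assumes "0 < s"
  shows "integrable lborel (wave s v)" "(LINT x|lborel. wave s v (x :: real^'n)) = 0"
proof -
  have eq: "wave s v = (\<lambda>x. wavelet (- ((1/s) *\<^sub>R v) + (1/s) *\<^sub>R x))"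
    by (auto simp: wave_def algebra_simps)
  show "integrable lborel (wave s v)" "(LINT x|lborel. wave s v (x :: real^'n)) = 0"
    unfolding eq using assms integrable_wavelet integral_wavelet
    by (subst integrable_affine integral_affine; simp)+
qed

definition wavelet_mass :: "'n::finite itself \<Rightarrow> real" where
  "wavelet_mass _ = (LINT z|lborel. \<bar>wavelet (z :: real^'n)\<bar>)"

lemma wavelet_mass_nonneg: "0 \<le> wavelet_mass TYPE('n::finite)"
  by (simp add: wavelet_mass_def)

lemma nn_integral_wavelet: "(\<integral>\<^sup>+z. ennreal \<bar>wavelet (z :: real^'n)\<bar> \<partial>lborel) = ennreal (wavelet_mass TYPE('n))"
  unfolding wavelet_mass_def using integrable_wavelet
  by (subst nn_integral_eq_integral) auto

lemma nn_integral_abs_wave: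
  assumes "0 < s"
  shows "(\<integral>\<^sup>+x. ennreal \<bar>wave s v (x :: real^'n)\<bar> \<partial>lborel) = ennreal (s ^ CARD('n) * wavelet_mass TYPE('n))"
    and "(\<integral>\<^sup>+v. ennreal \<bar>wave s v (x :: real^'n)\<bar> \<partial>lborel) = ennreal (s ^ CARD('n) * wavelet_mass TYPE('n))"
proof -
  have "(\<integral>\<^sup>+x. ennreal \<bar>wave s v (x :: real^'n)\<bar> \<partial>lborel)
      = (\<integral>\<^sup>+x. ennreal \<bar>wavelet (- ((1/s) *\<^sub>R v) + (1/s) *\<^sub>R x)\<bar> \<partial>lborel)"
    by (simp add: wave_def algebra_simps)
  also have "\<dots> = ennreal (s ^ CARD('n) * wavelet_mass TYPE('n))"
    using assms by (subst nn_integral_affine[where f="\<lambda>x. ennreal \<bar>wavelet x\<bar>"])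
      (auto simp: nn_integral_wavelet power_one_over wavelet_mass_nonneg simp flip: ennreal_mult)
  finally show "(\<integral>\<^sup>+x. ennreal \<bar>wave s v (x :: real^'n)\<bar> \<partial>lborel)
      = ennreal (s ^ CARD('n) * wavelet_mass TYPE('n))" .
next
  have "(\<integral>\<^sup>+v. ennreal \<bar>wave s v (x :: real^'n)\<bar> \<partial>lborel)
      = (\<integral>\<^sup>+v. ennreal \<bar>wavelet ((1/s) *\<^sub>R x + (- (1/s)) *\<^sub>R v)\<bar> \<partial>lborel)"
    by (simp add: wave_def algebra_simps)
  also have "\<dots> = ennreal (s ^ CARD('n) * wavelet_mass TYPE('n))"
    using assms by (subst nn_integral_affine[where f="\<lambda>x. ennreal \<bar>wavelet x\<bar>"])
      (auto simp: nn_integral_wavelet power_one_over wavelet_mass_nonneg simp flip: ennreal_mult)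
  finally show "(\<integral>\<^sup>+v. ennreal \<bar>wave s v (x :: real^'n)\<bar> \<partial>lborel)
      = ennreal (s ^ CARD('n) * wavelet_mass TYPE('n))" .
qed

definition wave_overlap :: "real \<Rightarrow> real^'n \<Rightarrow> real^'n \<Rightarrow> real" where
  "wave_overlap s x y = (LINT v|lborel. wave s v x * wave s v y)"

definition superposed_kernel :: "real \<Rightarrow> real^'n \<Rightarrow> real^'n \<Rightarrow> real" where
  "superposed_kernel lam x y = (LINT s|lborel. scale_weight lam CARD('n) s * wave_overlap s x y)"

lemma superposed_kernel_measurable:
  "(\<lambda>p. superposed_kernel lam (fst p) (snd p)) \<in> borel_measurable (borel \<Otimes>\<^sub>M borel)"
proof -
  have [measurable]: "(\<lambda>(p, s). wave_overlap s (fst p) (snd p)) \<in> borel_measurable ((borel \<Otimes>\<^sub>M borel) \<Otimes>\<^sub>M lborel)"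
    unfolding wave_overlap_def split_beta'
    by (rule lborel.borel_measurable_lebesgue_integral) measurable
  show ?thesis
    unfolding superposed_kernel_def by (rule lborel.borel_measurable_lebesgue_integral) measurable
qed

lemma superposed_kernel_translate: "superposed_kernel lam (x + a) (y + a) = superposed_kernel lam x y"
proof -
  have "wave_overlap s (x + a) (y + a) = wave_overlap s x y" for s
  proof -
    have "wave_overlap s (x + a) (y + a) = (LINT v|lborel. wave s (a + 1 *\<^sub>R v) (x + a) * wave s (a + 1 *\<^sub>R v) (y + a))"
      unfolding wave_overlap_def
      by (subst integral_affine[where f="\<lambda>v. wave s v (x + a) * wave s v (y + a)"]) auto
    also have "\<dots> = wave_overlap s x y"
      by (simp add: wave_overlap_def wave_def)
    finally show ?thesis .
  qed
  then show ?thesis by (simp add: superposed_kernel_def)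
qed

text \<open>
  The substitution \<open>v \<mapsto> R v\<close>; the wavelet is radial.
\<close>

lemma superposed_kernel_rotate:
  fixes R :: "real^'n \<Rightarrow> real^'n"
  assumes R: "orthogonal_transformation R"
  shows "superposed_kernel lam (R x) (R y) = superposed_kernel lam x (y :: real^'n)"
proof -
  have lin: "linear R" using R by (simp add: orthogonal_transformation_linear)
  have [measurable]: "R \<in> borel_measurable borel"
    using lin by (intro borel_measurable_continuous_onI) (simp add: linear_continuous_on linear_linear)
  have rot: "wave s (R v) (R x) = wave s v x" for s v x
  proof -
    have *: "norm (R x - R v) = norm (x - v)"
      using orthogonal_transformation_norm[OF R] by (simp flip: linear_diff[OF lin])
    show ?thesis unfolding wave_def by (rule wavelet_radial) (simp only: norm_scaleR *)
  qed
  have "wave_overlap s (R x) (R y) = wave_overlap s x y" for s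
  proof -
    have "wave_overlap s (R x) (R y) = (LINT v|distr lborel borel R. wave s v (R x) * wave s v (R y))"
      unfolding wave_overlap_def lborel_distr_orthogonal[OF R] ..
    also have "\<dots> = wave_overlap s x y"
      by (subst integral_distr) (auto simp: wave_overlap_def rot)
    finally show ?thesis .
  qed
  then show ?thesis by (simp add: superposed_kernel_def)
qed

text \<open>
  Under \<open>s \<mapsto> r s\<close>, \<open>v \<mapsto> r v\<close> the weight contributes \<open>r\<close> to the power \<open>- lam - 1 - n\<close>, the
  integral over \<open>v\<close> contributes \<open>r\<^sup>n\<close>, and the integral over \<open>s\<close> a factor \<open>r\<close>.
\<close>

lemma superposed_kernel_scale:
  assumes r: "0 < r"
  shows "superposed_kernel lam (r *\<^sub>R x) (r *\<^sub>R y) = r powr (- lam) * superposed_kernel lam x (y :: real^'n)"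
proof -
  let ?n = "CARD('n)"
  have ov: "wave_overlap (r * s) (r *\<^sub>R x) (r *\<^sub>R y) = r ^ ?n * wave_overlap s x y" for s
  proof -
    have "wave_overlap s x y = (LINT v|lborel. wave (r * s) (0 + r *\<^sub>R v) (r *\<^sub>R x) * wave (r * s) (0 + r *\<^sub>R v) (r *\<^sub>R y))"
      unfolding wave_overlap_def wave_def using r by (simp flip: scaleR_right_diff_distrib)
    also have "\<dots> = (1 / r ^ ?n) * wave_overlap (r * s) (r *\<^sub>R x) (r *\<^sub>R y)"
      using r by (subst integral_affine[where f="\<lambda>v. wave (r * s) v (r *\<^sub>R x) * wave (r * s) v (r *\<^sub>R y)"])
        (auto simp: wave_overlap_def)
    finally show ?thesis using r by simp
  qed
  have w: "scale_weight lam ?n (r * s) = r powr (- lam - 1 - real ?n) * scale_weight lam ?n s" for s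
    using r by (auto simp: scale_weight_def indicator_def powr_mult zero_less_mult_iff)
  have "superposed_kernel lam (r *\<^sub>R x) (r *\<^sub>R y) =
      r * (LINT s|lborel. scale_weight lam ?n (0 + r * s) * wave_overlap (0 + r * s) (r *\<^sub>R x) (r *\<^sub>R y))"
    unfolding superposed_kernel_def using r
    by (subst lborel_integral_real_affine[where c=r and t=0]) auto
  also have "\<dots> = r * (LINT s|lborel. (r powr (- lam - 1 - real ?n) * r ^ ?n) * (scale_weight lam ?n s * wave_overlap s x y))"
    unfolding add_0 ov w by (simp only: mult_ac)
  also have "\<dots> = (r powr 1 * r powr (- lam - 1 - real ?n) * r powr real ?n) * superposed_kernel lam x y"
    using r by (simp add: superposed_kernel_def powr_realpow)
  also have "r powr 1 * r powr (- lam - 1 - real ?n) * r powr real ?n = r powr (- lam)"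
    unfolding powr_add[symmetric] by simp
  finally show ?thesis .
qed

text \<open>
  The value at an arbitrary unit vector; \<open>undefined\<close> only selects a coordinate axis.
\<close>

definition kernel_const :: "real \<Rightarrow> 'n::finite itself \<Rightarrow> real" where
  "kernel_const lam _ = superposed_kernel lam (axis undefined 1 :: real^'n) 0"

text \<open>
  Translation moves \<open>y\<close> to 0, a rotation and a dilation then move \<open>x - y\<close> to the reference vector.
\<close>

lemma superposed_kernel_eq:
  fixes x y :: "real^'n"
  assumes "x \<noteq> y"
  shows "superposed_kernel lam x y = kernel_const lam TYPE('n) * norm (x - y) powr (- lam)"
proof -
  define r where "r = norm (x - y)"
  have r: "0 < r" using assms by (simp add: r_def)
  define e where "e = (axis undefined 1 :: real^'n)"
  have "norm (r *\<^sub>R e) = norm (x - y)" by (simp add: e_def r_def)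
  then obtain R where R: "orthogonal_transformation R" "R (r *\<^sub>R e) = x - y"
    by (rule orthogonal_transformation_exists)
  have R0: "R 0 = 0"
    using R(1) by (simp add: linear_0 orthogonal_transformation_linear)
  have "superposed_kernel lam x y = superposed_kernel lam (x - y) 0"
    using superposed_kernel_translate[of lam "x - y" y 0] by simp
  also have "\<dots> = superposed_kernel lam (r *\<^sub>R e) (r *\<^sub>R 0)"
    using superposed_kernel_rotate[OF R(1), of lam "r *\<^sub>R e" 0] by (simp add: R R0)
  also have "\<dots> = r powr (- lam) * superposed_kernel lam e 0"
    by (rule superposed_kernel_scale[OF r])
  finally show ?thesis by (simp add: kernel_const_def e_def r_def mult.commute)
qed


text \<open>
  The two terms govern the small and the large scales; they need \<open>lam < d\<close> and \<open>0 < lam\<close>.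
\<close>

lemma scale_integral_finite:
  assumes "0 < lam" "lam < d"
  shows "(\<integral>\<^sup>+s. ennreal (indicator {0<..1} s * s powr (d - lam - 1) + indicator {1..} s * s powr (- lam - 1)) \<partial>lborel) < \<infinity>"
proof -
  have 1: "(\<integral>\<^sup>+s. ennreal (indicator {0..1} s * s powr (d - lam - 1)) \<partial>lborel) < \<infinity>"
    using nn_integral_has_integral_lebesgue[OF _ has_integral_powr_from_0[of "d - lam - 1" 1]] assms
    by (simp add: ennreal_mult ennreal_indicator)
  have 2: "(\<integral>\<^sup>+s. ennreal (indicator {1..} s * s powr (- lam - 1)) \<partial>lborel) < \<infinity>"
    using nn_integral_has_integral_lebesgue[OF _ has_integral_powr_to_inf[of "- lam - 1" 1]] assms
    by (simp add: ennreal_mult ennreal_indicator)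
  have "(\<integral>\<^sup>+s. ennreal (indicator {0<..1} s * s powr (d - lam - 1) + indicator {1..} s * s powr (- lam - 1)) \<partial>lborel)
      \<le> (\<integral>\<^sup>+s. ennreal (indicator {0..1} s * s powr (d - lam - 1)) + ennreal (indicator {1..} s * s powr (- lam - 1)) \<partial>lborel)"
    by (intro nn_integral_mono) (auto simp: indicator_def simp flip: ennreal_plus)
  also have "\<dots> < \<infinity>"
    using 1 2 by (subst nn_integral_add) auto
  finally show ?thesis .
qed

text \<open>
  At small scales the integral over \<open>x\<close> is bounded through the supremum of \<open>f\<close>, at large scales
  through its \<open>L\<^sup>1\<close> norm. With the bound for the integral over \<open>v\<close> this leaves exactly the integral of
  \<open>scale_integral_finite\<close> over \<open>s\<close>.
\<close>

lemma nn_integral_wave_test: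
  fixes f :: "real^'n \<Rightarrow> complex"
  assumes f: "test_function f"
  obtains K where "0 \<le> K"
    and "\<And>s v. 0 < s \<Longrightarrow> (\<integral>\<^sup>+x. ennreal (\<bar>wave s v x\<bar> * norm (f x)) \<partial>lborel) \<le> ennreal (K * min 1 (s ^ CARD('n)))"
    and "\<And>s. 0 < s \<Longrightarrow> (\<integral>\<^sup>+v. (\<integral>\<^sup>+x. ennreal (\<bar>wave s v x\<bar> * norm (f x)) \<partial>lborel) \<partial>lborel) \<le> ennreal (K * s ^ CARD('n))"
proof -
  let ?n = "CARD('n)" and ?m = "wavelet_mass TYPE('n)"
  have [measurable]: "f \<in> borel_measurable borel" using f by (rule test_functionD)
  obtain M where M: "0 \<le> M" "\<And>x. norm (f x) \<le> M" using test_functionD(3)[OF f] by auto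
  define L where "L = (LINT x|lborel. norm (f x))"
  have L: "0 \<le> L" "(\<integral>\<^sup>+x. ennreal (norm (f x)) \<partial>lborel) = ennreal L"
    unfolding L_def using test_functionD(2)[OF f] by (auto intro: nn_integral_eq_integral)
  define K where "K = M * ?m + 2 ^ ?n * L + ?m * L"
  have K: "0 \<le> K" using M L wavelet_mass_nonneg[where 'n='n] by (auto simp: K_def)
  show ?thesis
  proof (rule that[OF K])
    fix s :: real and v :: "real^'n" assume s: "0 < s"
    have "(\<integral>\<^sup>+x. ennreal (\<bar>wave s v x\<bar> * norm (f x)) \<partial>lborel) \<le> (\<integral>\<^sup>+x. ennreal M * ennreal \<bar>wave s v x\<bar> \<partial>lborel)"
      using M by (intro nn_integral_mono) (auto intro!: mult_right_mono simp flip: ennreal_mult simp: mult.commute[of "\<bar>_\<bar>"])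
    also have "\<dots> = ennreal (M * (s ^ ?n * ?m))"
      using s M wavelet_mass_nonneg[where 'n='n] by (simp add: nn_integral_cmult nn_integral_abs_wave ennreal_mult)
    also have "\<dots> \<le> ennreal (K * s ^ ?n)"
    proof (rule ennreal_leI)
      have "M * ?m * s ^ ?n \<le> K * s ^ ?n"
        using s L wavelet_mass_nonneg[where 'n='n] by (intro mult_right_mono) (auto simp: K_def)
      then show "M * (s ^ ?n * ?m) \<le> K * s ^ ?n" by (simp add: mult_ac)
    qed
    finally have 1: "(\<integral>\<^sup>+x. ennreal (\<bar>wave s v x\<bar> * norm (f x)) \<partial>lborel) \<le> ennreal (K * s ^ ?n)" .
    have "(\<integral>\<^sup>+x. ennreal (\<bar>wave s v x\<bar> * norm (f x)) \<partial>lborel) \<le> (\<integral>\<^sup>+x. ennreal (2 ^ ?n) * ennreal (norm (f x)) \<partial>lborel)"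
      using wave_bound[where 'n='n] by (intro nn_integral_mono) (auto intro!: mult_right_mono simp flip: ennreal_mult)
    also have "\<dots> = ennreal (2 ^ ?n * L)"
      using L by (simp add: nn_integral_cmult ennreal_mult)
    also have "\<dots> \<le> ennreal K"
      using M L wavelet_mass_nonneg[where 'n='n] by (intro ennreal_leI) (auto simp: K_def)
    finally show "(\<integral>\<^sup>+x. ennreal (\<bar>wave s v x\<bar> * norm (f x)) \<partial>lborel) \<le> ennreal (K * min 1 (s ^ ?n))"
      using 1 by (auto simp: min_def)
  next
    fix s :: real assume s: "0 < s"
    have "(\<integral>\<^sup>+v. (\<integral>\<^sup>+x. ennreal (\<bar>wave s v x\<bar> * norm (f x)) \<partial>lborel) \<partial>lborel)
        = (\<integral>\<^sup>+x. (\<integral>\<^sup>+v. ennreal (\<bar>wave s v x\<bar> * norm (f x)) \<partial>lborel) \<partial>lborel)"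
      by (rule lborel_pair.Fubini') measurable
    also have "\<dots> = (\<integral>\<^sup>+x. ennreal (s ^ ?n * ?m) * ennreal (norm (f x)) \<partial>lborel)"
      using s by (intro nn_integral_cong) (simp add: ennreal_mult nn_integral_multc nn_integral_abs_wave)
    also have "\<dots> = ennreal (s ^ ?n * ?m * L)"
      using s L wavelet_mass_nonneg[where 'n='n] by (simp add: nn_integral_cmult ennreal_mult)
    also have "\<dots> \<le> ennreal (K * s ^ ?n)"
    proof (rule ennreal_leI)
      have "?m * L * s ^ ?n \<le> K * s ^ ?n"
        using s M L wavelet_mass_nonneg[where 'n='n] by (intro mult_right_mono) (auto simp: K_def)
      then show "s ^ ?n * ?m * L \<le> K * s ^ ?n" by (simp add: mult_ac)
    qed
    finally show "(\<integral>\<^sup>+v. (\<integral>\<^sup>+x. ennreal (\<bar>wave s v x\<bar> * norm (f x)) \<partial>lborel) \<partial>lborel) \<le> ennreal (K * s ^ ?n)" .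
  qed
qed

lemma wave_superposition_integrable:
  fixes f g :: "real^'n \<Rightarrow> complex"
  assumes lam: "0 < lam" "lam < real CARD('n)" and f: "test_function f" and g: "test_function g"
  shows "integrable (lborel \<Otimes>\<^sub>M lborel) (\<lambda>((s, v), (x, y)).
    of_real (scale_weight lam CARD('n) s) * (of_real (wave s v x) * g x) * (of_real (wave s v y) * f y))"
    (is "integrable _ ?H")
proof (rule integrableI_bounded)
  let ?n = "CARD('n)" and ?w = "scale_weight lam CARD('n)"
  have [measurable]: "f \<in> borel_measurable borel" "g \<in> borel_measurable borel"
    using f g by (simp_all add: test_functionD)
  have H: "?H \<in> borel_measurable ((lborel \<Otimes>\<^sub>M lborel) \<Otimes>\<^sub>M (lborel \<Otimes>\<^sub>M lborel))"
    unfolding split_beta' by measurable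
  then show "?H \<in> borel_measurable (lborel \<Otimes>\<^sub>M lborel)" by (simp add: lborel_prod)
  obtain K where K: "0 \<le> K"
    and K1: "\<And>s v. 0 < s \<Longrightarrow> (\<integral>\<^sup>+x. ennreal (\<bar>wave s v x\<bar> * norm (f x)) \<partial>lborel) \<le> ennreal (K * min 1 (s ^ ?n))"
    by (rule nn_integral_wave_test[OF f]) (rule that; assumption)
  obtain K' where K': "0 \<le> K'"
    and K'1: "\<And>s. 0 < s \<Longrightarrow> (\<integral>\<^sup>+v. (\<integral>\<^sup>+x. ennreal (\<bar>wave s v x\<bar> * norm (g x)) \<partial>lborel) \<partial>lborel) \<le> ennreal (K' * s ^ ?n)"
    by (rule nn_integral_wave_test[OF g]) (rule that; assumption)
  have "(\<integral>\<^sup>+p. ennreal (norm (?H p)) \<partial>(lborel \<Otimes>\<^sub>M lborel))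
      = (\<integral>\<^sup>+p. ennreal (norm (?H p)) \<partial>((lborel \<Otimes>\<^sub>M lborel) \<Otimes>\<^sub>M (lborel \<Otimes>\<^sub>M lborel)))"
    by (simp add: lborel_prod)
  also have "\<dots> = (\<integral>\<^sup>+p. \<integral>\<^sup>+q. ennreal (norm (?H (p, q))) \<partial>(lborel \<Otimes>\<^sub>M lborel) \<partial>(lborel \<Otimes>\<^sub>M lborel))"
  proof (rule sigma_finite_measure.nn_integral_fst[symmetric])
    show "sigma_finite_measure (lborel \<Otimes>\<^sub>M lborel :: ((real^'n) \<times> (real^'n)) measure)"
      unfolding lborel_prod by (rule lborel.sigma_finite_measure_axioms)
    show "(\<lambda>p. ennreal (norm (?H p))) \<in> borel_measurable ((lborel \<Otimes>\<^sub>M lborel) \<Otimes>\<^sub>M (lborel \<Otimes>\<^sub>M lborel))"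
      by (rule measurable_compose[OF H, where g="\<lambda>z. ennreal (norm z)"]) measurable
  qed
  also have "\<dots> = (\<integral>\<^sup>+s. \<integral>\<^sup>+v. \<integral>\<^sup>+q. ennreal (norm (?H ((s, v), q))) \<partial>(lborel \<Otimes>\<^sub>M lborel) \<partial>lborel \<partial>lborel)"
    by (rule lborel.nn_integral_fst[symmetric]) (simp_all only: split_beta' fst_conv snd_conv, measurable)
  also have "\<dots> = (\<integral>\<^sup>+s. \<integral>\<^sup>+v. \<integral>\<^sup>+x. \<integral>\<^sup>+y. ennreal (norm (?H ((s, v), (x, y)))) \<partial>lborel \<partial>lborel \<partial>lborel \<partial>lborel)"
    by (intro nn_integral_cong lborel.nn_integral_fst[symmetric]) (simp_all only: split_beta' fst_conv snd_conv, measurable)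
  also have "\<dots> \<le> (\<integral>\<^sup>+s. ennreal (K * K') * ennreal (indicator {0<..1} s * s powr (real ?n - lam - 1) + indicator {1..} s * s powr (- lam - 1)) \<partial>lborel)"
  proof (rule nn_integral_mono)
    fix s :: real
    have eq: "(\<integral>\<^sup>+x. \<integral>\<^sup>+y. ennreal (norm (?H ((s, v), (x, y)))) \<partial>lborel \<partial>lborel)
        = ennreal (?w s) * ((\<integral>\<^sup>+x. ennreal (\<bar>wave s v x\<bar> * norm (g x)) \<partial>lborel) * (\<integral>\<^sup>+y. ennreal (\<bar>wave s v y\<bar> * norm (f y)) \<partial>lborel))" for v
    proof -
      have "(\<integral>\<^sup>+x. \<integral>\<^sup>+y. ennreal (norm (?H ((s, v), (x, y)))) \<partial>lborel \<partial>lborel)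
          = (\<integral>\<^sup>+x. \<integral>\<^sup>+y. (ennreal (?w s) * ennreal (\<bar>wave s v x\<bar> * norm (g x))) * ennreal (\<bar>wave s v y\<bar> * norm (f y)) \<partial>lborel \<partial>lborel)"
        by (simp add: norm_mult scale_weight_nonneg flip: ennreal_mult)
      also have "\<dots> = ennreal (?w s) * ((\<integral>\<^sup>+x. ennreal (\<bar>wave s v x\<bar> * norm (g x)) \<partial>lborel) * (\<integral>\<^sup>+y. ennreal (\<bar>wave s v y\<bar> * norm (f y)) \<partial>lborel))"
        by (simp add: nn_integral_cmult nn_integral_multc mult.assoc)
      finally show ?thesis .
    qed
    show "(\<integral>\<^sup>+v. \<integral>\<^sup>+x. \<integral>\<^sup>+y. ennreal (norm (?H ((s, v), (x, y)))) \<partial>lborel \<partial>lborel \<partial>lborel)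
        \<le> ennreal (K * K') * ennreal (indicator {0<..1} s * s powr (real ?n - lam - 1) + indicator {1..} s * s powr (- lam - 1))"
    proof (cases "0 < s")
      case False
      then show ?thesis unfolding eq by (simp add: scale_weight_def)
    next
      case s: True
      have "(\<integral>\<^sup>+v. ennreal (?w s) * ((\<integral>\<^sup>+x. ennreal (\<bar>wave s v x\<bar> * norm (g x)) \<partial>lborel) * (\<integral>\<^sup>+y. ennreal (\<bar>wave s v y\<bar> * norm (f y)) \<partial>lborel)) \<partial>lborel)
         \<le> (\<integral>\<^sup>+v. ennreal (?w s) * ((\<integral>\<^sup>+x. ennreal (\<bar>wave s v x\<bar> * norm (g x)) \<partial>lborel) * ennreal (K * min 1 (s ^ ?n))) \<partial>lborel)"
        by (intro nn_integral_mono mult_left_mono K1 s) auto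
      also have "\<dots> = ennreal (?w s) * ((\<integral>\<^sup>+v. \<integral>\<^sup>+x. ennreal (\<bar>wave s v x\<bar> * norm (g x)) \<partial>lborel \<partial>lborel) * ennreal (K * min 1 (s ^ ?n)))"
        by (simp add: nn_integral_cmult nn_integral_multc)
      also have "\<dots> \<le> ennreal (?w s) * (ennreal (K' * s ^ ?n) * ennreal (K * min 1 (s ^ ?n)))"
        by (intro mult_left_mono mult_right_mono K'1 s) auto
      also have "\<dots> = ennreal (?w s * ((K' * s ^ ?n) * (K * min 1 (s ^ ?n))))"
      proof -
        have "0 \<le> ?w s" "0 \<le> K' * s ^ ?n" "0 \<le> K * min 1 (s ^ ?n)"
          using K K' s by (simp_all add: scale_weight_nonneg)
        then show ?thesis by (simp only: ennreal_mult mult_nonneg_nonneg)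
      qed
      also have "?w s * ((K' * s ^ ?n) * (K * min 1 (s ^ ?n))) = K * K' * (?w s * s ^ ?n * min 1 (s ^ ?n))"
        by (simp only: mult_ac)
      also have "\<dots> \<le> ennreal (K * K' * (indicator {0<..1} s * s powr (real ?n - lam - 1) + indicator {1..} s * s powr (- lam - 1)))"
      proof (intro ennreal_leI mult_left_mono)
        have 1: "?w s * s ^ ?n = s powr (- lam - 1)"
          using s by (simp add: scale_weight_def flip: powr_realpow powr_add)
        have 2: "s powr (- lam - 1) * s ^ ?n = s powr (real ?n - lam - 1)"
          using s by (simp add: algebra_simps flip: powr_realpow powr_add)
        show "?w s * s ^ ?n * min 1 (s ^ ?n) \<le> indicator {0<..1} s * s powr (real ?n - lam - 1) + indicator {1..} s * s powr (- lam - 1)"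
        proof (cases "s \<le> 1")
          case True
          then have "min 1 (s ^ ?n) = s ^ ?n" using s by (simp add: power_le_one)
          then show ?thesis using 1 2 s True by (auto simp: indicator_def)
        next
          case False
          then show ?thesis using 1 s by (auto simp: indicator_def)
        qed
        show "0 \<le> K * K'" using K K' by simp
      qed
      also have "\<dots> = ennreal (K * K') * ennreal (indicator {0<..1} s * s powr (real ?n - lam - 1) + indicator {1..} s * s powr (- lam - 1))"
        by (rule ennreal_mult) (use K K' in auto)
      finally show ?thesis unfolding eq .
    qed
  qed
  also have "\<dots> < \<infinity>"
    using scale_integral_finite[OF lam] by (subst nn_integral_cmult) (auto simp: ennreal_mult_less_top)
  finally show "(\<integral>\<^sup>+p. ennreal (norm (?H p)) \<partial>(lborel \<Otimes>\<^sub>M lborel)) < \<infinity>" .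
qed


lemma integrable_wave_mult:
  assumes "test_function f"
  shows "integrable lborel (\<lambda>x. of_real (wave s v x) * f x)"
proof (rule Bochner_Integration.integrable_bound)
  have [measurable]: "f \<in> borel_measurable borel" using assms by (rule test_functionD)
  show "(\<lambda>x. of_real (wave s v x) * f x) \<in> borel_measurable lborel" by measurable
  show "integrable lborel (\<lambda>x. 2 ^ CARD('a) * f x)"
    using test_functionD(2)[OF assms] by simp
  show "AE x in lborel. norm (of_real (wave s v x) * f x) \<le> norm (2 ^ CARD('a) * f x)"
  proof (rule AE_I2)
    fix x
    have "\<bar>wave s v x\<bar> * norm (f x) \<le> 2 ^ CARD('a) * norm (f x)"
      by (intro mult_right_mono wave_bound norm_ge_zero)
    then show "norm (of_real (wave s v x) * f x) \<le> norm (2 ^ CARD('a) * f x)"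
      by (simp add: norm_mult norm_power)
  qed
qed

lemma AE_off_diagonal: "AE p in lborel \<Otimes>\<^sub>M lborel. fst p \<noteq> snd (p :: (real^'n) \<times> (real^'n))"
proof -
  have "AE y in lborel. x \<noteq> y" for x :: "real^'n"
    using AE_lborel_singleton[of x] by (rule eventually_mono) auto
  then have "AE x in lborel. AE y in lborel. x \<noteq> (y :: real^'n)"
    by simp
  then have "AE p in lborel \<Otimes>\<^sub>M (lborel :: (real^'n) measure). case p of (x, y) \<Rightarrow> x \<noteq> y"
  proof (intro lborel_pair.AE_pair_measure)
    have "open {p :: (real^'n) \<times> (real^'n). fst p \<noteq> snd p}"
      by (intro open_Collect_neq continuous_intros)
    then have "{p :: (real^'n) \<times> (real^'n). fst p \<noteq> snd p} \<in> sets (borel \<Otimes>\<^sub>M borel)"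
      unfolding borel_prod by simp
    then show "{p \<in> space (lborel \<Otimes>\<^sub>M lborel). case p of (x, y) \<Rightarrow> x \<noteq> (y :: real^'n)} \<in> sets (lborel \<Otimes>\<^sub>M lborel)"
      by (simp add: split_beta' space_pair_measure)
  qed simp
  then show ?thesis by (simp add: split_beta')
qed

text \<open>
  Fubini for the integrand of \<open>wave_superposition_integrable\<close>: integrating over \<open>x\<close> and \<open>y\<close> first
  gives products of wave coefficients, integrating over \<open>s\<close> and \<open>v\<close> first gives the kernel.
\<close>

lemma
  fixes f g :: "real^'n \<Rightarrow> complex"
  assumes lam: "0 < lam" "lam < real CARD('n)" and f: "test_function f" and g: "test_function g"
  shows wave_energy_integrable: "integrable (lborel \<Otimes>\<^sub>M lborel) (\<lambda>(s, v).
      of_real (scale_weight lam CARD('n) s) * wave_coeff s v g * wave_coeff s v f)" (is ?int)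
    and kernel_energy_integrable: "integrable (lborel \<Otimes>\<^sub>M lborel)
      (\<lambda>(x, y). of_real (superposed_kernel lam x y) * (g x * f y))" (is ?int2)
    and wave_energy_eq: "integral\<^sup>L (lborel \<Otimes>\<^sub>M lborel) (\<lambda>(s, v).
        of_real (scale_weight lam CARD('n) s) * wave_coeff s v g * wave_coeff s v f)
      = integral\<^sup>L (lborel \<Otimes>\<^sub>M lborel) (\<lambda>(x, y).
        of_real (superposed_kernel lam x y) * (g x * f y))" (is ?eq)
proof -
  let ?n = "CARD('n)" and ?w = "scale_weight lam CARD('n)"
  let ?H = "\<lambda>(s, v) (x, y). of_real (?w s) * (of_real (wave s v x) * g x) * (of_real (wave s v y) * f y)"
  have [measurable]: "f \<in> borel_measurable borel" "g \<in> borel_measurable borel"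
    using f g by (simp_all add: test_functionD)
  have H: "integrable (lborel \<Otimes>\<^sub>M lborel) (case_prod ?H)"
    by (rule wave_superposition_integrable[OF lam f g])
  have inner: "(LINT q|lborel. ?H p q) = (case p of (s, v) \<Rightarrow> of_real (?w s) * wave_coeff s v g * wave_coeff s v f)"
    if "integrable lborel (\<lambda>q. ?H p q)" for p
  proof -
    obtain s v where p: "p = (s, v)" by fastforce
    have i: "integrable (lborel \<Otimes>\<^sub>M lborel) (case_prod (\<lambda>x y. of_real (?w s) * (of_real (wave s v x) * g x) * (of_real (wave s v y) * f y)))"
      using that unfolding p lborel_prod by (simp only: prod.case)
    show ?thesis
      using lborel_pair.integral_fst[OF i] unfolding p lborel_prod wave_coeff_def
      by (simp only: prod.case integral_mult_right_zero integral_mult_left_zero)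
  qed
  have AE1: "AE p in lborel. (LINT q|lborel. ?H p q) = (case p of (s, v) \<Rightarrow> of_real (?w s) * wave_coeff s v g * wave_coeff s v f)"
    using lborel_pair.AE_integrable_fst[OF H] by (rule eventually_mono) (rule inner)
  have [measurable]: "(\<lambda>(s, v). of_real (?w s) * wave_coeff s v g * wave_coeff s v f) \<in> borel_measurable (lborel \<Otimes>\<^sub>M lborel)"
    unfolding wave_coeff_def split_beta' by measurable
  have m1: "(\<lambda>(s, v). of_real (?w s) * wave_coeff s v g * wave_coeff s v f) \<in> borel_measurable lborel"
    unfolding lborel_prod[symmetric] by measurable
  have m1': "(\<lambda>p. LINT q|lborel. ?H p q) \<in> borel_measurable lborel"
    using lborel_pair.integrable_fst[OF H] by (rule borel_measurable_integrable)
  show ?int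
    unfolding lborel_prod
    by (rule iffD1[OF integrable_cong_AE[OF m1' m1 AE1] lborel_pair.integrable_fst[OF H]])
  have eq1: "integral\<^sup>L lborel (\<lambda>(s, v). of_real (?w s) * wave_coeff s v g * wave_coeff s v f) = integral\<^sup>L (lborel \<Otimes>\<^sub>M lborel) (case_prod ?H)"
    by (rule trans[OF integral_cong_AE[OF m1' m1 AE1, symmetric] lborel_pair.integral_fst[OF H]])
  have inner2: "(LINT p|lborel. ?H p q) = (case q of (x, y) \<Rightarrow> of_real (superposed_kernel lam x y) * (g x * f y))"
    if "integrable lborel (\<lambda>p. ?H p q)" for q
  proof -
    obtain x y where q: "q = (x, y)" by fastforce
    have i: "integrable (lborel \<Otimes>\<^sub>M lborel) (case_prod (\<lambda>s v. of_real (?w s) * (of_real (wave s v x) * g x) * (of_real (wave s v y) * f y)))"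
      using that unfolding q lborel_prod by (simp only: split_beta' fst_conv snd_conv)
    have "(LINT p|lborel. ?H p q) = (LINT s|lborel. LINT v|lborel. of_real (?w s) * (of_real (wave s v x) * g x) * (of_real (wave s v y) * f y))"
      using lborel_pair.integral_fst[OF i] unfolding q lborel_prod by (simp only: split_beta' fst_conv snd_conv)
    also have "\<dots> = (LINT s|lborel. LINT v|lborel. of_real (?w s * (wave s v x * wave s v y)) * (g x * f y))"
      by (simp only: of_real_mult mult_ac)
    also have "\<dots> = of_real (superposed_kernel lam x y) * (g x * f y)"
      by (simp only: integral_mult_left_zero integral_complex_of_real integral_mult_right_zero
          superposed_kernel_def wave_overlap_def)
    finally show ?thesis by (simp add: q)
  qed
  have AE2: "AE q in lborel. (LINT p|lborel. ?H p q) = (case q of (x, y) \<Rightarrow> of_real (superposed_kernel lam x y) * (g x * f y))"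
    using lborel_pair.AE_integrable_snd[OF H] by (rule eventually_mono) (rule inner2)
  have [measurable]: "(\<lambda>(x, y). of_real (superposed_kernel lam x y) * (g x * f y)) \<in> borel_measurable (lborel \<Otimes>\<^sub>M lborel)"
    using superposed_kernel_measurable unfolding split_beta' by measurable
  have m2: "(\<lambda>(x, y). of_real (superposed_kernel lam x y) * (g x * f y)) \<in> borel_measurable lborel"
    unfolding lborel_prod[symmetric] by measurable
  have m2': "(\<lambda>q. LINT p|lborel. ?H p q) \<in> borel_measurable lborel"
    using lborel_pair.integrable_snd[OF H] by (rule borel_measurable_integrable)
  show ?int2
    unfolding lborel_prod
    by (rule iffD1[OF integrable_cong_AE[OF m2' m2 AE2] lborel_pair.integrable_snd[OF H]])
  have eq2: "integral\<^sup>L lborel (\<lambda>(x, y). of_real (superposed_kernel lam x y) * (g x * f y)) = integral\<^sup>L (lborel \<Otimes>\<^sub>M lborel) (case_prod ?H)"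
    by (rule trans[OF integral_cong_AE[OF m2' m2 AE2, symmetric] lborel_pair.integral_snd[OF H]])
  show ?eq unfolding lborel_prod by (rule trans[OF eq1 eq2[symmetric]])
qed


text \<open>
  If the constant were 0, the kernel would vanish off the diagonal and the integral of the weighted
  squares of the wave coefficients would be 0 for \<open>g = f\<close>. For the indicator function of the unit
  ball, however, the wave coefficients are negative at all large scales near the origin.
\<close>

lemma kernel_const_nonzero:
  assumes lam: "0 < lam" "lam < real CARD('n::finite)"
  shows "kernel_const lam TYPE('n) \<noteq> 0"
proof
  assume c0: "kernel_const lam TYPE('n) = 0"
  let ?w = "scale_weight lam CARD('n)"
  let ?B = "ball 0 1 :: (real^'n) set"
  define f :: "real^'n \<Rightarrow> complex" where "f = indicator ?B"
  have f: "test_function f"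
    unfolding test_function_def
  proof (intro conjI)
    show "f \<in> borel_measurable borel" unfolding f_def by (rule borel_measurable_indicator) simp
    show "\<exists>M. \<forall>x. norm (f x) \<le> M" by (intro exI[of _ 1]) (simp add: f_def indicator_def)
    show "\<exists>R. \<forall>x. R < norm x \<longrightarrow> f x = 0" by (intro exI[of _ 1]) (simp add: f_def indicator_def)
  qed
  define q where "q s v = (LINT x|lborel. wave s v x * indicator ?B x)" for s v
  have iB: "integrable lborel (indicator ?B :: real^'n \<Rightarrow> real)"
    using emeasure_lborel_ball_finite[of "0::real^'n" 1] by (intro integrable_real_indicator) auto
  have co: "wave_coeff s v f = of_real (q s v)" for s v
  proof -
    have "wave_coeff s v f = (LINT x|lborel. of_real (wave s v x * indicator ?B x))"
      unfolding wave_coeff_def f_def by (intro Bochner_Integration.integral_cong) (auto simp: indicator_def)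
    then show ?thesis by (simp only: integral_complex_of_real q_def)
  qed
  have int: "integrable (lborel \<Otimes>\<^sub>M lborel) (\<lambda>p. ?w (fst p) * (q (fst p) (snd p))\<^sup>2)"
  proof -
    have "integrable (lborel \<Otimes>\<^sub>M lborel) (\<lambda>p. complex_of_real (?w (fst p) * (q (fst p) (snd p))\<^sup>2))"
      using wave_energy_integrable[OF lam f f] unfolding split_beta' co by (simp add: power2_eq_square mult.assoc)
    then show ?thesis by (simp only: complex_of_real_integrable_eq)
  qed
  have "complex_of_real (LINT p|(lborel \<Otimes>\<^sub>M lborel). ?w (fst p) * (q (fst p) (snd p))\<^sup>2)
      = integral\<^sup>L (lborel \<Otimes>\<^sub>M lborel) (\<lambda>(s, v). of_real (?w s) * wave_coeff s v f * wave_coeff s v f)"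
    unfolding integral_complex_of_real[symmetric] split_beta' co by (simp add: power2_eq_square mult.assoc)
  also have "\<dots> = integral\<^sup>L (lborel \<Otimes>\<^sub>M lborel) (\<lambda>(x, y). of_real (superposed_kernel lam x y) * (f x * f y))"
    by (rule wave_energy_eq[OF lam f f])
  also have "\<dots> = 0"
  proof (rule integral_eq_zero_AE)
    show "AE p in lborel \<Otimes>\<^sub>M lborel. (case p of (x, y) \<Rightarrow> of_real (superposed_kernel lam x y) * (f x * f y)) = 0"
      using AE_off_diagonal by (rule eventually_mono) (auto simp: superposed_kernel_eq c0)
  qed
  finally have "(LINT p|(lborel \<Otimes>\<^sub>M lborel). ?w (fst p) * (q (fst p) (snd p))\<^sup>2) = 0"
    by (simp only: of_real_eq_0_iff)
  then have AE0: "AE p in lborel \<Otimes>\<^sub>M lborel. ?w (fst p) * (q (fst p) (snd p))\<^sup>2 = 0"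
    using integral_nonneg_eq_0_iff_AE[OF int] by (simp add: scale_weight_nonneg)
  \<comment> \<open>For \<open>s > 16\<close> and \<open>v\<close>, \<open>x\<close> in the unit ball, \<open>(x - v) / s\<close> lies in the ball of radius \<open>1 / 8\<close>.\<close>
  let ?U = "{16<..<17::real} \<times> ?B"
  have pos: "?w s * (q s v)\<^sup>2 \<noteq> 0" if s: "16 < s" and v: "norm v < 1" for s v
  proof -
    have le: "wave s v x * indicator ?B x \<le> - (1/2) * indicator ?B x" for x
    proof (cases "norm x < 1")
      case True
      have "norm (x - v) \<le> 2" using norm_triangle_ineq4[of x v] True v by linarith
      then have "norm ((1 / s) *\<^sub>R (x - v)) \<le> 1 / 8"
        using s by (simp add: divide_le_eq del: scaleR_right_diff_distrib)
      then have "wave s v x \<le> - 1 / 2" unfolding wave_def by (rule wavelet_near_0)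
      then show ?thesis using True by simp
    qed simp
    have i1: "integrable lborel (\<lambda>x. wave s v x * indicator ?B x)"
      using integrable_mult_indicator[of ?B lborel "wave s v"] integral_wave(1)[of s v] s
      by (simp add: mult.commute)
    have "q s v \<le> (LINT x|lborel. - (1/2) * indicator ?B x)"
      unfolding q_def using iB by (intro integral_mono le i1) simp
    also have "\<dots> = - (1/2) * measure lborel ?B" by simp
    also have "\<dots> < 0" using content_ball_pos[of 1 "0::real^'n"] by simp
    finally show ?thesis using s by (simp add: scale_weight_def)
  qed
  have U: "?U \<in> sets (lborel \<Otimes>\<^sub>M lborel)" by simp
  have "AE p in lborel \<Otimes>\<^sub>M lborel. p \<notin> ?U"
    using AE0 by (rule eventually_mono) (use pos in force)
  then have "emeasure (lborel \<Otimes>\<^sub>M lborel) ?U = 0"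
    using AE_iff_null_sets[OF U] by auto
  moreover have "emeasure (lborel \<Otimes>\<^sub>M lborel) ?U = emeasure lborel ?B"
    by (subst lborel.emeasure_pair_measure_Times) auto
  ultimately show False
    using content_ball_pos[of 1 "0::real^'n"] by (simp add: measure_def)
qed

text \<open>
  The continuous form of the representation: integrating over all scales and positions gives back the
  fractional integral. Off the diagonal the kernel is a nonzero multiple of \<open>\<bar>x - y\<bar>\<^sup>-\<^sup>l\<^sup>a\<^sup>m\<close>, so the
  integrability passes from one to the other.
\<close>

lemma
  fixes f g :: "real^'n \<Rightarrow> complex"
  assumes lam: "0 < lam" "lam < real CARD('n)" and f: "test_function f" and g: "test_function g"
  shows kernel_pairing_integrable: "integrable (lborel \<Otimes>\<^sub>M lborel)
      (\<lambda>(x, y). g x * (f y / of_real (norm (x - y) powr lam)))" (is ?int)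
    and wave_reproducing: "integral\<^sup>L (lborel \<Otimes>\<^sub>M lborel) (\<lambda>(s, v).
        of_real (scale_weight lam CARD('n) s) * wave_coeff s v g * wave_coeff s v f)
      = of_real (kernel_const lam TYPE('n)) *
        integral\<^sup>L (lborel \<Otimes>\<^sub>M lborel) (\<lambda>(x, y). g x * (f y / of_real (norm (x - y) powr lam)))" (is ?eq)
proof -
  let ?c = "complex_of_real (kernel_const lam TYPE('n))"
  have [measurable]: "f \<in> borel_measurable borel" "g \<in> borel_measurable borel"
    using f g by (simp_all add: test_functionD)
  have c: "?c \<noteq> 0" using kernel_const_nonzero[OF lam] by simp
  have AE: "AE p in lborel \<Otimes>\<^sub>M lborel. (case p of (x, y) \<Rightarrow> of_real (superposed_kernel lam x y) * (g x * f y))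
      = ?c * (case p of (x, y) \<Rightarrow> g x * (f y / of_real (norm (x - y) powr lam)))"
    using AE_off_diagonal by (rule eventually_mono) (auto simp: superposed_kernel_eq powr_minus divide_simps)
  have m1: "(\<lambda>(x, y). of_real (superposed_kernel lam x y) * (g x * f y)) \<in> borel_measurable (lborel \<Otimes>\<^sub>M lborel)"
    using kernel_energy_integrable[OF lam f g] by (rule borel_measurable_integrable)
  have m2: "(\<lambda>p. ?c * (case p of (x, y) \<Rightarrow> g x * (f y / of_real (norm (x - y) powr lam)))) \<in> borel_measurable (lborel \<Otimes>\<^sub>M lborel)"
    unfolding split_beta' by measurable
  have "integrable (lborel \<Otimes>\<^sub>M lborel) (\<lambda>p. ?c * (case p of (x, y) \<Rightarrow> g x * (f y / of_real (norm (x - y) powr lam))))"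
    by (rule iffD1[OF integrable_cong_AE[OF m1 m2 AE] kernel_energy_integrable[OF lam f g]])
  from integrable_mult_right[OF this, of "inverse ?c"] show ?int using c by (simp add: mult.assoc[symmetric])
  show ?eq
    unfolding wave_energy_eq[OF lam f g] integral_cong_AE[OF m1 m2 AE] by (rule integral_mult_right_zero)
qed

section \<open>Half-open cubes and the dyadic grids\<close>

definition cube :: "real^'n \<Rightarrow> real \<Rightarrow> (real^'n) set" where
  "cube a l = {x. \<forall>r. a $ r \<le> x $ r \<and> x $ r < a $ r + l}"

lemma two_powi_less_iff: "(2::real) powi a < 2 powi b \<longleftrightarrow> a < b"
  using power_int_strict_increasing[of a b "2::real"] power_int_increasing[of b a "2::real"]
  by (meson linorder_not_less one_le_numeral one_less_numeral_iff semiring_norm(76))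

lemma two_powi_inject: "(2::real) powi a = 2 powi b \<longleftrightarrow> a = b"
  using two_powi_less_iff[of a b] two_powi_less_iff[of b a] by auto

lemma cube_image: "0 < l \<Longrightarrow> (\<lambda>x. a + l *\<^sub>R x) ` unit_cube = cube a l"
proof (intro equalityI subsetI)
  fix x assume l: "0 < l" and x: "x \<in> cube a l"
  have "0 \<le> (x $ r - a $ r) / l \<and> (x $ r - a $ r) / l < 1" for r
    using x l by (simp add: cube_def divide_less_eq diff_less_eq add.commute)
  then have "(1 / l) *\<^sub>R (x - a) \<in> unit_cube"
    by (simp add: unit_cube_def del: scaleR_right_diff_distrib)
  then have "a + l *\<^sub>R ((1 / l) *\<^sub>R (x - a)) \<in> (\<lambda>x. a + l *\<^sub>R x) ` unit_cube"
    by (rule imageI)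
  then show "x \<in> (\<lambda>x. a + l *\<^sub>R x) ` unit_cube" using l by (simp add: scaleR_right_diff_distrib)
qed (auto simp: cube_def unit_cube_def)

lemma cube_proj:
  assumes "0 < l"
  shows "(\<lambda>x. x $ r) ` cube a l = {a $ r..<a $ r + l}"
proof (intro equalityI subsetI)
  fix t assume t: "t \<in> {a $ r..<a $ r + l}"
  then have "(\<chi> i. if i = r then t else a $ i) \<in> cube a l" using assms by (auto simp: cube_def)
  then have "(\<chi> i. if i = r then t else a $ i) $ r \<in> (\<lambda>x. x $ r) ` cube a l" by (rule imageI)
  then show "t \<in> (\<lambda>x. x $ r) ` cube a l" by simp
qed (auto simp: cube_def)

lemma cube_inject:
  assumes "0 < l" "0 < l'" and eq: "cube a l = cube a' l'"
  shows "a = a' \<and> l = l'"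
proof -
  have *: "a $ r = a' $ r \<and> l = l'" for r
  proof -
    have e: "{a $ r..<a $ r + l} = {a' $ r..<a' $ r + l'}"
      using cube_proj[OF assms(1), of r a] cube_proj[OF assms(2), of r a'] eq by metis
    have "Inf {a $ r..<a $ r + l} = a $ r" "Inf {a' $ r..<a' $ r + l'} = a' $ r"
      "Sup {a $ r..<a $ r + l} = a $ r + l" "Sup {a' $ r..<a' $ r + l'} = a' $ r + l'"
      using assms by simp_all
    then show ?thesis using e by (metis add_left_cancel)
  qed
  then show ?thesis by (auto simp: vec_eq_iff)
qed

lemma side_length_cube:
  assumes "0 < l"
  shows "side_length (cube a l) = l"
  unfolding side_length_def
proof (rule the_equality)
  show "0 < l \<and> (\<exists>c. cube a l = (\<lambda>x. c + l *\<^sub>R x) ` unit_cube)"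
    using assms cube_image by blast
  fix l' assume "0 < l' \<and> (\<exists>c. cube a l = (\<lambda>x. c + l' *\<^sub>R x) ` unit_cube)"
  then obtain c where "0 < l'" "cube a l = cube c l'" using cube_image by metis
  then show "l' = l" using cube_inject[OF assms] by metis
qed

lemma cube_ne: "0 < l \<Longrightarrow> a \<in> cube a l"
  by (simp add: cube_def)

lemma std_dyadic_level_eq:
  "std_dyadic_level k = range (\<lambda>m :: 'n \<Rightarrow> int. cube (2 powi (- k) *\<^sub>R (\<chi> r. of_int (m r)) :: real^'n) (2 powi (- k)))"
proof -
  have im: "(\<lambda>x. (2 powi (- k)) *\<^sub>R (x + m)) ` unit_cube = cube (2 powi (- k) *\<^sub>R m) (2 powi (- k))" for m :: "real^'n"
    by (subst cube_image[symmetric]) (auto simp: algebra_simps)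
  show ?thesis
  proof (intro equalityI subsetI)
    fix I assume "I \<in> (std_dyadic_level k :: (real^'n) set set)"
    then obtain m where m: "\<forall>r. m $ r \<in> \<int>" and I: "I = cube (2 powi (- k) *\<^sub>R m) (2 powi (- k))"
      by (auto simp: std_dyadic_level_def im)
    have "m = (\<chi> r. of_int \<lfloor>m $ r\<rfloor>)" using m by (simp add: vec_eq_iff)
    then show "I \<in> range (\<lambda>m :: 'n \<Rightarrow> int. cube (2 powi (- k) *\<^sub>R (\<chi> r. of_int (m r))) (2 powi (- k)))"
      using I by (intro image_eqI[of _ _ "\<lambda>r. \<lfloor>m $ r\<rfloor>"]) auto
  next
    fix I assume "I \<in> range (\<lambda>m :: 'n \<Rightarrow> int. cube (2 powi (- k) *\<^sub>R (\<chi> r. of_int (m r)) :: real^'n) (2 powi (- k)))"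
    then obtain m :: "'n \<Rightarrow> int" where "I = cube (2 powi (- k) *\<^sub>R (\<chi> r. of_int (m r))) (2 powi (- k))" by auto
    then show "I \<in> std_dyadic_level k"
      unfolding std_dyadic_level_def im by (auto intro!: exI[of _ "\<chi> r. of_int (m r)"])
  qed
qed

text \<open>
  The common translation of all cubes of level \<open>k\<close>: a cube of side \<open>2\<^sup>-\<^sup>k\<close> is moved by the
  digits \<open>j\<close> with \<open>2\<^sup>-\<^sup>j < 2\<^sup>-\<^sup>k\<close>.
\<close>

definition grid_offset :: "(int \<Rightarrow> 'n \<Rightarrow> bool) \<Rightarrow> int \<Rightarrow> real^'n" where
  "grid_offset \<omega> k = (\<Sum>\<^sub>\<infinity>j\<in>{k<..}. (2 powi (- j)) *\<^sub>R bits_vec (\<omega> j))"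

definition grid_corner :: "(int \<Rightarrow> 'n \<Rightarrow> bool) \<Rightarrow> int \<Rightarrow> ('n \<Rightarrow> int) \<Rightarrow> real^'n" where
  "grid_corner \<omega> k m = 2 powi (- k) *\<^sub>R (\<chi> r. of_int (m r)) + grid_offset \<omega> k"

definition grid_cube :: "(int \<Rightarrow> 'n \<Rightarrow> bool) \<Rightarrow> int \<Rightarrow> ('n \<Rightarrow> int) \<Rightarrow> (real^'n) set" where
  "grid_cube \<omega> k m = cube (grid_corner \<omega> k m) (2 powi (- k))"

lemma side_length_grid_cube: "side_length (grid_cube \<omega> k m) = 2 powi (- k)"
  by (simp add: grid_cube_def side_length_cube)

lemma dyadic_eq: "dyadic \<omega> = range (\<lambda>(k, m). grid_cube \<omega> k m)"
proof -
  have lev: "{j::int. 2 powi (- j) < (2 powi (- k) :: real)} = {k<..}" for k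
    by (auto simp: two_powi_less_iff)
  have tr: "(\<lambda>x. x + v) ` cube a l = cube (a + v) l" if "0 < l" for v a :: "real^'n" and l
    using that by (simp add: cube_image[symmetric] image_image algebra_simps)
  have "dyadic_translate \<omega> (cube (2 powi (- k) *\<^sub>R (\<chi> r. of_int (m r))) (2 powi (- k))) = grid_cube \<omega> k m" for k m
    by (simp add: dyadic_translate_def side_length_cube lev tr grid_cube_def grid_corner_def grid_offset_def)
  then have lvl: "dyadic_translate \<omega> ` std_dyadic_level k = range (grid_cube \<omega> k)" for k
    unfolding std_dyadic_level_eq image_image by simp
  have "dyadic \<omega> = (\<Union>k. dyadic_translate \<omega> ` std_dyadic_level k)"
    unfolding dyadic_def std_dyadic_def by blast
  also have "\<dots> = range (\<lambda>(k, m). grid_cube \<omega> k m)" unfolding lvl by auto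
  finally show ?thesis .
qed

lemma norm_bits_vec: "norm (bits_vec b :: real^'n) \<le> real CARD('n)"
proof -
  have "norm (bits_vec b :: real^'n) \<le> (\<Sum>i\<in>UNIV. \<bar>(bits_vec b :: real^'n) $ i\<bar>)" by (rule norm_le_l1_cart)
  also have "\<dots> \<le> (\<Sum>i\<in>(UNIV :: 'n set). 1)" by (intro sum_mono) (simp add: bits_vec_def)
  finally show ?thesis by simp
qed

lemma powi_minus_add_nat: "2 powi (- (k + int i)) = 2 powi (- k) * (1/2 :: real) ^ i"
proof -
  have "(2::real) powi (- k) = 2 powi (- (k + int i)) * 2 powi (int i)"
    by (subst power_int_add[symmetric]) auto
  then show ?thesis by (simp add: power_one_over field_simps)
qed

lemma grid_offset_has_sum:
  "((\<lambda>j. (2 powi (- j)) *\<^sub>R bits_vec (\<omega> j)) has_sum (grid_offset \<omega> k :: real^'n)) {k<..}"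
  and norm_grid_offset: "norm (grid_offset \<omega> k :: real^'n) \<le> real CARD('n) * 2 powi (- k)"
proof -
  let ?f = "\<lambda>j. (2 powi (- j)) *\<^sub>R bits_vec (\<omega> j) :: real^'n"
  let ?g = "\<lambda>i. ?f (k + 1 + int i)"
  let ?c = "2 powi (- (k + 1)) * real CARD('n)"
  have bij: "bij_betw (\<lambda>i. k + 1 + int i) UNIV {k<..}"
    by (rule bij_betwI[of _ _ _ "\<lambda>j. nat (j - k - 1)"]) auto
  have bd: "norm (?g i) \<le> ?c * (1/2) ^ i" for i
    using mult_left_mono[OF norm_bits_vec[of "\<omega> (k + 1 + int i)"], of "2 powi (- (k + 1)) * (1/2) ^ i"]
    unfolding norm_scaleR powi_minus_add_nat by (simp add: mult_ac abs_mult)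
  have s1: "(\<lambda>i. ?c * (1/2 :: real) ^ i) sums (?c * 2)"
    using geometric_sums[of "1/2 :: real"] by (intro sums_mult) simp
  have s: "summable (\<lambda>i. norm (?g i))"
    by (rule summable_comparison_test'[OF sums_summable[OF s1], of 0]) (use bd in simp)
  have sg: "?g sums suminf ?g" by (rule summable_sums[OF summable_norm_cancel[OF s]])
  have "(?g has_sum suminf ?g) UNIV" by (rule norm_summable_imp_has_sum[OF s sg])
  then have hs: "(?f has_sum suminf ?g) {k<..}"
    using has_sum_reindex_bij_betw[OF bij, of ?f] by simp
  then have eq: "grid_offset \<omega> k = suminf ?g" unfolding grid_offset_def by (rule infsumI)
  show "(?f has_sum (grid_offset \<omega> k)) {k<..}" using hs eq by simp
  have "norm (suminf ?g) \<le> (\<Sum>i. norm (?g i))" by (rule summable_norm[OF s])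
  also have "\<dots> \<le> (\<Sum>i. ?c * (1/2) ^ i)" by (intro suminf_le bd s sums_summable[OF s1])
  also have "\<dots> = ?c * 2" using s1 by (simp add: sums_iff)
  also have "\<dots> = real CARD('n) * 2 powi (- k)" using powi_minus_add_nat[of k 1] by simp
  finally show "norm (grid_offset \<omega> k) \<le> real CARD('n) * 2 powi (- k)" using eq by simp
qed

lemma grid_offset_rec:
  "grid_offset \<omega> (k - 1) = 2 powi (- k) *\<^sub>R bits_vec (\<omega> k) + (grid_offset \<omega> k :: real^'n)"
proof -
  have "{k - 1<..} = insert k {k<..}" by auto
  then have "((\<lambda>j. (2 powi (- j)) *\<^sub>R bits_vec (\<omega> j)) has_sum (2 powi (- k) *\<^sub>R bits_vec (\<omega> k) + grid_offset \<omega> k :: real^'n)) {k - 1<..}"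
    using has_sum_insert[of k "{k<..}" "\<lambda>j. (2 powi (- j)) *\<^sub>R bits_vec (\<omega> j)", OF _ grid_offset_has_sum] by simp
  then show ?thesis unfolding grid_offset_def[of \<omega> "k - 1"] by (rule infsumI)
qed

text \<open>
  The index of the cube that contains \<open>x\<close> consists of integer parts. Disjointness, covering and
  nesting of the cubes therefore reduce to arithmetic with floors.
\<close>

lemma mem_grid_cube:
  "x \<in> grid_cube \<omega> k m \<longleftrightarrow> (\<forall>r. m r = \<lfloor>2 powi k * (x $ r - grid_offset \<omega> k $ r)\<rfloor>)"
proof -
  have "(2 powi (- k) * real_of_int i + c \<le> t \<and> t < 2 powi (- k) * real_of_int i + c + 2 powi (- k)) \<longleftrightarrow>
     i = \<lfloor>2 powi k * (t - c)\<rfloor>" for i :: int and c t :: real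
  proof -
    have p: "(0::real) < 2 powi k" by simp
    have "i = \<lfloor>2 powi k * (t - c)\<rfloor> \<longleftrightarrow> real_of_int i \<le> 2 powi k * (t - c) \<and> 2 powi k * (t - c) < real_of_int i + 1"
      by linarith
    then show ?thesis using p by (simp add: power_int_minus field_simps)
  qed
  then show ?thesis by (simp add: grid_cube_def cube_def grid_corner_def)
qed

text \<open>
  The grid of level \<open>k - 1\<close> is translated by \<open>2\<^sup>-\<^sup>k \<omega>\<^sub>k\<close> more than the grid of level \<open>k\<close>, so this bit
  is subtracted before halving.
\<close>

definition parent_index :: "(int \<Rightarrow> 'n \<Rightarrow> bool) \<Rightarrow> int \<Rightarrow> ('n \<Rightarrow> int) \<Rightarrow> 'n \<Rightarrow> int" where
  "parent_index \<omega> k m = (\<lambda>r. (m r - of_bool (\<omega> k r)) div 2)"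

definition child_index :: "(int \<Rightarrow> 'n \<Rightarrow> bool) \<Rightarrow> int \<Rightarrow> ('n \<Rightarrow> int) \<Rightarrow> ('n \<Rightarrow> bool) \<Rightarrow> 'n \<Rightarrow> int" where
  "child_index \<omega> k m b = (\<lambda>r. 2 * m r + of_bool (\<omega> k r) + of_bool (b r))"

lemma grid_cube_parent: "grid_cube \<omega> k m \<subseteq> grid_cube \<omega> (k - 1) (parent_index \<omega> k m)"
proof
  fix x :: "real^'a" assume x: "x \<in> grid_cube \<omega> k m"
  show "x \<in> grid_cube \<omega> (k - 1) (parent_index \<omega> k m)"
    unfolding mem_grid_cube
  proof
    fix r
    let ?y = "2 powi k * (x $ r - grid_offset \<omega> k $ r)"
    have m: "m r = \<lfloor>?y\<rfloor>" using x mem_grid_cube by blast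
    have "2 powi (k - 1) * (x $ r - grid_offset \<omega> (k - 1) $ r) = (?y - real_of_int (of_bool (\<omega> k r))) / real_of_int 2"
      by (simp add: grid_offset_rec bits_vec_def power_int_diff power_int_minus field_simps)
    then show "parent_index \<omega> k m r = \<lfloor>2 powi (k - 1) * (x $ r - grid_offset \<omega> (k - 1) $ r)\<rfloor>"
      unfolding parent_index_def m by (simp only: floor_divide_real_eq_div zero_le_numeral floor_diff_of_int)
  qed
qed

lemma grid_cube_disjoint: "x \<in> grid_cube \<omega> k m \<Longrightarrow> x \<in> grid_cube \<omega> k m' \<Longrightarrow> m = m'"
  unfolding mem_grid_cube by (auto simp: fun_eq_iff)

lemma grid_cube_cover: "\<exists>m. x \<in> grid_cube \<omega> k m"
  unfolding mem_grid_cube by (rule exI[of _ "\<lambda>r. \<lfloor>2 powi k * (x $ r - grid_offset \<omega> k $ r)\<rfloor>"]) simp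

lemma grid_corner_mem: "grid_corner \<omega> k m \<in> grid_cube \<omega> k m"
  unfolding grid_cube_def by (rule cube_ne) simp

lemma grid_cube_inject: "grid_cube \<omega> k m = grid_cube \<omega> k' m' \<longleftrightarrow> k = k' \<and> m = m'"
proof
  assume eq: "grid_cube \<omega> k m = grid_cube \<omega> k' m'"
  then have "(2::real) powi (- k) = 2 powi (- k')" using side_length_grid_cube by metis
  then have "k = k'" by (simp add: two_powi_inject)
  then show "k = k' \<and> m = m'" using eq grid_corner_mem grid_cube_disjoint by metis
qed simp

lemma inj_grid_cube: "inj (\<lambda>(k, m). grid_cube \<omega> k m)"
  by (auto simp: inj_def grid_cube_inject)

primrec ancestor_index :: "(int \<Rightarrow> 'n \<Rightarrow> bool) \<Rightarrow> nat \<Rightarrow> int \<Rightarrow> ('n \<Rightarrow> int) \<Rightarrow> 'n \<Rightarrow> int" where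
  "ancestor_index \<omega> 0 k m = m"
| "ancestor_index \<omega> (Suc i) k m = ancestor_index \<omega> i (k - 1) (parent_index \<omega> k m)"

lemma grid_cube_ancestor: "grid_cube \<omega> k m \<subseteq> grid_cube \<omega> (k - int i) (ancestor_index \<omega> i k m)"
proof (induction i arbitrary: k m)
  case (Suc i)
  have "grid_cube \<omega> k m \<subseteq> grid_cube \<omega> (k - 1) (parent_index \<omega> k m)" by (rule grid_cube_parent)
  also have "\<dots> \<subseteq> grid_cube \<omega> (k - 1 - int i) (ancestor_index \<omega> i (k - 1) (parent_index \<omega> k m))" by (rule Suc)
  finally show ?case by (simp add: algebra_simps)
qed simp

text \<open>
  The side length determines the level of an ancestor, and cubes of one level are disjoint.
\<close>

lemma ancestor_grid_cube: "ancestor \<omega> i (grid_cube \<omega> k m) = grid_cube \<omega> (k - int i) (ancestor_index \<omega> i k m)"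
  unfolding ancestor_def side_length_grid_cube
proof (rule the_equality)
  have sl: "(2::real) powi (- (k - int i)) = 2 ^ i * 2 powi (- k)"
  proof -
    have "(2::real) powi (- k) = 2 powi (- (k - int i)) * (1 / 2) ^ i"
      using powi_minus_add_nat[of "k - int i" i] by simp
    then show ?thesis by (simp add: power_one_over)
  qed
  show "grid_cube \<omega> (k - int i) (ancestor_index \<omega> i k m) \<in> dyadic \<omega> \<and>
    grid_cube \<omega> k m \<subseteq> grid_cube \<omega> (k - int i) (ancestor_index \<omega> i k m) \<and>
    side_length (grid_cube \<omega> (k - int i) (ancestor_index \<omega> i k m)) = 2 ^ i * 2 powi (- k)"
  proof (intro conjI)
    show "side_length (grid_cube \<omega> (k - int i) (ancestor_index \<omega> i k m)) = 2 ^ i * 2 powi (- k)"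
      unfolding side_length_grid_cube by (rule sl)
  qed (auto simp: dyadic_eq intro: subsetD[OF grid_cube_ancestor])
  fix P assume P: "P \<in> dyadic \<omega> \<and> grid_cube \<omega> k m \<subseteq> P \<and> side_length P = 2 ^ i * 2 powi (- k)"
  then obtain k' m' where P': "P = grid_cube \<omega> k' m'" by (auto simp: dyadic_eq)
  then have "(2::real) powi (- k') = 2 powi (- (k - int i))" using P sl by (simp add: side_length_grid_cube)
  then have k': "k' = k - int i" by (simp add: two_powi_inject)
  have "m' = ancestor_index \<omega> i k m"
    using grid_cube_disjoint[of "grid_corner \<omega> k m" \<omega> k' m'] grid_cube_ancestor[of \<omega> k m i]
      grid_corner_mem[of \<omega> k m] P P' k' by blast
  then show "P = grid_cube \<omega> (k - int i) (ancestor_index \<omega> i k m)" using P' k' by simp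
qed

definition descendant_indices :: "(int \<Rightarrow> 'n \<Rightarrow> bool) \<Rightarrow> nat \<Rightarrow> int \<Rightarrow> ('n \<Rightarrow> int) \<Rightarrow> ('n \<Rightarrow> int) set" where
  "descendant_indices \<omega> i k m = {m'. ancestor_index \<omega> i (k + int i) m' = m}"

lemma descendants_eq:
  "{I \<in> dyadic \<omega>. ancestor \<omega> i I = grid_cube \<omega> k m} = grid_cube \<omega> (k + int i) ` descendant_indices \<omega> i k m"
  by (auto simp: dyadic_eq ancestor_grid_cube grid_cube_inject descendant_indices_def image_iff split: prod.splits)

lemma shift_pairs_eq:
  "shift_pairs \<omega> i j (grid_cube \<omega> k m) =
     (grid_cube \<omega> (k + int i) ` descendant_indices \<omega> i k m) \<times> (grid_cube \<omega> (k + int j) ` descendant_indices \<omega> j k m)"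
  unfolding descendants_eq[symmetric] shift_pairs_def by auto

lemma parent_child: "parent_index \<omega> k (child_index \<omega> k m b) = m"
  by (auto simp: parent_index_def child_index_def fun_eq_iff)

lemma child_parent: "\<exists>b. m = child_index \<omega> k (parent_index \<omega> k m) b"
proof
  show "m = child_index \<omega> k (parent_index \<omega> k m) (\<lambda>r. odd (m r - of_bool (\<omega> k r)))"
    by (auto simp: parent_index_def child_index_def fun_eq_iff)
qed

lemma child_index_inj: "child_index \<omega> k m b = child_index \<omega> k m' b' \<longleftrightarrow> m = m' \<and> b = b'"
proof
  assume eq: "child_index \<omega> k m b = child_index \<omega> k m' b'"
  then have "m = m'" using parent_child by metis
  moreover have "b r = b' r" for r
    using fun_cong[OF eq, of r] \<open>m = m'\<close> by (cases "b r"; cases "b' r") (auto simp: child_index_def)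
  ultimately show "m = m' \<and> b = b'" by auto
qed simp

lemma descendant_indices_0: "descendant_indices \<omega> 0 k m = {m}"
  by (auto simp: descendant_indices_def)

lemma descendant_indices_Suc:
  "descendant_indices \<omega> (Suc i) k m =
     (\<lambda>(m', b). child_index \<omega> (k + int i + 1) m' b) ` (descendant_indices \<omega> i k m \<times> UNIV)"
proof (intro equalityI subsetI)
  fix m' assume "m' \<in> descendant_indices \<omega> (Suc i) k m"
  then have "parent_index \<omega> (k + int i + 1) m' \<in> descendant_indices \<omega> i k m"
    by (simp add: descendant_indices_def add.assoc add.commute[of 1])
  then show "m' \<in> (\<lambda>(m', b). child_index \<omega> (k + int i + 1) m' b) ` (descendant_indices \<omega> i k m \<times> UNIV)"
    using child_parent[of m' \<omega> "k + int i + 1"] by (auto intro: image_eqI[of _ _ "(parent_index \<omega> (k + int i + 1) m', _)"])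
next
  fix m' assume "m' \<in> (\<lambda>(m', b). child_index \<omega> (k + int i + 1) m' b) ` (descendant_indices \<omega> i k m \<times> UNIV)"
  then show "m' \<in> descendant_indices \<omega> (Suc i) k m"
    by (auto simp: descendant_indices_def parent_child add.assoc add.commute[of 1])
qed

lemma sum_descendants_Suc:
  "(\<Sum>m'\<in>descendant_indices \<omega> (Suc i) k (m :: 'n::finite \<Rightarrow> int). F m') =
     (\<Sum>m'\<in>descendant_indices \<omega> i k m. \<Sum>b\<in>UNIV. F (child_index \<omega> (k + int i + 1) m' b))"
proof -
  have inj: "inj_on (\<lambda>(m', b). child_index \<omega> (k + int i + 1) m' b) (descendant_indices \<omega> i k m \<times> UNIV)"
    by (auto simp: inj_on_def child_index_inj)
  show ?thesis
    unfolding descendant_indices_Suc sum.reindex[OF inj] sum.cartesian_product by (simp add: split_beta')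
qed


text \<open>
  The bits \<open>b\<close> tell in which coordinates the upper half is taken.
\<close>

definition subcube :: "real^'n \<Rightarrow> real \<Rightarrow> ('n \<Rightarrow> bool) \<Rightarrow> (real^'n) set" where
  "subcube a l b = cube (a + (l / 2) *\<^sub>R bits_vec b) (l / 2)"

lemma grid_cube_child:
  "grid_cube \<omega> (k + 1) (child_index \<omega> (k + 1) m b) = subcube (grid_corner \<omega> k m) (2 powi (- k)) b"
proof -
  have "(2::real) powi (- 1 - k) = 2 powi (- (k + int 1))" "(2::real) powi (- k - 1) = 2 powi (- (k + int 1))"
    by (rule arg_cong[where f="power_int 2"], simp)+
  then have p: "(2::real) powi (- 1 - k) = 2 powi (- k) / 2" "(2::real) powi (- k - 1) = 2 powi (- k) / 2"
    unfolding powi_minus_add_nat by simp_all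
  have "grid_corner \<omega> (k + 1) (child_index \<omega> (k + 1) m b) = grid_corner \<omega> k m + (2 powi (- k) / 2) *\<^sub>R bits_vec b"
    using grid_offset_rec[of \<omega> "k + 1"]
    by (simp add: grid_corner_def child_index_def bits_vec_def vec_eq_iff p) (simp add: p algebra_simps)
  then show ?thesis by (simp add: grid_cube_def subcube_def p)
qed

section \<open>Haar functions on a cube\<close>

lemma cube_box: "box a (a + l *\<^sub>R 1) \<subseteq> cube a l" "cube a l \<subseteq> cbox a (a + l *\<^sub>R (1 :: real^'n))"
  by (simp_all add: cube_def mem_box_cart subset_eq less_imp_le)

lemma cube_measurable [measurable]: "cube (a :: real^'n) l \<in> sets borel"
proof -
  have "cube a l = (\<Inter>r. {x. a $ r \<le> x $ r} \<inter> {x. x $ r < a $ r + l})" by (auto simp: cube_def)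
  moreover have "{x :: real^'n. a $ r \<le> x $ r} \<in> sets borel" "{x :: real^'n. x $ r < c} \<in> sets borel" for r c
    by (auto intro!: borel_closed borel_open closed_Collect_le open_Collect_less continuous_intros)
  ultimately show ?thesis by (auto intro!: sets.countable_INT'')
qed

lemma emeasure_cube:
  assumes "0 < l"
  shows "emeasure lborel (cube a l :: (real^'n) set) = ennreal (l ^ CARD('n))"
proof (rule antisym)
  have "prod (\<lambda>b. (l *\<^sub>R 1 :: real^'n) \<bullet> b) Basis = l ^ CARD('n)"
    by (simp add: Basis_vec_def inner_axis UNION_singleton_eq_range prod.reindex inj_on_def axis_eq_axis)
  then have "emeasure lborel (box a (a + l *\<^sub>R 1)) = ennreal (l ^ CARD('n))"
    "emeasure lborel (cbox a (a + l *\<^sub>R 1)) = ennreal (l ^ CARD('n))"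
    using assms by (auto simp: emeasure_lborel_box_eq emeasure_lborel_cbox_eq inner_add_left Basis_vec_def inner_axis)
  then show "emeasure lborel (cube a l) \<le> ennreal (l ^ CARD('n))" "ennreal (l ^ CARD('n)) \<le> emeasure lborel (cube a l)"
    using emeasure_mono[OF cube_box(1)[of a l], of lborel] emeasure_mono[OF cube_box(2)[of a l], of lborel] by simp_all
qed

lemma measure_cube: "0 < l \<Longrightarrow> measure lborel (cube a l :: (real^'n) set) = l ^ CARD('n)"
  by (simp add: measure_def emeasure_cube)

lemma mem_subcube:
  assumes "0 < l"
  shows "x \<in> subcube a l b \<longleftrightarrow> x \<in> cube a l \<and> b = (\<lambda>r. a $ r + l / 2 \<le> x $ r)"
proof -
  have "(a $ r + (l / 2) * of_bool (b r) \<le> x $ r \<and> x $ r < a $ r + (l / 2) * of_bool (b r) + l / 2)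
     \<longleftrightarrow> (a $ r \<le> x $ r \<and> x $ r < a $ r + l) \<and> b r = (a $ r + l / 2 \<le> x $ r)" for r
    using assms by (cases "b r") auto
  then show ?thesis by (auto simp: subcube_def cube_def bits_vec_def fun_eq_iff)
qed

text \<open>
  The value on the subcube \<open>b\<close>, up to normalization, of the Haar function with index \<open>\<eta>\<close>.
\<close>

definition haar_sign :: "('n::finite \<Rightarrow> bool) \<Rightarrow> ('n \<Rightarrow> bool) \<Rightarrow> real" where
  "haar_sign \<eta> b = (\<Prod>k\<in>UNIV. if \<eta> k \<and> b k then - 1 else 1)"

lemma haar_cube:
  assumes l: "0 < l"
  shows "haar \<eta> (cube a l) x = (l ^ CARD('n)) powr (- 1 / 2) *
    (\<Sum>b\<in>UNIV. haar_sign \<eta> b * indicator (subcube a l b) (x :: real^'n))"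
proof -
  have hi: "haar_interval e {c..<c + l} t = l powr (- 1 / 2) *
      (if c \<le> t \<and> t < c + l then (if e \<and> c + l / 2 \<le> t then - 1 else 1) else 0)" for e c t
  proof -
    have "Inf {c..<c + l} = c" "Sup {c..<c + l} = c + l" using l by simp_all
    then show ?thesis
      using l by (auto simp: haar_interval_def left_half_def right_half_def indicator_def field_simps)
  qed
  let ?c = "(l ^ CARD('n)) powr (- 1 / 2)"
  have c: "(l powr (- 1 / 2)) ^ CARD('n) = ?c"
    using l by (simp add: powr_power powr_powr mult.commute flip: powr_realpow)
  have h: "haar \<eta> (cube a l) x = ?c *
     (\<Prod>k\<in>UNIV. if a $ k \<le> x $ k \<and> x $ k < a $ k + l then (if \<eta> k \<and> a $ k + l / 2 \<le> x $ k then - 1 else 1) else 0)"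
    unfolding haar_def cube_proj[OF l] hi prod.distrib c[symmetric] by simp
  show ?thesis
  proof (cases "x \<in> cube a l")
    case True
    let ?b = "\<lambda>r. a $ r + l / 2 \<le> x $ r"
    have "(\<Sum>b\<in>UNIV. haar_sign \<eta> b * indicator (subcube a l b) x) = (\<Sum>b\<in>UNIV. if b = ?b then haar_sign \<eta> ?b else 0)"
      by (intro sum.cong refl) (auto simp: mem_subcube[OF l] True indicator_def)
    also have "\<dots> = haar_sign \<eta> ?b" by simp
    also have "\<dots> = (\<Prod>k\<in>UNIV. if a $ k \<le> x $ k \<and> x $ k < a $ k + l then (if \<eta> k \<and> a $ k + l / 2 \<le> x $ k then - 1 else 1) else 0)"
      unfolding haar_sign_def using True by (intro prod.cong) (auto simp: cube_def)
    finally show ?thesis unfolding h by simp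
  next
    case False
    then obtain r where "\<not> (a $ r \<le> x $ r \<and> x $ r < a $ r + l)" by (auto simp: cube_def)
    then have "(\<Prod>k\<in>UNIV. if a $ k \<le> x $ k \<and> x $ k < a $ k + l then (if \<eta> k \<and> a $ k + l / 2 \<le> x $ k then - 1 else 1) else 0) = (0::real)"
      by (intro prod_zero) auto
    moreover have "(\<Sum>b\<in>UNIV. haar_sign \<eta> b * indicator (subcube a l b) x) = 0"
      using False by (intro sum.neutral) (auto simp: mem_subcube[OF l])
    ultimately show ?thesis unfolding h by simp
  qed
qed

lemma sum_over_bits: "(\<Sum>\<eta>\<in>UNIV. \<Prod>k\<in>UNIV. F k (\<eta> k)) = (\<Prod>k\<in>(UNIV::'n::finite set). F k False + F k True :: real)"
proof -
  have "(\<Prod>k\<in>(UNIV::'n set). F k False + F k True) = (\<Prod>k\<in>(UNIV::'n set). \<Sum>e\<in>(UNIV::bool set). F k e)"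
    by (simp add: UNIV_bool)
  also have "\<dots> = (\<Sum>\<eta>\<in>PiE UNIV (\<lambda>_. UNIV). \<Prod>k\<in>UNIV. F k (\<eta> k))"
    by (rule prod_sum_PiE) auto
  also have "PiE UNIV (\<lambda>_. UNIV) = (UNIV :: ('n \<Rightarrow> bool) set)" by auto
  finally show ?thesis by simp
qed

text \<open>
  The signs are the characters of the group of bit vectors.
\<close>

lemma haar_sign_orthogonal:
  "(\<Sum>\<eta>\<in>UNIV. haar_sign \<eta> b * haar_sign \<eta> b') = (if b = (b' :: 'n::finite \<Rightarrow> bool) then 2 ^ CARD('n) else 0)"
proof -
  have "(\<Sum>\<eta>\<in>UNIV. haar_sign \<eta> b * haar_sign \<eta> b')
      = (\<Sum>\<eta>\<in>UNIV. \<Prod>k\<in>UNIV. (\<lambda>k e. (if e \<and> b k then - 1 else 1) * (if e \<and> b' k then - 1 else 1 :: real)) k (\<eta> k))"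
    by (simp add: haar_sign_def prod.distrib)
  also have "\<dots> = (\<Prod>k\<in>UNIV. 1 + (if b k then - 1 else 1) * (if b' k then - 1 else 1 :: real))"
    by (subst sum_over_bits) simp
  also have "\<dots> = (if b = b' then 2 ^ CARD('n) else 0)"
  proof (cases "b = b'")
    case True
    then have "(\<Prod>k\<in>UNIV. 1 + (if b k then - 1 else 1) * (if b' k then - 1 else 1 :: real)) = (\<Prod>k\<in>(UNIV::'n set). 2)"
      by (intro prod.cong) auto
    then show ?thesis using True by simp
  next
    case False
    then obtain k where "b k \<noteq> b' k" by (auto simp: fun_eq_iff)
    then show ?thesis using False by (auto intro!: prod_zero bexI[of _ k])
  qed
  finally show ?thesis .
qed

lemma haar_sign_sum:
  assumes "\<eta> \<noteq> (\<lambda>_. False)"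
  shows "(\<Sum>b\<in>UNIV. haar_sign \<eta> b) = 0"
proof -
  obtain k where k: "\<eta> k" using assms by (auto simp: fun_eq_iff)
  have "(\<Sum>b\<in>UNIV. haar_sign \<eta> b) = (\<Prod>k\<in>UNIV. 1 + (if \<eta> k then - 1 else 1))"
    unfolding haar_sign_def using sum_over_bits[of "\<lambda>k e. if \<eta> k \<and> e then - 1 else 1"] by simp
  also have "\<dots> = 0" using k by (auto intro!: prod_zero bexI[of _ k])
  finally show ?thesis .
qed

lemma haar_sign_abs: "\<bar>haar_sign \<eta> b\<bar> = 1"
  unfolding haar_sign_def abs_prod by (intro prod.neutral) auto

text \<open>
  The Haar coefficient on \<open>cube a l\<close> written out through the subcubes. The general codomain covers
  both the real waves and the complex functions.
\<close>

definition haar_coeff :: "('n::finite \<Rightarrow> bool) \<Rightarrow> real^'n \<Rightarrow> real \<Rightarrow> (real^'n \<Rightarrow> 'b) \<Rightarrow> 'b::{banach, second_countable_topology}" where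
  "haar_coeff \<eta> a l f = ((l ^ CARD('n)) powr (- 1 / 2)) *\<^sub>R (\<Sum>b\<in>UNIV. haar_sign \<eta> b *\<^sub>R (LINT x:subcube a l b|lborel. f x))"

lemma subcube_measurable [measurable]: "subcube a l b \<in> sets borel"
  unfolding subcube_def by measurable

lemma set_integrable_cube:
  fixes f :: "real^'n \<Rightarrow> 'b::{banach, second_countable_topology}"
  assumes "integrable lborel f"
  shows "set_integrable lborel (cube a l) f" "set_integrable lborel (subcube a l b) f"
  using assms integrable_mult_indicator[of "cube a l" lborel f] integrable_mult_indicator[of "subcube a l b" lborel f]
  by (auto simp: set_integrable_def)

lemma sum_subcubes:
  fixes f :: "real^'n \<Rightarrow> 'b::{banach, second_countable_topology}"
  assumes l: "0 < l" and f: "integrable lborel f"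
  shows "(\<Sum>b\<in>UNIV. LINT x:subcube a l b|lborel. f x) = (LINT x:cube a l|lborel. f x)"
proof -
  have un: "cube a l = (\<Union>b\<in>UNIV. subcube a l b)" by (auto simp: mem_subcube[OF l])
  have "disjoint_family_on (subcube a l) UNIV" by (auto simp: disjoint_family_on_def mem_subcube[OF l])
  then show ?thesis
    unfolding un using set_integrable_cube[OF f]
    by (subst set_integral_finite_Union) auto
qed

lemma pairing_haar:
  fixes f :: "real^'n \<Rightarrow> complex"
  assumes l: "0 < l" and f: "integrable lborel f"
  shows "pairing f (\<lambda>y. of_real (haar \<eta> (cube a l) y)) = haar_coeff \<eta> a l f"
    "integrable lborel (\<lambda>x. f x * of_real (haar \<eta> (cube a l) x))"
proof -
  let ?c = "(l ^ CARD('n)) powr (- 1 / 2)"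
  have [measurable]: "f \<in> borel_measurable borel" using borel_measurable_integrable[OF f] by simp
  have eq: "f x * of_real (haar \<eta> (cube a l) x) = ?c *\<^sub>R (\<Sum>b\<in>UNIV. haar_sign \<eta> b *\<^sub>R (indicator (subcube a l b) x *\<^sub>R f x))" for x
    by (simp only: haar_cube[OF l] scaleR_conv_of_real sum_distrib_left of_real_mult of_real_sum mult_ac)
  have i: "integrable lborel (\<lambda>x. indicator (subcube a l b) x *\<^sub>R f x)" for b
    using set_integrable_cube(2)[OF f] by (simp add: set_integrable_def)
  show int: "integrable lborel (\<lambda>x. f x * of_real (haar \<eta> (cube a l) x))"
    unfolding eq by (intro integrable_scaleR_right Bochner_Integration.integrable_sum i)
  have "pairing f (\<lambda>y. of_real (haar \<eta> (cube a l) y)) = (LINT x|lborel. f x * of_real (haar \<eta> (cube a l) x))"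
    unfolding pairing_def by (rule integral_completion) (use borel_measurable_integrable[OF int] in simp)
  also have "\<dots> = haar_coeff \<eta> a l f"
    unfolding eq haar_coeff_def set_lebesgue_integral_def
    by (simp add: Bochner_Integration.integral_sum i del: scaleR_scaleR)
  finally show "pairing f (\<lambda>y. of_real (haar \<eta> (cube a l) y)) = haar_coeff \<eta> a l f" .
qed


lemma haar_coeff_0:
  fixes f :: "real^'n \<Rightarrow> 'b::{banach, second_countable_topology}"
  assumes l: "0 < l" and f: "integrable lborel f"
  shows "haar_coeff (\<lambda>_. False) a l f = ((l ^ CARD('n)) powr (- 1 / 2)) *\<^sub>R (LINT x:cube a l|lborel. f x)"
  unfolding haar_coeff_def haar_sign_def by (simp add: sum_subcubes[OF l f])

text \<open>
  Summing over all \<open>\<eta>\<close>, orthogonality of the signs leaves the diagonal terms, one for each subcube.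
  The subtracted term belongs to the constant \<open>\<eta> = 0\<close>, which is not a Haar index. In this form the
  identity telescopes over generations of cubes.
\<close>

lemma haar_parseval_cube:
  fixes p :: "real^'n \<Rightarrow> real" and f :: "real^'n \<Rightarrow> 'b::{banach, second_countable_topology}"
  assumes l: "0 < l" and p: "integrable lborel p" and f: "integrable lborel f"
  shows "(\<Sum>\<eta>\<in>haar_indices. haar_coeff \<eta> a l p *\<^sub>R haar_coeff \<eta> a l f) =
    (\<Sum>b\<in>UNIV. (1 / (l / 2) ^ CARD('n)) *\<^sub>R ((LINT x:subcube a l b|lborel. p x) *\<^sub>R (LINT x:subcube a l b|lborel. f x)))
    - (1 / l ^ CARD('n)) *\<^sub>R ((LINT x:cube a l|lborel. p x) *\<^sub>R (LINT x:cube a l|lborel. f x))"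
proof -
  let ?c = "(l ^ CARD('n)) powr (- 1 / 2)"
  let ?P = "\<lambda>b. LINT x:subcube a l b|lborel. p x" and ?F = "\<lambda>b. LINT x:subcube a l b|lborel. f x"
  have cc: "?c * ?c = 1 / l ^ CARD('n)"
    using l by (simp add: powr_minus_divide flip: powr_add)
  have "(\<Sum>\<eta>\<in>UNIV. haar_coeff \<eta> a l p *\<^sub>R haar_coeff \<eta> a l f)
     = (\<Sum>\<eta>\<in>UNIV. \<Sum>b\<in>UNIV. \<Sum>b'\<in>UNIV. (?c * ?c * (haar_sign \<eta> b * haar_sign \<eta> b') * ?P b') *\<^sub>R ?F b)"
    unfolding haar_coeff_def
    by (simp add: scaleR_sum_right scaleR_sum_left sum_distrib_left sum_distrib_right mult_ac)
  also have "\<dots> = (\<Sum>b\<in>UNIV. \<Sum>b'\<in>UNIV. \<Sum>\<eta>\<in>UNIV. (?c * ?c * (haar_sign \<eta> b * haar_sign \<eta> b') * ?P b') *\<^sub>R ?F b)"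
    by (rule trans[OF sum.swap], rule sum.cong[OF refl], rule sum.swap)
  also have "\<dots> = (\<Sum>b\<in>UNIV. \<Sum>b'\<in>UNIV. (?c * ?c * (\<Sum>\<eta>\<in>UNIV. haar_sign \<eta> b * haar_sign \<eta> b') * ?P b') *\<^sub>R ?F b)"
    by (simp add: scaleR_sum_left sum_distrib_left sum_distrib_right)
  also have "\<dots> = (\<Sum>b\<in>UNIV. \<Sum>b'\<in>UNIV. if b' = b then (1 / l ^ CARD('n) * 2 ^ CARD('n) * ?P b) *\<^sub>R ?F b else 0)"
    unfolding haar_sign_orthogonal cc by (intro sum.cong refl) simp
  also have "\<dots> = (\<Sum>b\<in>UNIV. (1 / (l / 2) ^ CARD('n)) *\<^sub>R (?P b *\<^sub>R ?F b))"
    by (simp add: power_divide)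
  finally have all: "(\<Sum>\<eta>\<in>UNIV. haar_coeff \<eta> a l p *\<^sub>R haar_coeff \<eta> a l f)
     = (\<Sum>b\<in>UNIV. (1 / (l / 2) ^ CARD('n)) *\<^sub>R (?P b *\<^sub>R ?F b))" .
  have z: "haar_coeff (\<lambda>_. False) a l p *\<^sub>R haar_coeff (\<lambda>_. False) a l f
      = (1 / l ^ CARD('n)) *\<^sub>R ((LINT x:cube a l|lborel. p x) *\<^sub>R (LINT x:cube a l|lborel. f x))"
    unfolding haar_coeff_0[OF l p] haar_coeff_0[OF l f] cc[symmetric] by (simp add: mult_ac)
  show ?thesis
    unfolding haar_indices_def z[symmetric] all[symmetric] by (subst sum_diff1) auto
qed

lemma norm_haar_coeff:
  fixes f :: "real^'n \<Rightarrow> 'b::{banach, second_countable_topology}"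
  assumes l: "0 < l" and f: "integrable lborel f"
  shows "norm (haar_coeff \<eta> a l f) \<le> ((l ^ CARD('n)) powr (- 1 / 2)) * (LINT x:cube a l|lborel. norm (f x))"
proof -
  have "norm (\<Sum>b\<in>UNIV. haar_sign \<eta> b *\<^sub>R (LINT x:subcube a l b|lborel. f x))
      \<le> (\<Sum>b\<in>UNIV. norm (haar_sign \<eta> b *\<^sub>R (LINT x:subcube a l b|lborel. f x)))" by (rule norm_sum)
  also have "\<dots> \<le> (\<Sum>b\<in>UNIV. LINT x:subcube a l b|lborel. norm (f x))"
    using set_integrable_cube(2)[OF f]
    by (intro sum_mono) (simp add: haar_sign_abs set_integral_norm_bound)
  also have "\<dots> = (LINT x:cube a l|lborel. norm (f x))"
    by (rule sum_subcubes[OF l integrable_norm[OF f]])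
  finally show ?thesis unfolding haar_coeff_def by (simp add: mult_left_mono)
qed

text \<open>
  A Haar function with nonzero index annihilates constants, so \<open>p\<close> may be replaced by \<open>p - c\<close>.
\<close>

lemma haar_coeff_oscillation:
  fixes p :: "real^'n \<Rightarrow> real"
  assumes l: "0 < l" and p: "integrable lborel p" and \<eta>: "\<eta> \<in> haar_indices"
    and osc: "\<And>x. x \<in> cube a l \<Longrightarrow> \<bar>p x - c\<bar> \<le> \<epsilon>"
  shows "\<bar>haar_coeff \<eta> a l p\<bar> \<le> \<epsilon> * (l ^ CARD('n)) powr (1 / 2)"
proof -
  let ?c = "(l ^ CARD('n)) powr (- 1 / 2)"
  have fin: "emeasure lborel (subcube a l b) < \<infinity>" "emeasure lborel (cube a l) < \<infinity>"
    and m: "measure lborel (subcube a l b) = (l / 2) ^ CARD('n)" for b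
    using l by (auto simp: subcube_def emeasure_cube measure_cube)
  have ci: "set_integrable lborel (subcube a l b) (\<lambda>x. c)" "set_integrable lborel (cube a l) (\<lambda>x. c)" for b c
    using fin by (auto simp: set_integrable_def)
  have sp: "set_integrable lborel (subcube a l b) p" for b by (rule set_integrable_cube(2)[OF p])
  have eq: "(LINT x:subcube a l b|lborel. p x - c) = (LINT x:subcube a l b|lborel. p x) - c * (l / 2) ^ CARD('n)" for b
    using set_integral_diff(2)[OF sp[of b] ci(1)[of b c]] fin m
    by (simp add: set_lebesgue_integral_def)
  have \<eta>0: "\<eta> \<noteq> (\<lambda>_. False)" using \<eta> by (simp add: haar_indices_def)
  have "(\<Sum>b\<in>UNIV. haar_sign \<eta> b * (c * (l / 2) ^ CARD('n))) = 0"
    using haar_sign_sum[OF \<eta>0] by (simp flip: sum_distrib_right)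
  then have "(\<Sum>b\<in>UNIV. haar_sign \<eta> b * (LINT x:subcube a l b|lborel. p x))
      = (\<Sum>b\<in>UNIV. haar_sign \<eta> b * (LINT x:subcube a l b|lborel. p x - c))"
    unfolding eq by (simp add: right_diff_distrib sum_subtractf)
  then have "\<bar>\<Sum>b\<in>UNIV. haar_sign \<eta> b * (LINT x:subcube a l b|lborel. p x)\<bar>
      \<le> (\<Sum>b\<in>UNIV. \<bar>haar_sign \<eta> b * (LINT x:subcube a l b|lborel. p x - c)\<bar>)" by (simp only: sum_abs)
  also have "\<dots> \<le> (\<Sum>b\<in>(UNIV :: ('n \<Rightarrow> bool) set). \<epsilon> * (l / 2) ^ CARD('n))"
  proof (rule sum_mono)
    fix b
    have "\<bar>LINT x:subcube a l b|lborel. p x - c\<bar> \<le> (LINT x:subcube a l b|lborel. \<bar>p x - c\<bar>)"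
      using set_integral_norm_bound[OF set_integral_diff(1)[OF sp[of b] ci(1)[of b c]]] by simp
    also have "\<dots> \<le> (LINT x:subcube a l b|lborel. \<epsilon>)"
      using osc ci(1) by (intro set_integral_mono set_integrable_abs set_integral_diff(1) sp)
        (auto simp: mem_subcube[OF l])
    also have "\<dots> = \<epsilon> * (l / 2) ^ CARD('n)" using m fin by (simp add: set_lebesgue_integral_def)
    finally show "\<bar>haar_sign \<eta> b * (LINT x:subcube a l b|lborel. p x - c)\<bar> \<le> \<epsilon> * (l / 2) ^ CARD('n)"
      by (simp add: abs_mult haar_sign_abs)
  qed
  also have "\<dots> = \<epsilon> * l ^ CARD('n)" by (simp add: card_fun power_divide)
  finally have "\<bar>haar_coeff \<eta> a l p\<bar> \<le> ?c * (\<epsilon> * l ^ CARD('n))"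
    unfolding haar_coeff_def by (simp add: abs_mult mult_left_mono)
  also have "?c * (\<epsilon> * l ^ CARD('n)) = \<epsilon> * (?c * (l ^ CARD('n)) powr 1)" using l by simp
  also have "?c * (l ^ CARD('n)) powr 1 = (l ^ CARD('n)) powr (1 / 2)"
    by (subst powr_add[symmetric]) simp
  finally show ?thesis .
qed

section \<open>The law of the random grid\<close>

lemma prob_space_omega: "prob_space (omega_measure :: (int \<Rightarrow> 'n::finite \<Rightarrow> bool) measure)"
  unfolding omega_measure_def by (intro prob_space_PiM prob_space_measure_pmf)

lemma bits_measurable [measurable]:
  "(\<lambda>\<omega>. bits_vec (\<omega> j) :: real^'n) \<in> borel_measurable omega_measure"
proof -
  have "(\<lambda>\<omega>. \<omega> j) \<in> measurable omega_measure (measure_pmf (pmf_of_set (UNIV :: ('n \<Rightarrow> bool) set)))"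
    unfolding omega_measure_def by (rule measurable_component_singleton) simp
  then show ?thesis by (rule measurable_compose) simp
qed

text \<open>
  The coordinates are independent, so redrawing one of them does not change the law.
\<close>

lemma omega_resample:
  fixes F :: "(int \<Rightarrow> 'n::finite \<Rightarrow> bool) \<Rightarrow> complex"
  assumes F: "F \<in> borel_measurable omega_measure" and M: "\<And>\<omega>. norm (F \<omega>) \<le> M"
  shows "(LINT \<omega>|omega_measure. F \<omega>) = (1 / 2 ^ CARD('n)) *\<^sub>R (\<Sum>b\<in>UNIV. LINT \<omega>|omega_measure. F (fun_upd \<omega> (j) b))"
proof -
  let ?N = "measure_pmf (pmf_of_set (UNIV :: ('n \<Rightarrow> bool) set))"
  let ?O = "omega_measure :: (int \<Rightarrow> 'n::finite \<Rightarrow> bool) measure"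
  interpret O: prob_space ?O by (rule prob_space_omega)
  interpret N: prob_space ?N by (rule prob_space_measure_pmf)
  interpret NO: pair_prob_space ?N ?O ..
  have d: "distr (?N \<Otimes>\<^sub>M ?O) ?O (\<lambda>(x, X). X(j := x)) = ?O"
    using distr_pair_PiM_eq_PiM[of "UNIV :: int set" "\<lambda>_. ?N" j]
    by (simp add: omega_measure_def prob_space_measure_pmf)
  have m: "(\<lambda>(x, X). X(j := x)) \<in> measurable (?N \<Otimes>\<^sub>M ?O) ?O"
    unfolding omega_measure_def
    using measurable_fun_upd[where J="UNIV :: int set" and I=UNIV and i=j] by measurable
  have int: "integrable (?N \<Otimes>\<^sub>M ?O) (\<lambda>(x, X). F (X(j := x)))"
    by (rule NO.integrable_const_bound[of _ M])
      (use measurable_compose[OF m F] M in \<open>auto simp: split_beta'\<close>)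
  have "(LINT \<omega>|?O. F \<omega>) = (LINT \<omega>|distr (?N \<Otimes>\<^sub>M ?O) ?O (\<lambda>(x, X). X(j := x)). F \<omega>)" unfolding d ..
  also have "\<dots> = (LINT p|(?N \<Otimes>\<^sub>M ?O). F ((\<lambda>(x, X). X(j := x)) p))"
    by (rule integral_distr[OF m F])
  also have "\<dots> = (LINT x|?N. LINT X|?O. F (X(j := x)))"
    using NO.integral_fst[OF int] by (simp add: split_beta')
  also have "\<dots> = (\<Sum>b\<in>UNIV. pmf (pmf_of_set UNIV) b *\<^sub>R (LINT X|?O. F (X(j := b))))"
    by (rule integral_measure_pmf) auto
  also have "\<dots> = (1 / 2 ^ CARD('n)) *\<^sub>R (\<Sum>b\<in>UNIV. LINT \<omega>|omega_measure. F (fun_upd \<omega> (j) b))"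
    by (simp add: scaleR_sum_right card_fun)
  finally show ?thesis .
qed

lemma integral_cube_affine:
  fixes H :: "real^'n \<Rightarrow> 'b::{banach, second_countable_topology}"
  assumes l: "0 < l" and [measurable]: "H \<in> borel_measurable borel"
  shows "(LINT x:cube a l|lborel. H x) = l ^ CARD('n) *\<^sub>R (LINT x:cube 0 1|lborel. H (a + l *\<^sub>R x))"
proof -
  have mem: "a + l *\<^sub>R x \<in> cube a l \<longleftrightarrow> x \<in> cube 0 1" for x
    using l by (auto simp: cube_def zero_le_mult_iff mult_less_cancel_left2)
  have "(LINT x:cube 0 1|lborel. H (a + l *\<^sub>R x)) = (LINT x|lborel. indicator (cube a l) (a + l *\<^sub>R x) *\<^sub>R H (a + l *\<^sub>R x))"
    unfolding set_lebesgue_integral_def by (intro Bochner_Integration.integral_cong) (auto simp: indicator_def mem)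
  also have "\<dots> = (1 / l ^ CARD('n)) *\<^sub>R (LINT x:cube a l|lborel. H x)"
    unfolding set_lebesgue_integral_def using l
    by (subst integral_affine[where f="\<lambda>x. indicator (cube a l) x *\<^sub>R H x"]) auto
  finally show ?thesis using l by simp
qed

lemma set_integrable_cube_bounded:
  fixes H :: "real^'n \<Rightarrow> 'b::{banach, second_countable_topology}"
  assumes l: "0 < l" and [measurable]: "H \<in> borel_measurable borel" and M: "\<And>x. norm (H x) \<le> M"
  shows "set_integrable lborel (cube a l) H"
  unfolding set_integrable_def
proof (rule Bochner_Integration.integrable_bound)
  show "integrable lborel (\<lambda>x. M * indicator (cube a l) x)"
    using emeasure_cube[OF l, of a] by (intro integrable_mult_right integrable_real_indicator) auto
  show "AE x in lborel. norm (indicator (cube a l) x *\<^sub>R H x) \<le> norm (M * indicator (cube a l) x)"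
  proof (rule AE_I2)
    fix x show "norm (indicator (cube a l) x *\<^sub>R H x) \<le> norm (M * indicator (cube a l) x)"
      using M[of x] by (auto simp: indicator_def)
  qed
qed measurable

lemma integral_unit_cube_halve:
  fixes H :: "real^'n \<Rightarrow> 'b::{banach, second_countable_topology}"
  assumes H[measurable]: "H \<in> borel_measurable borel" and M: "\<And>x. norm (H x) \<le> M"
  shows "(LINT x:cube 0 1|lborel. H x) =
    (1 / 2 ^ CARD('n)) *\<^sub>R (\<Sum>b\<in>UNIV. LINT x:cube 0 1|lborel. H ((1 / 2) *\<^sub>R bits_vec b + (1 / 2) *\<^sub>R x))"
proof -
  let ?H = "\<lambda>x. indicator (cube 0 1) x *\<^sub>R H x"
  have int: "integrable lborel ?H"
    using set_integrable_cube_bounded[of 1 H M 0] M by (simp add: set_integrable_def)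
  have "(LINT x:cube 0 1|lborel. H x) = (LINT x:cube 0 1|lborel. ?H x)"
    unfolding set_lebesgue_integral_def by (intro Bochner_Integration.integral_cong) (auto simp: indicator_def)
  also have "\<dots> = (\<Sum>b\<in>UNIV. LINT x:subcube 0 1 b|lborel. ?H x)"
    by (rule sum_subcubes[symmetric]) (use int in auto)
  also have "\<dots> = (\<Sum>b\<in>UNIV. LINT x:subcube 0 1 b|lborel. H x)"
    unfolding set_lebesgue_integral_def
    by (intro sum.cong refl Bochner_Integration.integral_cong) (auto simp: indicator_def mem_subcube)
  also have "\<dots> = (\<Sum>b\<in>UNIV. (1 / 2) ^ CARD('n) *\<^sub>R (LINT x:cube 0 1|lborel. H ((1 / 2) *\<^sub>R bits_vec b + (1 / 2) *\<^sub>R x)))"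
    unfolding subcube_def by (intro sum.cong refl, subst integral_cube_affine) auto
  finally show ?thesis by (simp add: scaleR_sum_right power_one_over)
qed

definition grid_offset_upto :: "(int \<Rightarrow> 'n \<Rightarrow> bool) \<Rightarrow> int \<Rightarrow> nat \<Rightarrow> real^'n" where
  "grid_offset_upto \<omega> k N = (\<Sum>i<N. 2 powi (- (k + 1 + int i)) *\<^sub>R bits_vec (\<omega> (k + 1 + int i)))"

lemma grid_offset_split: "grid_offset \<omega> k = grid_offset_upto \<omega> k N + grid_offset \<omega> (k + int N)"
proof (induction N)
  case (Suc N)
  have "grid_offset \<omega> (k + int N) = 2 powi (- (k + 1 + int N)) *\<^sub>R bits_vec (\<omega> (k + 1 + int N)) + grid_offset \<omega> (k + int (Suc N))"
    using grid_offset_rec[of \<omega> "k + 1 + int N"] by (simp add: algebra_simps)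
  then show ?case using Suc by (simp add: grid_offset_upto_def add.assoc)
qed (simp add: grid_offset_upto_def)

lemma grid_offset_upto_tendsto: "(\<lambda>N. grid_offset_upto \<omega> k N + 2 powi (- (k + int N)) *\<^sub>R x) \<longlonglongrightarrow> (grid_offset \<omega> k :: real^'n)"
proof -
  have h: "(\<lambda>N. (1/2::real) ^ N) \<longlonglongrightarrow> 0" by (rule LIMSEQ_power_zero) simp
  have 1: "(\<lambda>N. real CARD('n) * 2 powi (- k) * (1/2) ^ N) \<longlonglongrightarrow> real CARD('n) * 2 powi (- k) * 0"
    by (intro tendsto_mult h tendsto_const)
  have "(\<lambda>N. grid_offset \<omega> (k + int N) :: real^'n) \<longlonglongrightarrow> 0"
  proof (rule Lim_null_comparison)
    show "\<forall>\<^sub>F N in sequentially. norm (grid_offset \<omega> (k + int N) :: real^'n) \<le> real CARD('n) * 2 powi (- k) * (1/2) ^ N"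
      using norm_grid_offset[of \<omega> "k + int _"] unfolding powi_minus_add_nat by (simp add: mult.assoc)
    show "(\<lambda>N. real CARD('n) * 2 powi (- k) * (1/2) ^ N) \<longlonglongrightarrow> 0" using 1 by simp
  qed
  then have "(\<lambda>N. grid_offset \<omega> k - grid_offset \<omega> (k + int N)) \<longlonglongrightarrow> grid_offset \<omega> k - (0 :: real^'n)"
    by (rule tendsto_diff[OF tendsto_const])
  moreover have "grid_offset \<omega> k - grid_offset \<omega> (k + int N) = (grid_offset_upto \<omega> k N :: real^'n)" for N
    using grid_offset_split[of \<omega> k N] by simp
  ultimately have 2: "(\<lambda>N. grid_offset_upto \<omega> k N) \<longlonglongrightarrow> (grid_offset \<omega> k :: real^'n)" by simp
  have 3: "(\<lambda>N. (2 powi (- k) * (1/2) ^ N) *\<^sub>R x) \<longlonglongrightarrow> (2 powi (- k) * 0) *\<^sub>R x"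
    by (intro tendsto_intros h)
  show ?thesis unfolding powi_minus_add_nat using tendsto_add[OF 2 3] by simp
qed

lemma grid_offset_upto_measurable [measurable]:
  "(\<lambda>\<omega>. grid_offset_upto \<omega> k N :: real^'n) \<in> borel_measurable omega_measure"
  unfolding grid_offset_upto_def by measurable

lemma grid_offset_measurable [measurable]:
  "(\<lambda>\<omega>. grid_offset \<omega> k :: real^'n) \<in> borel_measurable omega_measure"
  by (rule borel_measurable_LIMSEQ_metric[where f="\<lambda>N \<omega>. grid_offset_upto \<omega> k N"])
    (use grid_offset_upto_tendsto[where x=0] in auto)

lemma grid_offset_upto_upd:
  "grid_offset_upto (fun_upd \<omega> (k + 1 + int N) b) k (Suc N) = grid_offset_upto \<omega> k N + 2 powi (- (k + 1 + int N)) *\<^sub>R (bits_vec b :: real^'n)"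
  by (simp add: grid_offset_upto_def)

text \<open>
  Let \<open>h N\<close> be the average of \<open>F\<close> over the cube of side \<open>2\<close> to the power \<open>- (k + N)\<close> whose corner is
  given by the first \<open>N\<close> random digits. The next digit chooses one of the \<open>2\<^sup>n\<close> halves of this cube
  uniformly, so the expectation of \<open>h N\<close> does not depend on \<open>N\<close>. For \<open>N = 0\<close> it is the right-hand
  side, and for \<open>N \<longrightarrow> \<infinity>\<close> the cubes shrink to the random offset.
\<close>

lemma expectation_grid_offset:
  fixes F :: "real^'n \<Rightarrow> complex"
  assumes cont: "continuous_on UNIV F" and M: "\<And>x. norm (F x) \<le> M"
  shows "(LINT \<omega>|omega_measure. F (grid_offset \<omega> k)) = (LINT x:cube 0 1|lborel. F (2 powi (- k) *\<^sub>R x))"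
proof -
  interpret O: prob_space "omega_measure :: (int \<Rightarrow> 'n \<Rightarrow> bool) measure" by (rule prob_space_omega)
  have [measurable]: "F \<in> borel_measurable borel" using cont by (rule borel_measurable_continuous_onI)
  define G where "G N y = (LINT x:cube 0 1|lborel. F (y + 2 powi (- (k + int N)) *\<^sub>R x))" for N y
  define h where "h N \<omega> = G N (grid_offset_upto \<omega> k N)" for N and \<omega> :: "int \<Rightarrow> 'n \<Rightarrow> bool"
  have G[measurable]: "G N \<in> borel_measurable borel" for N
    unfolding G_def set_lebesgue_integral_def
    by (rule lborel.borel_measurable_lebesgue_integral) measurable
  have u1: "measure lborel (cube 0 1 :: (real^'n) set) = 1" "emeasure lborel (cube 0 1 :: (real^'n) set) = 1"
    using measure_cube[of 1 "0::real^'n"] emeasure_cube[of 1 "0::real^'n"] by auto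
  have iM: "integrable lborel (\<lambda>x. M * indicator (cube 0 1 :: (real^'n) set) x)"
    using u1 by (intro integrable_mult_right integrable_real_indicator) auto
  have M0: "0 \<le> M" by (rule order_trans[OF norm_ge_zero M])
  have GM: "norm (G N y) \<le> M" for N y
  proof -
    have "norm (G N y) \<le> (LINT x|lborel. M * indicator (cube 0 1 :: (real^'n) set) x)"
      unfolding G_def set_lebesgue_integral_def
      by (rule order_trans[OF integral_norm_bound integral_mono'[OF iM]]) (use M M0 in \<open>auto simp: indicator_def\<close>)
    then show ?thesis using u1 by simp
  qed
  have hm: "h N \<in> borel_measurable omega_measure" for N
    unfolding h_def by measurable
  have step: "h N \<omega> = (1 / 2 ^ CARD('n)) *\<^sub>R (\<Sum>b\<in>UNIV. h (Suc N) (fun_upd \<omega> (k + 1 + int N) b))" for N \<omega>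
  proof -
    have p: "2 powi (- (k + 1 + int N)) = 2 powi (- (k + int N)) * (1/2 :: real)" "2 powi (- (k + int (Suc N))) = 2 powi (- (k + int N)) * (1/2 :: real)"
      using powi_minus_add_nat[of "k + int N" 1] by (simp_all add: algebra_simps)
    show ?thesis
      unfolding h_def grid_offset_upto_upd G_def p
      by (subst integral_unit_cube_halve[where M=M]) (auto simp: M scaleR_add_right add.assoc)
  qed
  have E: "(LINT \<omega>|omega_measure. h N \<omega>) = (LINT x:cube 0 1|lborel. F (2 powi (- k) *\<^sub>R x))" for N
  proof (induction N)
    case 0
    have "h 0 \<omega> = (LINT x:cube 0 1|lborel. F (2 powi (- k) *\<^sub>R x))" for \<omega>
      by (simp add: h_def G_def grid_offset_upto_def)
    then show ?case by (simp add: O.prob_space)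
  next
    case (Suc N)
    have i: "integrable omega_measure (\<lambda>\<omega>. h (Suc N) (fun_upd \<omega> (k + 1 + int N) b))" for b
    proof (rule O.integrable_const_bound[of _ M])
      show "(\<lambda>\<omega>. h (Suc N) (fun_upd \<omega> (k + 1 + int N) b)) \<in> borel_measurable omega_measure"
        unfolding h_def grid_offset_upto_upd by measurable
    qed (auto simp: h_def GM)
    have "(LINT \<omega>|omega_measure. h (Suc N) \<omega>) = (1 / 2 ^ CARD('n)) *\<^sub>R (\<Sum>b\<in>UNIV. LINT \<omega>|omega_measure. h (Suc N) (fun_upd \<omega> (k + 1 + int N) b))"
      by (rule omega_resample[OF hm, where M=M]) (simp add: h_def GM)
    also have "\<dots> = (LINT \<omega>|omega_measure. h N \<omega>)"
      unfolding step[of N] by (simp add: i)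
    finally show ?case using Suc by simp
  qed
  have lim: "(\<lambda>N. h N \<omega>) \<longlonglongrightarrow> F (grid_offset \<omega> k)" for \<omega>
  proof -
    have "(\<lambda>N. h N \<omega>) \<longlonglongrightarrow> (LINT x:(cube 0 1 :: (real^'n) set)|lborel. F (grid_offset \<omega> k))"
      unfolding h_def G_def set_lebesgue_integral_def
    proof (rule integral_dominated_convergence[where w="\<lambda>x. M * indicator (cube 0 1 :: (real^'n) set) x"])
      show "AE x in lborel. (\<lambda>N. indicat_real (cube 0 1) x *\<^sub>R F (grid_offset_upto \<omega> k N + 2 powi (- (k + int N)) *\<^sub>R x))
          \<longlonglongrightarrow> indicat_real (cube 0 1) x *\<^sub>R F (grid_offset \<omega> k)"
      proof (intro AE_I2 tendsto_scaleR tendsto_const)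
        fix x
        have "isCont F (grid_offset \<omega> k)" using cont by (simp add: continuous_on_eq_continuous_at)
        then show "(\<lambda>N. F (grid_offset_upto \<omega> k N + 2 powi (- (k + int N)) *\<^sub>R x)) \<longlonglongrightarrow> F (grid_offset \<omega> k)"
          by (rule isCont_tendsto_compose[OF _ grid_offset_upto_tendsto])
      qed
    qed (use iM M in \<open>auto simp: indicator_def\<close>)
    then show ?thesis using u1 by (simp add: set_lebesgue_integral_def)
  qed
  have "(\<lambda>N. LINT \<omega>|omega_measure. h N \<omega>) \<longlonglongrightarrow> (LINT \<omega>|omega_measure. F (grid_offset \<omega> k))"
  proof (rule integral_dominated_convergence[where w="\<lambda>_. M"])
    show "AE \<omega> in omega_measure. (\<lambda>N. h N \<omega>) \<longlonglongrightarrow> F (grid_offset \<omega> k)" using lim by simp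
    show "AE \<omega> in omega_measure. norm (h N \<omega>) \<le> M" for N by (simp add: h_def GM)
  qed (use hm in auto)
  then show ?thesis unfolding E by (simp add: LIMSEQ_const_iff)
qed

section \<open>Infinite sums and integrals\<close>

text \<open>
  Summability of complex families is absolute, so the two sides agree even in the divergent case,
  where both are 0 by convention.
\<close>

lemma integral_count_space_eq_infsum:
  fixes f :: "'i::countable \<Rightarrow> complex"
  shows "integral\<^sup>L (count_space UNIV) f = infsum f UNIV"
proof (cases "integrable (count_space UNIV) f")
  case True
  then have "Infinite_Set_Sum.abs_summable_on f UNIV" by (simp add: Infinite_Set_Sum.abs_summable_on_def)
  then show ?thesis using infsetsum_infsum[of f UNIV] by (simp add: infsetsum_def)
next
  case False
  then have "\<not> Infinite_Set_Sum.abs_summable_on f UNIV" by (simp add: Infinite_Set_Sum.abs_summable_on_def)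
  then have "\<not> f summable_on UNIV"
    unfolding abs_summable_equivalent[symmetric] summable_on_iff_abs_summable_on_complex .
  with False show ?thesis by (simp add: not_integrable_integral_eq infsum_not_exists)
qed

text \<open>
  Fubini for the product with the counting measure.
\<close>

lemma
  fixes F :: "'i::countable \<Rightarrow> 'a \<Rightarrow> complex"
  assumes sf: "sigma_finite_measure M" and int: "\<And>i. integrable M (F i)"
    and sum: "(\<lambda>i. LINT x|M. norm (F i x)) summable_on UNIV"
  shows integrable_infsum: "integrable M (\<lambda>x. \<Sum>\<^sub>\<infinity>i. F i x)"
    and integral_infsum: "(LINT x|M. (\<Sum>\<^sub>\<infinity>i. F i x)) = (\<Sum>\<^sub>\<infinity>i. LINT x|M. F i x)"
proof -
  let ?N = "count_space (UNIV :: 'i set)"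
  interpret M: sigma_finite_measure M by fact
  interpret N: sigma_finite_measure ?N by (rule sigma_finite_measure_count_space_countable) simp
  interpret P: pair_sigma_finite ?N M ..
  have m: "case_prod F \<in> borel_measurable (?N \<Otimes>\<^sub>M M)"
    by (rule measurable_pair_measure_countable1) (use int in auto)
  have s: "integrable ?N (\<lambda>i. LINT x|M. norm (F i x))"
    unfolding Infinite_Set_Sum.abs_summable_on_def[symmetric] abs_summable_equivalent[symmetric]
    by (rule iffD1[OF summable_on_iff_abs_summable_on_real sum])
  have I: "integrable (?N \<Otimes>\<^sub>M M) (case_prod F)"
    by (rule P.Fubini_integrable[OF m]) (use s int in auto)
  show "integrable M (\<lambda>x. \<Sum>\<^sub>\<infinity>i. F i x)"
    using P.integrable_snd[OF I] by (simp add: integral_count_space_eq_infsum)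
  show "(LINT x|M. (\<Sum>\<^sub>\<infinity>i. F i x)) = (\<Sum>\<^sub>\<infinity>i. LINT x|M. F i x)"
    using P.integral_snd[OF I] P.integral_fst[OF I] by (simp add: integral_count_space_eq_infsum)
qed

section \<open>Haar expansion inside a grid cube\<close>

text \<open>
  The contribution of the cubes \<open>i\<close> generations below \<open>grid_cube \<omega> k m\<close> to the Haar expansion of the
  integral of \<open>p f\<close>.
\<close>

definition haar_level ::
    "(int \<Rightarrow> 'n::finite \<Rightarrow> bool) \<Rightarrow> int \<Rightarrow> ('n \<Rightarrow> int) \<Rightarrow> nat \<Rightarrow> (real^'n \<Rightarrow> real) \<Rightarrow> (real^'n \<Rightarrow> complex) \<Rightarrow> complex" where
  "haar_level \<omega> k m i p f = (\<Sum>m'\<in>descendant_indices \<omega> i k m. \<Sum>\<eta>\<in>haar_indices.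
     haar_coeff \<eta> (grid_corner \<omega> (k + int i) m') (2 powi (- (k + int i))) p *\<^sub>R
     haar_coeff \<eta> (grid_corner \<omega> (k + int i) m') (2 powi (- (k + int i))) f)"

lemma sum_descendant_integrals:
  fixes f :: "real^'n \<Rightarrow> 'b::{banach, second_countable_topology}"
  assumes f: "integrable lborel f"
  shows "(\<Sum>m'\<in>descendant_indices \<omega> i k m. LINT x:grid_cube \<omega> (k + int i) m'|lborel. f x) = (LINT x:grid_cube \<omega> k m|lborel. f x)"
proof (induction i)
  case (Suc i)
  have "(\<Sum>b\<in>UNIV. LINT x:grid_cube \<omega> (k + int (Suc i)) (child_index \<omega> (k + int i + 1) m' b)|lborel. f x)
      = (LINT x:grid_cube \<omega> (k + int i) m'|lborel. f x)" for m'
  proof -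
    have e: "k + int (Suc i) = k + int i + 1" by simp
    show ?thesis unfolding e grid_cube_child by (subst sum_subcubes[OF _ f]) (simp_all add: grid_cube_def)
  qed
  then show ?case unfolding sum_descendants_Suc using Suc by simp
qed (simp add: descendant_indices_0)

lemma cube_diameter:
  assumes "x \<in> cube a l" "y \<in> cube a (l :: real)"
  shows "norm (x - y :: real^'n) \<le> real CARD('n) * l"
proof -
  have "norm (x - y) \<le> (\<Sum>i\<in>UNIV. \<bar>(x - y) $ i\<bar>)" by (rule norm_le_l1_cart)
  also have "\<dots> \<le> (\<Sum>i\<in>(UNIV :: 'n set). l)"
  proof (rule sum_mono)
    fix i
    have "a $ i \<le> x $ i \<and> x $ i < a $ i + l" "a $ i \<le> y $ i \<and> y $ i < a $ i + l"
      using assms by (auto simp: cube_def)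
    then show "\<bar>(x - y) $ i\<bar> \<le> l" unfolding vector_minus_component by linarith
  qed
  finally show ?thesis by simp
qed

context
  fixes p :: "real^'n \<Rightarrow> real" and f :: "real^'n \<Rightarrow> complex" and L :: real
  assumes p: "integrable lborel p" and f: "integrable lborel f" and L: "0 \<le> L"
    and lip: "\<And>x y. \<bar>p x - p y\<bar> \<le> L * norm (x - y)"
    and pf: "integrable lborel (\<lambda>x. p x *\<^sub>R f x)"
begin

lemma oscillation_cube:
  assumes "0 < l" "x \<in> cube a l"
  shows "\<bar>p x - p a\<bar> \<le> L * (real CARD('n) * l)"
  using lip[of x a] mult_left_mono[OF cube_diameter[OF assms(2) cube_ne[OF assms(1)]] L] by linarith

lemma haar_coeff_lipschitz:
  assumes "0 < l" "\<eta> \<in> haar_indices"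
  shows "\<bar>haar_coeff \<eta> a l p\<bar> \<le> L * (real CARD('n) * l) * (l ^ CARD('n)) powr (1 / 2)"
  using haar_coeff_oscillation[OF assms(1) p assms(2), of a "p a"] oscillation_cube[OF assms(1)] by blast

text \<open>
  On the cube both \<open>p\<close> and its average differ from \<open>p a\<close> by at most the oscillation of \<open>p\<close>.
\<close>

lemma cube_average_error:
  assumes l: "0 < l"
  shows "norm ((1 / l ^ CARD('n)) *\<^sub>R ((LINT x:cube a l|lborel. p x) *\<^sub>R (LINT x:cube a l|lborel. f x)) - (LINT x:cube a l|lborel. p x *\<^sub>R f x))
     \<le> 2 * (L * (real CARD('n) * l)) * (LINT x:cube a l|lborel. norm (f x))"
proof -
  let ?Q = "cube a l" and ?e = "L * (real CARD('n) * l)"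
  let ?F = "LINT x:?Q|lborel. norm (f x)"
  have ci: "set_integrable lborel ?Q (\<lambda>x. c)" for c :: real
    using emeasure_cube[OF l, of a] by (simp add: set_integrable_def)
  have sp: "set_integrable lborel ?Q p" and sf: "set_integrable lborel ?Q f" and spf: "set_integrable lborel ?Q (\<lambda>x. p x *\<^sub>R f x)"
    using p f pf by (auto intro: set_integrable_cube)
  have scf: "set_integrable lborel ?Q (\<lambda>x. p a *\<^sub>R f x)"
    by (rule set_integrable_cube) (use f in simp)
  have const: "(LINT x:?Q|lborel. c) = c * l ^ CARD('n)" for c :: real
    using l by (simp add: set_lebesgue_integral_def measure_cube)
  have d1: "(LINT x:?Q|lborel. p x - p a) = (LINT x:?Q|lborel. p x) - p a * l ^ CARD('n)"
    using set_integral_diff(2)[OF sp ci[of "p a"]] const by simp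
  have "\<bar>LINT x:?Q|lborel. p x - p a\<bar> \<le> (LINT x:?Q|lborel. \<bar>p x - p a\<bar>)"
    using set_integral_norm_bound[OF set_integral_diff(1)[OF sp ci[of "p a"]]] by simp
  also have "\<dots> \<le> (LINT x:?Q|lborel. ?e)"
    using set_integrable_abs[OF set_integral_diff(1)[OF sp ci[of "p a"]]] oscillation_cube[OF l]
    by (intro set_integral_mono ci) auto
  finally have "\<bar>(LINT x:?Q|lborel. p x) - p a * l ^ CARD('n)\<bar> \<le> ?e * l ^ CARD('n)"
    unfolding d1 const .
  then have 1: "\<bar>(1 / l ^ CARD('n)) * (LINT x:?Q|lborel. p x) - p a\<bar> \<le> ?e"
    using l by (simp add: field_simps abs_if split: if_splits)
  have d2: "(LINT x:?Q|lborel. (p x - p a) *\<^sub>R f x) = (LINT x:?Q|lborel. p x *\<^sub>R f x) - p a *\<^sub>R (LINT x:?Q|lborel. f x)"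
    using set_integral_diff(2)[OF spf scf]
    by (simp add: scaleR_left_diff_distrib set_lebesgue_integral_def scaleR_left_commute)
  have sd: "set_integrable lborel ?Q (\<lambda>x. (p x - p a) *\<^sub>R f x)"
    using set_integral_diff(1)[OF spf scf] by (simp add: scaleR_left_diff_distrib)
  have "norm (LINT x:?Q|lborel. (p x - p a) *\<^sub>R f x) \<le> (LINT x:?Q|lborel. norm ((p x - p a) *\<^sub>R f x))"
    by (rule set_integral_norm_bound[OF sd])
  also have "\<dots> \<le> (LINT x:?Q|lborel. ?e * norm (f x))"
  proof (rule set_integral_mono)
    show "set_integrable lborel ?Q (\<lambda>x. norm ((p x - p a) *\<^sub>R f x))" by (rule set_integrable_norm[OF sd])
    show "set_integrable lborel ?Q (\<lambda>x. ?e * norm (f x))"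
      using set_integrable_norm[OF sf] by (rule set_integrable_mult_right)
    fix x assume "x \<in> ?Q"
    then show "norm ((p x - p a) *\<^sub>R f x) \<le> ?e * norm (f x)"
      using oscillation_cube[OF l, of x a] by (simp add: mult_right_mono)
  qed
  also have "\<dots> = ?e * ?F" by simp
  finally have 2: "norm (LINT x:?Q|lborel. (p x - p a) *\<^sub>R f x) \<le> ?e * ?F" .
  have 3: "norm (LINT x:?Q|lborel. f x) \<le> ?F" by (rule set_integral_norm_bound[OF sf])
  have "(1 / l ^ CARD('n)) *\<^sub>R ((LINT x:?Q|lborel. p x) *\<^sub>R (LINT x:?Q|lborel. f x)) - (LINT x:?Q|lborel. p x *\<^sub>R f x)
      = ((1 / l ^ CARD('n)) * (LINT x:?Q|lborel. p x) - p a) *\<^sub>R (LINT x:?Q|lborel. f x) - (LINT x:?Q|lborel. (p x - p a) *\<^sub>R f x)"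
    unfolding d2 by (simp add: scaleR_left_diff_distrib)
  also have "norm \<dots> \<le> \<bar>(1 / l ^ CARD('n)) * (LINT x:?Q|lborel. p x) - p a\<bar> * norm (LINT x:?Q|lborel. f x) + norm (LINT x:?Q|lborel. (p x - p a) *\<^sub>R f x)"
    by (rule order_trans[OF norm_triangle_ineq4]) simp
  also have "\<dots> \<le> ?e * ?F + ?e * ?F"
    using L l by (intro add_mono mult_mono 1 2 3) auto
  also have "?e * ?F + ?e * ?F = 2 * ?e * ?F" by (simp only: mult_2 distrib_right)
  finally show ?thesis .
qed

text \<open>
  The wave side decays like the side length by the Lipschitz condition; on the other side the \<open>L\<^sup>1\<close>
  norms over the disjoint subcubes add up.
\<close>

lemma norm_haar_level:
  "norm (haar_level \<omega> k m i p f) \<le>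
     2 ^ CARD('n) * (L * (real CARD('n) * 2 powi (- (k + int i)))) * (LINT x:grid_cube \<omega> k m|lborel. norm (f x))"
proof -
  let ?l = "2 powi (- (k + int i)) :: real" and ?D = "descendant_indices \<omega> i k m"
  let ?e = "L * (real CARD('n) * ?l)"
  let ?F = "\<lambda>m'. LINT x:grid_cube \<omega> (k + int i) m'|lborel. norm (f x)"
  have l: "0 < ?l" by simp
  have F0: "0 \<le> ?F m'" for m' unfolding set_lebesgue_integral_def by simp
  have "norm (haar_coeff \<eta> (grid_corner \<omega> (k + int i) m') ?l p *\<^sub>R haar_coeff \<eta> (grid_corner \<omega> (k + int i) m') ?l f) \<le> ?e * ?F m'"
    if "\<eta> \<in> haar_indices" for \<eta> m'
  proof -
    have "norm (haar_coeff \<eta> (grid_corner \<omega> (k + int i) m') ?l p *\<^sub>R haar_coeff \<eta> (grid_corner \<omega> (k + int i) m') ?l f)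
        \<le> (?e * (?l ^ CARD('n)) powr (1 / 2)) * ((?l ^ CARD('n)) powr (- 1 / 2) * ?F m')"
      unfolding norm_scaleR grid_cube_def using L
      by (intro mult_mono haar_coeff_lipschitz[OF l that] norm_haar_coeff[OF l f]) auto
    also have "\<dots> = ?e * ((?l ^ CARD('n)) powr (1 / 2) * (?l ^ CARD('n)) powr (- 1 / 2)) * ?F m'" by (simp only: mult_ac)
    also have "(?l ^ CARD('n)) powr (1 / 2) * (?l ^ CARD('n)) powr (- 1 / 2) = 1"
      by (subst powr_add[symmetric]) simp
    finally show ?thesis by simp
  qed
  then have "norm (haar_level \<omega> k m i p f) \<le> (\<Sum>m'\<in>?D. \<Sum>\<eta>\<in>(haar_indices :: ('n \<Rightarrow> bool) set). ?e * ?F m')"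
    unfolding haar_level_def by (intro sum_norm_le)
  also have "\<dots> \<le> (\<Sum>m'\<in>?D. 2 ^ CARD('n) * (?e * ?F m'))"
  proof (rule sum_mono)
    fix m'
    have "card (haar_indices :: ('n \<Rightarrow> bool) set) \<le> card (UNIV :: ('n \<Rightarrow> bool) set)"
      by (rule card_mono) auto
    then have "real (card (haar_indices :: ('n \<Rightarrow> bool) set)) \<le> 2 ^ CARD('n)"
      by (simp add: card_fun)
    then show "(\<Sum>\<eta>\<in>(haar_indices :: ('n \<Rightarrow> bool) set). ?e * ?F m') \<le> 2 ^ CARD('n) * (?e * ?F m')"
      using L F0[of m'] by (simp add: mult_right_mono)
  qed
  also have "\<dots> = 2 ^ CARD('n) * ?e * (\<Sum>m'\<in>?D. ?F m')" by (simp add: sum_distrib_left mult.assoc)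
  also have "(\<Sum>m'\<in>?D. ?F m') = (LINT x:grid_cube \<omega> k m|lborel. norm (f x))"
    by (rule sum_descendant_integrals[OF integrable_norm[OF f]])
  finally show ?thesis .
qed

text \<open>
  Let \<open>e i\<close> be the sum over the cubes of generation \<open>i\<close> of the product of the two integrals divided by
  the volume. Level \<open>i\<close> of the expansion is \<open>e (i + 1) - e i\<close>, \<open>e 0\<close> vanishes because \<open>p\<close> has mean
  zero on the cube, and \<open>e i\<close> tends to the integral of \<open>p f\<close> because \<open>p\<close> is nearly constant on small
  cubes.
\<close>

lemma haar_level_sums:
  assumes mean: "(LINT x:grid_cube \<omega> k m|lborel. p x) = 0"
  shows "(\<lambda>i. haar_level \<omega> k m i p f) sums (LINT x:grid_cube \<omega> k m|lborel. p x *\<^sub>R f x)"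
proof -
  define l where "l i = (2 powi (- (k + int i)) :: real)" for i
  define D where "D i = descendant_indices \<omega> i k m" for i
  define e where "e i = (\<Sum>m'\<in>D i. (1 / l i ^ CARD('n)) *\<^sub>R
     ((LINT x:grid_cube \<omega> (k + int i) m'|lborel. p x) *\<^sub>R (LINT x:grid_cube \<omega> (k + int i) m'|lborel. f x)))" for i
  have l: "0 < l i" "l (Suc i) = l i / 2" "l i = 2 powi (- k) * (1/2) ^ i" for i
    unfolding l_def powi_minus_add_nat by auto
  have step: "haar_level \<omega> k m i p f = e (Suc i) - e i" for i
  proof -
    have k: "k + int (Suc i) = k + int i + 1" by simp
    have lk: "l i = 2 powi (- (k + int i))" by (simp only: l_def)
    show ?thesis
      unfolding haar_level_def e_def D_def sum_descendants_Suc k grid_cube_child sum_subtractf[symmetric]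
        haar_parseval_cube[OF l(1)[of i, unfolded l_def] p f] l(2) lk
      by (simp add: grid_cube_def)
  qed
  have e0: "e 0 = 0" using mean by (simp add: e_def D_def descendant_indices_0)
  have partial: "(\<Sum>i<N. haar_level \<omega> k m i p f) = e N" for N
    by (induction N) (auto simp: step e0)
  have err: "norm (e i - (LINT x:grid_cube \<omega> k m|lborel. p x *\<^sub>R f x))
      \<le> (2 * (L * real CARD('n)) * (LINT x:grid_cube \<omega> k m|lborel. norm (f x)) * 2 powi (- k)) * (1/2) ^ i" for i
  proof -
    have "e i - (LINT x:grid_cube \<omega> k m|lborel. p x *\<^sub>R f x)
       = (\<Sum>m'\<in>D i. (1 / l i ^ CARD('n)) *\<^sub>R ((LINT x:grid_cube \<omega> (k + int i) m'|lborel. p x) *\<^sub>R (LINT x:grid_cube \<omega> (k + int i) m'|lborel. f x))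
            - (LINT x:grid_cube \<omega> (k + int i) m'|lborel. p x *\<^sub>R f x))"
      unfolding sum_descendant_integrals[OF pf, of \<omega> k i m, symmetric] e_def sum_subtractf D_def ..
    also have "norm \<dots> \<le> (\<Sum>m'\<in>D i. 2 * (L * (real CARD('n) * l i)) * (LINT x:grid_cube \<omega> (k + int i) m'|lborel. norm (f x)))"
      unfolding grid_cube_def l_def by (intro sum_norm_le cube_average_error) simp
    also have "\<dots> = 2 * (L * (real CARD('n) * l i)) * (LINT x:grid_cube \<omega> k m|lborel. norm (f x))"
      unfolding sum_distrib_left[symmetric] D_def sum_descendant_integrals[OF integrable_norm[OF f]] ..
    also have "\<dots> = (2 * (L * real CARD('n)) * (LINT x:grid_cube \<omega> k m|lborel. norm (f x)) * 2 powi (- k)) * (1/2) ^ i"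
      unfolding l(3) by (simp only: mult_ac)
    finally show ?thesis .
  qed
  have h: "(\<lambda>N. (1/2::real) ^ N) \<longlonglongrightarrow> 0" by (rule LIMSEQ_power_zero) simp
  have "(\<lambda>i. e i - (LINT x:grid_cube \<omega> k m|lborel. p x *\<^sub>R f x)) \<longlonglongrightarrow> 0"
    by (rule Lim_null_comparison[OF always_eventually[OF allI[OF err]]]) (rule tendsto_mult_right_zero[OF h])
  then have "e \<longlonglongrightarrow> (LINT x:grid_cube \<omega> k m|lborel. p x *\<^sub>R f x)" by (rule LIM_zero_cancel)
  then show ?thesis unfolding sums_def partial .
qed

end

section \<open>The shifts\<close>

definition cube_corner :: "(real^'n) set \<Rightarrow> real^'n" where
  "cube_corner K = (\<chi> r. Inf ((\<lambda>x. x $ r) ` K))"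

definition cube_center :: "(real^'n) set \<Rightarrow> real^'n" where
  "cube_center K = cube_corner K + (side_length K / 2) *\<^sub>R 1"

text \<open>
  The windows for \<open>l = 2\<^sup>-\<^sup>k\<close> tile the positive reals, and a wave of scale \<open>s < l / 2\<close> centred in a cube
  of side \<open>l\<close> is supported there.
\<close>

definition scale_window :: "real \<Rightarrow> real set" where
  "scale_window l = {l / 4..<l / 2}"

definition wave_haar :: "real \<Rightarrow> real^'n \<Rightarrow> ('n \<Rightarrow> bool) \<Rightarrow> (real^'n) set \<Rightarrow> real" where
  "wave_haar s v \<eta> I = haar_coeff \<eta> (cube_corner I) (side_length I) (wave s v)"

text \<open>
  The Lipschitz constant of the wavelet, times a bound for the ratio of diameter to side of a cube,
  times the bound 4 for \<open>l / s\<close> in \<open>scale_window l\<close>.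
\<close>

definition osc_const :: "'n::finite itself \<Rightarrow> real" where
  "osc_const _ = 4 * (1 + 2 * 2 ^ CARD('n)) * real CARD('n)"

text \<open>
  One factor \<open>osc_const\<close> for each of the two Haar coefficients, and the factor from
  \<open>scale_window_bound\<close>.
\<close>

definition shift_const :: "real \<Rightarrow> 'n::finite itself \<Rightarrow> real" where
  "shift_const lam T = (osc_const T)\<^sup>2 * 4 powr (lam + real CARD('n))"

text \<open>
  Both waves sit at the centre of \<open>K\<close>; the scale runs through the window of \<open>K\<close>. The power of 2
  compensates the weight of the shift in the series, and the division by \<open>shift_const\<close> normalizes the
  bound on the coefficients.
\<close>

definition shift_coeff :: "real \<Rightarrow> nat \<Rightarrow> nat \<Rightarrow> 'n::finite shift_coeffs" where
  "shift_coeff lam i j \<eta> \<theta> I J K = of_real (2 powr (real (max i j) / 2) / shift_const lam TYPE('n) *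
     (side_length K ^ CARD('n) * (LINT s:scale_window (side_length K)|lborel. scale_weight lam CARD('n) s *
        (wave_haar s (cube_center K) \<eta> I * wave_haar s (cube_center K) \<theta> J))))"

lemma cube_corner_cube: "0 < l \<Longrightarrow> cube_corner (cube a l) = a"
  unfolding cube_corner_def by (subst cube_proj) (auto simp: vec_eq_iff cInf_atLeastLessThan)

lemma osc_const_pos: "0 < osc_const TYPE('n::finite)"
  by (simp add: osc_const_def add_pos_pos)

lemma shift_const_pos: "0 < shift_const lam TYPE('n::finite)"
  using osc_const_pos[where 'n='n] by (simp add: shift_const_def)

lemma scale_window_measurable [measurable]: "scale_window l \<in> sets borel"
  by (simp add: scale_window_def)

text \<open>
  In the window \<open>s\<close> is comparable to \<open>l\<close>, so the weight integrates to a multiple of \<open>l\<close> to the power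
  \<open>- lam - n\<close>.
\<close>

lemma
  fixes F :: "real \<Rightarrow> 'b::{banach, second_countable_topology}"
  assumes l: "0 < l" and [measurable]: "F \<in> borel_measurable borel"
    and M: "\<And>s. s \<in> scale_window l \<Longrightarrow> norm (F s) \<le> M"
  shows scale_window_integrable: "set_integrable lborel (scale_window l) (\<lambda>s. scale_weight lam n s *\<^sub>R F s)"
    and scale_window_bound: "0 \<le> lam \<Longrightarrow> norm (l ^ n *\<^sub>R (LINT s:scale_window l|lborel. scale_weight lam n s *\<^sub>R F s))
      \<le> 4 powr (lam + real n) * l powr (- lam) * M"
proof -
  have ne: "l / 4 \<in> scale_window l" using l by (simp add: scale_window_def)
  have M0: "0 \<le> M" using M[OF ne] norm_ge_zero order_trans by blast
  let ?w = "max (scale_weight lam n (l / 4)) (scale_weight lam n (l / 2))"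
  have w0: "0 \<le> ?w" using scale_weight_nonneg[of lam n "l / 4"] by linarith
  have em: "emeasure lborel (scale_window l) = ennreal (l / 4)"
    using l by (simp add: scale_window_def)
  have ind: "integrable lborel (\<lambda>s. c * indicator (scale_window l) s)" for c :: real
    using em by (intro integrable_mult_right integrable_real_indicator) auto
  have wle: "scale_weight lam n s \<le> ?w" if s: "s \<in> scale_window l" for s
  proof -
    have s': "l / 4 \<le> s" "s \<le> l / 2" "0 < s" using s l by (auto simp: scale_window_def)
    show ?thesis
    proof (cases "- lam - 1 - real n \<ge> 0")
      case True
      then have "s powr (- lam - 1 - real n) \<le> (l / 2) powr (- lam - 1 - real n)"
        using s' by (intro powr_mono2) auto
      then show ?thesis using s' l by (simp add: scale_weight_def)
    next
      case False
      then have "s powr (- lam - 1 - real n) \<le> (l / 4) powr (- lam - 1 - real n)"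
        using s' l by (intro powr_mono2') auto
      then show ?thesis using s' l by (simp add: scale_weight_def)
    qed
  qed
  have bd: "norm (indicator (scale_window l) s *\<^sub>R (scale_weight lam n s *\<^sub>R F s)) \<le> (?w * M) * indicator (scale_window l) s" for s
    using wle[of s] M[of s] scale_weight_nonneg[of lam n s] w0 by (auto simp: indicator_def intro!: mult_mono)
  show int: "set_integrable lborel (scale_window l) (\<lambda>s. scale_weight lam n s *\<^sub>R F s)"
    unfolding set_integrable_def
  proof (rule Bochner_Integration.integrable_bound[OF ind[of "?w * M"]])
    show "AE s in lborel. norm (indicator (scale_window l) s *\<^sub>R (scale_weight lam n s *\<^sub>R F s)) \<le> norm ((?w * M) * indicator (scale_window l) s)"
      using bd w0 M0 by (intro AE_I2) (auto simp: abs_mult indicator_def)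
  qed measurable
  assume lam: "0 \<le> lam"
  have wmax: "?w = (l / 4) powr (- lam - 1 - real n)"
  proof -
    have "(l / 2) powr (- lam - 1 - real n) \<le> (l / 4) powr (- lam - 1 - real n)"
      using l lam by (intro powr_mono2') auto
    then show ?thesis using l by (simp add: scale_weight_def)
  qed
  have "norm (LINT s:scale_window l|lborel. scale_weight lam n s *\<^sub>R F s) \<le> (LINT s|lborel. (?w * M) * indicator (scale_window l) s)"
    unfolding set_lebesgue_integral_def
    by (rule order_trans[OF integral_norm_bound integral_mono'[OF ind]]) (use bd w0 M0 in auto)
  also have "\<dots> = ?w * M * (l / 4)" using em l by (simp add: measure_def)
  finally have "norm (l ^ n *\<^sub>R (LINT s:scale_window l|lborel. scale_weight lam n s *\<^sub>R F s)) \<le> l ^ n * (?w * M * (l / 4))"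
    using l by (simp add: mult_left_mono)
  also have "\<dots> = (4 powr real n * (l / 4) powr real n * (l / 4) powr (- lam - 1 - real n) * (l / 4) powr 1) * M"
  proof -
    have "l ^ n = 4 powr real n * (l / 4) powr real n" using l by (simp add: powr_realpow power_divide)
    then show ?thesis unfolding wmax using l by simp
  qed
  also have "4 powr real n * (l / 4) powr real n * (l / 4) powr (- lam - 1 - real n) * (l / 4) powr 1 = 4 powr real n * (l / 4) powr (- lam)"
    unfolding mult.assoc powr_add[symmetric] by simp
  also have "\<dots> = 4 powr (lam + real n) * l powr (- lam)"
    using l by (simp add: powr_divide powr_minus powr_add field_simps)
  finally show "norm (l ^ n *\<^sub>R (LINT s:scale_window l|lborel. scale_weight lam n s *\<^sub>R F s))
      \<le> 4 powr (lam + real n) * l powr (- lam) * M" .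
qed

lemma cube_corner_grid: "cube_corner (grid_cube \<omega> k m) = grid_corner \<omega> k m"
  unfolding grid_cube_def by (rule cube_corner_cube) simp

lemma wave_haar_grid:
  "wave_haar s v \<eta> (grid_cube \<omega> k m) = haar_coeff \<eta> (grid_corner \<omega> k m) (2 powi (- k)) (wave s v)"
  by (simp add: wave_haar_def cube_corner_grid side_length_grid_cube)

lemma measure_grid_cube: "measure lebesgue (grid_cube \<omega> k m :: (real^'n) set) = (2 powi (- k)) ^ CARD('n)"
  by (simp add: grid_cube_def measure_cube)

lemma measure_grid_cube_powr:
  "measure lebesgue (grid_cube \<omega> k m :: (real^'n) set) powr (lam / real CARD('n)) = (2 powi (- k)) powr lam"
proof -
  have "measure lebesgue (grid_cube \<omega> k m :: (real^'n) set) = (2 powi (- k)) powr real CARD('n)"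
    unfolding measure_grid_cube by (rule powr_realpow[symmetric]) simp
  then show ?thesis by (simp add: powr_powr)
qed

lemma haar_coeff_measurable [measurable (raw)]:
  assumes [measurable]: "s \<in> borel_measurable M" "v \<in> borel_measurable M"
  shows "(\<lambda>x. haar_coeff \<eta> a l (wave (s x) (v x :: real^'n))) \<in> borel_measurable M"
proof -
  have "(\<lambda>(s, v). LINT x:subcube a l b|lborel. wave s (v :: real^'n) x) \<in> borel_measurable (borel \<Otimes>\<^sub>M borel)" for b
    unfolding set_lebesgue_integral_def split_beta'
    by (rule lborel.borel_measurable_lebesgue_integral) measurable
  then have [measurable]: "(\<lambda>x. LINT y:subcube a l b|lborel. wave (s x) (v x) y) \<in> borel_measurable M" for b
    using measurable_compose[of "\<lambda>x. (s x, v x)" M "borel \<Otimes>\<^sub>M borel" "\<lambda>(s, v). LINT x:subcube a l b|lborel. wave s v x" borel]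
    by simp
  show ?thesis unfolding haar_coeff_def by measurable
qed

lemma window_lipschitz:
  assumes s: "s \<in> scale_window l" and l: "0 < l" and t: "0 \<le> t"
  shows "(1 + 2 * 2 ^ CARD('n)) / s * (real CARD('n) * (l * t)) \<le> osc_const TYPE('n::finite) * t"
proof -
  have s': "0 < s" "l / s \<le> 4" using s l by (auto simp: scale_window_def field_simps)
  have "(1 + 2 * 2 ^ CARD('n)) / s * (real CARD('n) * (l * t)) = (1 + 2 * 2 ^ CARD('n)) * real CARD('n) * t * (l / s)" by simp
  also have "\<dots> \<le> (1 + 2 * 2 ^ CARD('n)) * real CARD('n) * t * 4"
    using t s' by (intro mult_left_mono) auto
  also have "\<dots> = osc_const TYPE('n) * t" by (simp add: osc_const_def mult_ac)
  finally show ?thesis .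
qed

text \<open>
  The Lipschitz constant of a wave of scale \<open>s\<close> is of order \<open>1 / l\<close>, and a cube of generation \<open>i\<close> has
  diameter of order \<open>2\<^sup>-\<^sup>i l\<close>.
\<close>

lemma wave_haar_bound:
  assumes s: "s \<in> scale_window (2 powi (- k))" and \<eta>: "\<eta> \<in> haar_indices"
  shows "\<bar>wave_haar s (v :: real^'n) \<eta> (grid_cube \<omega> (k + int i) m')\<bar> \<le>
    osc_const TYPE('n) * (1/2) ^ i * measure lebesgue (grid_cube \<omega> (k + int i) m' :: (real^'n) set) powr (1 / 2)"
proof -
  let ?l = "2 powi (- (k + int i)) :: real"
  have s0: "0 < s" using s zero_less_power_int[of "2::real" "- k"] by (auto simp: scale_window_def intro: less_le_trans[rotated])
  have "\<bar>haar_coeff \<eta> (grid_corner \<omega> (k + int i) m') ?l (wave s v)\<bar>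
      \<le> (1 + 2 * 2 ^ CARD('n)) / s * (real CARD('n) * ?l) * (?l ^ CARD('n)) powr (1 / 2)"
    by (rule haar_coeff_lipschitz[of _ "\<lambda>_. 0"]) (use integral_wave(1)[OF s0] wave_lipschitz[OF s0] s0 \<eta> in auto)
  also have "\<dots> \<le> osc_const TYPE('n) * (1/2) ^ i * (?l ^ CARD('n)) powr (1 / 2)"
    unfolding powi_minus_add_nat by (intro mult_right_mono window_lipschitz[OF s]) auto
  finally show ?thesis unfolding wave_haar_grid measure_grid_cube .
qed

lemma two_powr_max_le: "2 powr (real (max i j) / 2) * ((1/2) ^ i * (1/2) ^ j) \<le> 1"
proof -
  have "2 powr (real (max i j) / 2) * ((1/2) ^ i * (1/2) ^ j) = 2 powr (real (max i j) / 2) * (2 powr (- real i) * 2 powr (- real j))"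
    by (simp add: powr_minus_divide powr_realpow power_one_over)
  also have "\<dots> = 2 powr (real (max i j) / 2 + (- real i - real j))" by (simp flip: powr_add)
  also have "\<dots> \<le> 2 powr 0" by (intro powr_mono) (auto simp: max_def)
  finally show ?thesis by simp
qed

text \<open>
  The two Haar coefficients of the waves supply \<open>2\<^sup>-\<^sup>i\<close> and \<open>2\<^sup>-\<^sup>j\<close>, whose product outweighs the
  power of 2 in \<open>shift_coeff\<close> (\<open>two_powr_max_le\<close>).
\<close>

lemma shift_coeff_bounded:
  assumes lam: "0 \<le> lam"
  shows "shift_coeff_bound lam \<omega> i j (shift_coeff lam i j :: 'n::finite shift_coeffs)"
  unfolding shift_coeff_bound_def
proof (intro ballI, safe)
  fix K I J :: "(real^'n) set" and \<eta> \<theta> :: "'n \<Rightarrow> bool"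
  assume K: "K \<in> dyadic \<omega>" and IJ: "(I, J) \<in> shift_pairs \<omega> i j K" and \<eta>: "\<eta> \<in> haar_indices" and \<theta>: "\<theta> \<in> haar_indices"
  obtain k m where K': "K = grid_cube \<omega> k m" using K by (auto simp: dyadic_eq)
  obtain m1 m2 where I: "I = grid_cube \<omega> (k + int i) m1" and J: "J = grid_cube \<omega> (k + int j) m2"
    using IJ unfolding K' shift_pairs_eq by auto
  let ?l = "2 powi (- k) :: real" and ?B = "osc_const TYPE('n)" and ?c = "cube_center K"
  let ?I = "measure lebesgue I powr (1 / 2)" and ?J = "measure lebesgue J powr (1 / 2)"
  let ?F = "\<lambda>s. wave_haar s ?c \<eta> I * wave_haar s ?c \<theta> J"
  have l: "0 < ?l" by simp
  have "norm (?l ^ CARD('n) *\<^sub>R (LINT s:scale_window ?l|lborel. scale_weight lam CARD('n) s *\<^sub>R ?F s))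
      \<le> 4 powr (lam + real CARD('n)) * ?l powr (- lam) * ((?B * (1/2) ^ i * ?I) * (?B * (1/2) ^ j * ?J))"
  proof (rule scale_window_bound[OF l _ _ lam])
    show "?F \<in> borel_measurable borel" unfolding I J wave_haar_grid by measurable
    fix s assume s: "s \<in> scale_window ?l"
    show "norm (?F s) \<le> (?B * (1/2) ^ i * ?I) * (?B * (1/2) ^ j * ?J)"
      unfolding real_norm_def abs_mult using osc_const_pos[where 'n='n] less_imp_le
      by (intro mult_mono wave_haar_bound[OF s \<eta>, folded I] wave_haar_bound[OF s \<theta>, folded J]) (auto simp: I J wave_haar_bound[OF s \<eta>] wave_haar_bound[OF s \<theta>])
  qed
  then have 1: "\<bar>?l ^ CARD('n) * (LINT s:scale_window ?l|lborel. scale_weight lam CARD('n) s * ?F s)\<bar>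
      \<le> shift_const lam TYPE('n) * (?l powr (- lam) * (((1/2) ^ i * (1/2) ^ j) * (?I * ?J)))"
    by (simp add: shift_const_def power2_eq_square mult_ac)
  have "norm (shift_coeff lam i j \<eta> \<theta> I J K) =
     2 powr (real (max i j) / 2) / shift_const lam TYPE('n) *
     \<bar>?l ^ CARD('n) * (LINT s:scale_window ?l|lborel. scale_weight lam CARD('n) s * ?F s)\<bar>"
    using shift_const_pos[of lam, where 'n='n]
    unfolding shift_coeff_def norm_of_real K' side_length_grid_cube by (subst abs_mult) simp
  also have "\<dots> \<le> 2 powr (real (max i j) / 2) / shift_const lam TYPE('n) *
     (shift_const lam TYPE('n) * (?l powr (- lam) * (((1/2) ^ i * (1/2) ^ j) * (?I * ?J))))"
    using shift_const_pos[of lam, where 'n='n] by (intro mult_left_mono 1) auto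
  also have "\<dots> = (2 powr (real (max i j) / 2) * ((1/2) ^ i * (1/2) ^ j)) * (?l powr (- lam) * (?I * ?J))"
    using shift_const_pos[of lam, where 'n='n] by simp
  also have "\<dots> \<le> 1 * (?l powr (- lam) * (?I * ?J))"
    by (intro mult_right_mono two_powr_max_le) auto
  also have "\<dots> = ?I * ?J / measure lebesgue K powr (lam / real CARD('n))"
  proof -
    show ?thesis unfolding K' measure_grid_cube_powr powr_minus_divide by simp
  qed
  finally show "norm (shift_coeff lam i j \<eta> \<theta> I J K) \<le> ?I * ?J / measure lebesgue K powr (lam / real CARD('n))" .
qed


lemma grid_cube_measurable [measurable]: "grid_cube \<omega> k (m :: 'n::finite \<Rightarrow> int) \<in> sets borel"
  unfolding grid_cube_def by measurable

lemma haar_cube_abs: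
  assumes l: "0 < l"
  shows "\<bar>haar \<eta> (cube a l) x\<bar> \<le> (l ^ CARD('n)) powr (- 1 / 2) * indicator (cube a l) (x :: real^'n)"
proof -
  have "\<bar>\<Sum>b\<in>UNIV. haar_sign \<eta> b * indicator (subcube a l b) x\<bar> \<le> (\<Sum>b\<in>UNIV. \<bar>haar_sign \<eta> b * indicator (subcube a l b) x\<bar>)"
    by (rule sum_abs)
  also have "\<dots> = (\<Sum>b\<in>UNIV. if b = (\<lambda>r. a $ r + l / 2 \<le> x $ r) then indicator (cube a l) x else 0)"
    by (intro sum.cong refl) (auto simp: abs_mult haar_sign_abs mem_subcube[OF l] indicator_def)
  also have "\<dots> = indicator (cube a l) x" by simp
  finally show ?thesis unfolding haar_cube[OF l] by (simp add: abs_mult mult_left_mono)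
qed

lemma
  fixes g :: "real^'n \<Rightarrow> complex"
  assumes g: "integrable lborel g"
  shows integrable_mult_haar: "integrable lborel (\<lambda>x. g x * of_real (haar \<theta> (grid_cube \<omega> k m) x))"
    and integral_mult_haar: "(LINT x|lborel. g x * of_real (haar \<theta> (grid_cube \<omega> k m) x)) = haar_coeff \<theta> (grid_corner \<omega> k m) (2 powi (- k)) g"
    and pairing_haar_grid: "pairing g (\<lambda>x. of_real (haar \<theta> (grid_cube \<omega> k m) x)) = haar_coeff \<theta> (grid_corner \<omega> k m) (2 powi (- k)) g"
    and integral_norm_mult_haar: "(LINT x|lborel. norm (g x * of_real (haar \<theta> (grid_cube \<omega> k m) x)))
      \<le> measure lebesgue (grid_cube \<omega> k m) powr (- 1 / 2) * (LINT x:grid_cube \<omega> k m|lborel. norm (g x))"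
proof -
  let ?l = "2 powi (- k) :: real" and ?a = "grid_corner \<omega> k m"
  have l: "0 < ?l" by simp
  show i: "integrable lborel (\<lambda>x. g x * of_real (haar \<theta> (grid_cube \<omega> k m) x))"
    unfolding grid_cube_def by (rule pairing_haar(2)[OF l g])
  show p: "pairing g (\<lambda>x. of_real (haar \<theta> (grid_cube \<omega> k m) x)) = haar_coeff \<theta> ?a ?l g"
    unfolding grid_cube_def by (rule pairing_haar(1)[OF l g])
  show "(LINT x|lborel. g x * of_real (haar \<theta> (grid_cube \<omega> k m) x)) = haar_coeff \<theta> ?a ?l g"
    unfolding p[symmetric] pairing_def
    by (rule integral_completion[symmetric]) (use borel_measurable_integrable[OF i] in simp)
  have gi: "set_integrable lborel (grid_cube \<omega> k m) (\<lambda>x. norm (g x))"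
    unfolding grid_cube_def by (rule set_integrable_cube[OF integrable_norm[OF g]])
  have "(LINT x|lborel. norm (g x * of_real (haar \<theta> (grid_cube \<omega> k m) x)))
      \<le> (LINT x|lborel. (?l ^ CARD('n)) powr (- 1 / 2) * (indicator (grid_cube \<omega> k m) x *\<^sub>R norm (g x)))"
  proof (rule integral_mono)
    show "integrable lborel (\<lambda>x. norm (g x * of_real (haar \<theta> (grid_cube \<omega> k m) x)))" by (rule integrable_norm[OF i])
    show "integrable lborel (\<lambda>x. (?l ^ CARD('n)) powr (- 1 / 2) * (indicator (grid_cube \<omega> k m) x *\<^sub>R norm (g x)))"
      using gi unfolding set_integrable_def by (rule integrable_mult_right)
    fix x
    show "norm (g x * of_real (haar \<theta> (grid_cube \<omega> k m) x)) \<le> (?l ^ CARD('n)) powr (- 1 / 2) * (indicator (grid_cube \<omega> k m) x *\<^sub>R norm (g x))"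
      using mult_left_mono[OF haar_cube_abs[OF l, of \<theta> ?a x] norm_ge_zero[of "g x"]]
      unfolding grid_cube_def norm_mult norm_of_real by (simp add: mult_ac)
  qed
  then show "(LINT x|lborel. norm (g x * of_real (haar \<theta> (grid_cube \<omega> k m) x)))
      \<le> measure lebesgue (grid_cube \<omega> k m) powr (- 1 / 2) * (LINT x:grid_cube \<omega> k m|lborel. norm (g x))"
    by (simp add: measure_grid_cube set_lebesgue_integral_def)
qed

lemma shift_block_grid:
  fixes f :: "real^'n \<Rightarrow> complex"
  assumes f: "integrable lborel f"
  shows "shift_block \<omega> i j a (grid_cube \<omega> k m) f x =
    (\<Sum>m1\<in>descendant_indices \<omega> i k m. \<Sum>m2\<in>descendant_indices \<omega> j k m. \<Sum>\<eta>\<in>haar_indices. \<Sum>\<theta>\<in>haar_indices.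
      a \<eta> \<theta> (grid_cube \<omega> (k + int i) m1) (grid_cube \<omega> (k + int j) m2) (grid_cube \<omega> k m) *
      haar_coeff \<eta> (grid_corner \<omega> (k + int i) m1) (2 powi (- (k + int i))) f *
      of_real (haar \<theta> (grid_cube \<omega> (k + int j) m2) x))"
proof -
  have inj: "inj_on (grid_cube \<omega> k) A" for k and A :: "('n \<Rightarrow> int) set"
    by (simp add: inj_on_def grid_cube_inject)
  show ?thesis
    unfolding shift_block_def shift_pairs_eq sum.cartesian_product[symmetric]
      sum.reindex[OF inj] o_def pairing_haar_grid[OF f] ..
qed

definition local_mass :: "(real^'n \<Rightarrow> complex) \<Rightarrow> (int \<Rightarrow> 'n \<Rightarrow> bool) \<Rightarrow> int \<Rightarrow> ('n \<Rightarrow> int) \<Rightarrow> real" where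
  "local_mass f \<omega> k m = (LINT x:grid_cube \<omega> k m|lborel. norm (f x))"

lemma local_mass_nonneg: "0 \<le> local_mass f \<omega> k m"
  unfolding local_mass_def set_lebesgue_integral_def by simp

lemma sum_local_mass:
  "integrable lborel f \<Longrightarrow> (\<Sum>m'\<in>descendant_indices \<omega> i k m. local_mass f \<omega> (k + int i) m') = local_mass f \<omega> k m"
  unfolding local_mass_def by (rule sum_descendant_integrals[OF integrable_norm])

text \<open>
  The norm bound uses that, for cubes of one generation, the \<open>L\<^sup>1\<close> norms of \<open>f\<close> (and of \<open>g\<close>) add up to
  the norm over \<open>K\<close>; the factor \<open>4\<^sup>n\<close> bounds the number of pairs of Haar indices.
\<close>

lemma
  fixes f g :: "real^'n \<Rightarrow> complex"
  assumes f: "integrable lborel f" and g: "integrable lborel g"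
  shows integrable_mult_block: "integrable lborel (\<lambda>x. g x * shift_block \<omega> i j a (grid_cube \<omega> k m) f x)"
    and integral_mult_block: "(LINT x|lborel. g x * shift_block \<omega> i j a (grid_cube \<omega> k m) f x) =
      (\<Sum>m1\<in>descendant_indices \<omega> i k m. \<Sum>m2\<in>descendant_indices \<omega> j k m. \<Sum>\<eta>\<in>haar_indices. \<Sum>\<theta>\<in>haar_indices.
      a \<eta> \<theta> (grid_cube \<omega> (k + int i) m1) (grid_cube \<omega> (k + int j) m2) (grid_cube \<omega> k m) *
      haar_coeff \<eta> (grid_corner \<omega> (k + int i) m1) (2 powi (- (k + int i))) f *
      haar_coeff \<theta> (grid_corner \<omega> (k + int j) m2) (2 powi (- (k + int j))) g)"
    and integral_norm_mult_block: "shift_coeff_bound lam \<omega> i j a \<Longrightarrow>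
      (LINT x|lborel. norm (g x * shift_block \<omega> i j a (grid_cube \<omega> k m) f x))
      \<le> 4 ^ CARD('n) * ((2 powi (- k)) powr (- lam) * (local_mass f \<omega> k m * local_mass g \<omega> k m))"
proof -
  let ?D = "descendant_indices \<omega> i k m" and ?E = "descendant_indices \<omega> j k m"
  let ?I = "grid_cube \<omega> (k + int i)" and ?J = "grid_cube \<omega> (k + int j)" and ?K = "grid_cube \<omega> k m"
  let ?A = "\<lambda>m1 m2 \<eta> \<theta>. a \<eta> \<theta> (?I m1) (?J m2) ?K * haar_coeff \<eta> (grid_corner \<omega> (k + int i) m1) (2 powi (- (k + int i))) f"
  let ?G = "\<lambda>m2 \<theta> x. g x * of_real (haar \<theta> (?J m2) x)"
  have eq: "g x * shift_block \<omega> i j a ?K f x = (\<Sum>m1\<in>?D. \<Sum>m2\<in>?E. \<Sum>\<eta>\<in>haar_indices. \<Sum>\<theta>\<in>haar_indices. ?A m1 m2 \<eta> \<theta> * ?G m2 \<theta> x)" for x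
    unfolding shift_block_grid[OF f] sum_distrib_left by (intro sum.cong refl) (simp only: mult_ac)
  have iG: "integrable lborel (?G m2 \<theta>)" for m2 \<theta> by (rule integrable_mult_haar[OF g])
  show "integrable lborel (\<lambda>x. g x * shift_block \<omega> i j a ?K f x)"
    unfolding eq by (intro Bochner_Integration.integrable_sum integrable_mult_right iG)
  show "(LINT x|lborel. g x * shift_block \<omega> i j a ?K f x) = (\<Sum>m1\<in>?D. \<Sum>m2\<in>?E. \<Sum>\<eta>\<in>haar_indices. \<Sum>\<theta>\<in>haar_indices.
      ?A m1 m2 \<eta> \<theta> * haar_coeff \<theta> (grid_corner \<omega> (k + int j) m2) (2 powi (- (k + int j))) g)"
    unfolding eq integral_mult_haar[OF g, symmetric]
    by (simp add: Bochner_Integration.integral_sum Bochner_Integration.integrable_sum iG)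
  assume a: "shift_coeff_bound lam \<omega> i j a"
  let ?M = "(2 powi (- k)) powr (- lam) :: real"
  let ?H = "haar_indices :: ('n \<Rightarrow> bool) set"
  have Ale: "norm (?A m1 m2 \<eta> \<theta>) * (LINT x|lborel. norm (?G m2 \<theta> x)) \<le> ?M * (local_mass f \<omega> (k + int i) m1 * local_mass g \<omega> (k + int j) m2)"
    if "m1 \<in> ?D" "m2 \<in> ?E" "\<eta> \<in> ?H" "\<theta> \<in> ?H" for m1 m2 \<eta> \<theta>
  proof -
    let ?mI = "measure lebesgue (?I m1)" and ?mJ = "measure lebesgue (?J m2)"
    have mI: "?mI = (2 powi (- (k + int i))) ^ CARD('n)" by (rule measure_grid_cube)
    have pos: "0 < ?mI" "0 < ?mJ" unfolding measure_grid_cube by auto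
    have K: "?K \<in> dyadic \<omega>" by (auto simp: dyadic_eq)
    have "(?I m1, ?J m2) \<in> shift_pairs \<omega> i j ?K" unfolding shift_pairs_eq using that by auto
    then have "norm (a \<eta> \<theta> (?I m1) (?J m2) ?K) \<le> ?mI powr (1 / 2) * ?mJ powr (1 / 2) / measure lebesgue ?K powr (lam / real CARD('n))"
      using a K that unfolding shift_coeff_bound_def by fastforce
    also have "measure lebesgue ?K powr (lam / real CARD('n)) = (2 powi (- k)) powr lam"
      by (rule measure_grid_cube_powr)
    finally have 1: "norm (a \<eta> \<theta> (?I m1) (?J m2) ?K) \<le> ?mI powr (1 / 2) * ?mJ powr (1 / 2) * ?M"
      unfolding powr_minus_divide by simp
    have 2: "norm (haar_coeff \<eta> (grid_corner \<omega> (k + int i) m1) (2 powi (- (k + int i))) f) \<le> ?mI powr (- 1 / 2) * local_mass f \<omega> (k + int i) m1"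
      unfolding mI local_mass_def by (unfold grid_cube_def, rule norm_haar_coeff[OF _ f]) simp
    have 3: "(LINT x|lborel. norm (?G m2 \<theta> x)) \<le> ?mJ powr (- 1 / 2) * local_mass g \<omega> (k + int j) m2"
      unfolding local_mass_def by (rule integral_norm_mult_haar[OF g])
    have "norm (?A m1 m2 \<eta> \<theta>) * (LINT x|lborel. norm (?G m2 \<theta> x)) \<le>
       (?mI powr (1 / 2) * ?mJ powr (1 / 2) * ?M) * (?mI powr (- 1 / 2) * local_mass f \<omega> (k + int i) m1) * (?mJ powr (- 1 / 2) * local_mass g \<omega> (k + int j) m2)"
      unfolding norm_mult[of "a _ _ _ _ _"] using local_mass_nonneg
      by (intro mult_mono 1 2 3) (auto intro!: mult_nonneg_nonneg)
    also have "\<dots> = (?mI powr (1 / 2) * ?mI powr (- 1 / 2)) * (?mJ powr (1 / 2) * ?mJ powr (- 1 / 2)) * (?M * (local_mass f \<omega> (k + int i) m1 * local_mass g \<omega> (k + int j) m2))"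
      by (simp only: mult_ac)
    also have "(?mI powr (1 / 2) * ?mI powr (- 1 / 2)) = 1" using pos by (subst powr_add[symmetric]) simp
    also have "(?mJ powr (1 / 2) * ?mJ powr (- 1 / 2)) = 1" using pos by (subst powr_add[symmetric]) simp
    finally show ?thesis by simp
  qed
  have card: "real (card ?H) \<le> 2 ^ CARD('n)"
  proof -
    have "card ?H \<le> card (UNIV :: ('n \<Rightarrow> bool) set)" by (rule card_mono) auto
    then show ?thesis by (simp add: card_fun)
  qed
  have iS: "integrable lborel (\<lambda>x. norm (?A m1 m2 \<eta> \<theta>) * norm (?G m2 \<theta> x))" for m1 m2 \<eta> \<theta>
    by (intro integrable_mult_right integrable_norm iG)
  have "(LINT x|lborel. norm (g x * shift_block \<omega> i j a ?K f x))
      \<le> (LINT x|lborel. (\<Sum>m1\<in>?D. \<Sum>m2\<in>?E. \<Sum>\<eta>\<in>?H. \<Sum>\<theta>\<in>?H. norm (?A m1 m2 \<eta> \<theta>) * norm (?G m2 \<theta> x)))"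
  proof (rule integral_mono)
    show "integrable lborel (\<lambda>x. norm (g x * shift_block \<omega> i j a ?K f x))"
      unfolding eq by (intro integrable_norm Bochner_Integration.integrable_sum integrable_mult_right iG)
    show "integrable lborel (\<lambda>x. \<Sum>m1\<in>?D. \<Sum>m2\<in>?E. \<Sum>\<eta>\<in>?H. \<Sum>\<theta>\<in>?H. norm (?A m1 m2 \<eta> \<theta>) * norm (?G m2 \<theta> x))"
      by (intro Bochner_Integration.integrable_sum iS)
    fix x
    show "norm (g x * shift_block \<omega> i j a ?K f x) \<le> (\<Sum>m1\<in>?D. \<Sum>m2\<in>?E. \<Sum>\<eta>\<in>?H. \<Sum>\<theta>\<in>?H. norm (?A m1 m2 \<eta> \<theta>) * norm (?G m2 \<theta> x))"
      unfolding eq norm_mult[symmetric] by (intro sum_norm_le order_refl)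
  qed
  also have "\<dots> = (\<Sum>m1\<in>?D. \<Sum>m2\<in>?E. \<Sum>\<eta>\<in>?H. \<Sum>\<theta>\<in>?H. norm (?A m1 m2 \<eta> \<theta>) * (LINT x|lborel. norm (?G m2 \<theta> x)))"
    by (simp only: Bochner_Integration.integral_sum Bochner_Integration.integrable_sum iS integral_mult_right_zero)
  also have "\<dots> \<le> (\<Sum>m1\<in>?D. \<Sum>m2\<in>?E. \<Sum>\<eta>\<in>?H. \<Sum>\<theta>\<in>?H. ?M * (local_mass f \<omega> (k + int i) m1 * local_mass g \<omega> (k + int j) m2))"
    by (intro sum_mono Ale)
  also have "\<dots> = (real (card ?H) * real (card ?H)) * (?M * ((\<Sum>m1\<in>?D. local_mass f \<omega> (k + int i) m1) * (\<Sum>m2\<in>?E. local_mass g \<omega> (k + int j) m2)))"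
    by (simp add: sum_product sum_distrib_left mult_ac) (rule sum.swap)
  also have "\<dots> = (real (card ?H) * real (card ?H)) * (?M * (local_mass f \<omega> k m * local_mass g \<omega> k m))"
    unfolding sum_local_mass[OF f] sum_local_mass[OF g] ..
  also have "\<dots> \<le> (2 ^ CARD('n) * 2 ^ CARD('n)) * (?M * (local_mass f \<omega> k m * local_mass g \<omega> k m))"
    using card local_mass_nonneg by (intro mult_right_mono mult_mono) (auto intro!: mult_nonneg_nonneg)
  also have "(2 ^ CARD('n) * 2 ^ CARD('n)) = (4 :: real) ^ CARD('n)" by (simp flip: power_mult_distrib)
  finally show "(LINT x|lborel. norm (g x * shift_block \<omega> i j a ?K f x)) \<le> 4 ^ CARD('n) * (?M * (local_mass f \<omega> k m * local_mass g \<omega> k m))" .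
qed

section \<open>Summation over all cubes\<close>

lemma summable_on_dominated:
  fixes f :: "'a \<Rightarrow> complex"
  assumes "b summable_on A" "\<And>x. x \<in> A \<Longrightarrow> norm (f x) \<le> b x"
  shows "f summable_on A"
proof (rule abs_summable_summable)
  show "(\<lambda>x. norm (f x)) summable_on A"
    by (rule summable_on_comparison_test[OF assms(1)]) (use assms(2) in auto)
qed

lemma summable_on_times:
  fixes a :: "'a \<Rightarrow> real" and b :: "'b \<Rightarrow> real"
  assumes a: "a summable_on UNIV" "\<And>x. 0 \<le> a x" and b: "b summable_on UNIV" "\<And>y. 0 \<le> b y"
  shows "(\<lambda>(x, y). a x * b y) summable_on UNIV"
proof (rule nonneg_bdd_above_summable_on)
  show "bdd_above (sum (\<lambda>(x, y). a x * b y) ` {F. F \<subseteq> UNIV \<and> finite F})"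
  proof (rule bdd_aboveI2)
    fix F :: "('a \<times> 'b) set" assume "F \<in> {F. F \<subseteq> UNIV \<and> finite F}"
    then have F: "finite F" by simp
    have "sum (\<lambda>(x, y). a x * b y) F \<le> sum (\<lambda>(x, y). a x * b y) (fst ` F \<times> snd ` F)"
      by (rule sum_mono2) (use F a(2) b(2) in \<open>auto simp: rev_image_eqI\<close>)
    also have "\<dots> = sum a (fst ` F) * sum b (snd ` F)"
      by (simp add: sum_product sum.cartesian_product)
    also have "\<dots> \<le> infsum a UNIV * infsum b UNIV"
      using F a b by (intro mult_mono finite_sum_le_infsum sum_nonneg infsum_nonneg) auto
    finally show "sum (\<lambda>(x, y). a x * b y) F \<le> infsum a UNIV * infsum b UNIV" .
  qed
qed (use a(2) b(2) in auto)

lemma infsum_times: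
  fixes a :: "'a \<Rightarrow> complex" and b :: "'b \<Rightarrow> complex"
  assumes "(\<lambda>(x, y). a x * b y) summable_on UNIV"
  shows "(\<Sum>\<^sub>\<infinity>(x, y). a x * b y) = infsum a UNIV * infsum b UNIV"
proof -
  have "(\<Sum>\<^sub>\<infinity>(x, y). a x * b y) = (\<Sum>\<^sub>\<infinity>x. \<Sum>\<^sub>\<infinity>y. a x * b y)"
    using infsum_Sigma'_banach[of "\<lambda>x y. a x * b y" UNIV "\<lambda>_. UNIV"] assms by simp
  then show ?thesis by (simp only: infsum_cmult_right' infsum_cmult_left')
qed

lemma summable_two_sided_geometric:
  assumes "0 \<le> r" "r < (1 :: real)"
  shows "(\<lambda>k::int. r ^ nat \<bar>k\<bar>) summable_on UNIV"
proof -
  have s: "(\<lambda>i::nat. r ^ i) summable_on UNIV"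
    by (rule summable_nonneg_imp_summable_on[OF summable_geometric]) (use assms in auto)
  have "(\<lambda>k::int. r ^ nat \<bar>k\<bar>) summable_on range int"
    by (subst summable_on_reindex) (use s in \<open>auto simp: o_def\<close>)
  moreover have "(\<lambda>k::int. r ^ nat \<bar>k\<bar>) summable_on range (\<lambda>i. - int i)"
    by (subst summable_on_reindex) (use s in \<open>auto simp: o_def inj_def\<close>)
  moreover have "range int \<union> range (\<lambda>i. - int i) = UNIV"
  proof -
    have "k \<in> range int \<union> range (\<lambda>i. - int i)" for k
      by (cases k rule: int_cases2) auto
    then show ?thesis by auto
  qed
  ultimately show ?thesis using summable_on_union by metis
qed

lemma half_powers_summable: "(\<lambda>(i, j). (1/2 :: real) ^ i * (1/2) ^ j) summable_on UNIV"
proof -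
  have s: "(\<lambda>i::nat. (1/2 :: real) ^ i) summable_on UNIV"
    by (rule summable_nonneg_imp_summable_on[OF summable_geometric]) auto
  show ?thesis by (rule summable_on_times[OF s _ s]) auto
qed

text \<open>
  The common majorant, up to constants, of everything that a single cube contributes.
\<close>

definition local_energy :: "real \<Rightarrow> (real^'n \<Rightarrow> complex) \<Rightarrow> (real^'n \<Rightarrow> complex) \<Rightarrow> (int \<Rightarrow> 'n \<Rightarrow> bool) \<Rightarrow> int \<times> ('n \<Rightarrow> int) \<Rightarrow> real" where
  "local_energy lam f g \<omega> = (\<lambda>(k, m). (2 powi (- k)) powr (- lam) * (local_mass f \<omega> k m * local_mass g \<omega> k m))"

lemma local_energy_nonneg: "0 \<le> local_energy lam f g \<omega> p"
  by (auto simp: local_energy_def local_mass_nonneg split: prod.splits)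

lemma sum_local_mass_le:
  fixes f :: "real^'n \<Rightarrow> complex"
  assumes f: "integrable lborel f" and G: "finite G"
  shows "(\<Sum>m\<in>G. local_mass f \<omega> k m) \<le> (LINT x|lborel. norm (f x))"
proof -
  have si: "set_integrable lborel (grid_cube \<omega> k m) (\<lambda>x. norm (f x))" for m
    unfolding grid_cube_def by (rule set_integrable_cube[OF integrable_norm[OF f]])
  have "disjoint_family_on (grid_cube \<omega> k) G"
    unfolding disjoint_family_on_def
  proof (intro ballI impI)
    fix m m' :: "'n \<Rightarrow> int" assume "m \<noteq> m'"
    then show "grid_cube \<omega> k m \<inter> grid_cube \<omega> k m' = {}" using grid_cube_disjoint[of _ \<omega> k m m'] by auto
  qed
  then have "(\<Sum>m\<in>G. local_mass f \<omega> k m) = (LINT x:(\<Union>m\<in>G. grid_cube \<omega> k m)|lborel. norm (f x))"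
    unfolding local_mass_def using G si by (subst set_integral_finite_Union) auto
  also have "\<dots> \<le> (LINT x|lborel. norm (f x))"
    unfolding set_lebesgue_integral_def
    by (rule integral_mono'[OF integrable_norm[OF f]]) (auto simp: indicator_def)
  finally show ?thesis .
qed

lemma local_mass_le:
  assumes f: "integrable lborel f" and M: "\<And>x. norm (f x) \<le> M"
  shows "local_mass f \<omega> k (m :: 'n::finite \<Rightarrow> int) \<le> M * (2 powi (- k)) ^ CARD('n)"
proof -
  let ?l = "2 powi (- k) :: real"
  have em: "emeasure lborel (grid_cube \<omega> k m) = ennreal (?l ^ CARD('n))"
    unfolding grid_cube_def by (rule emeasure_cube) simp
  have "0 \<le> M" using order_trans[OF norm_ge_zero M] .
  then have "local_mass f \<omega> k m \<le> (LINT x|lborel. M * indicator (grid_cube \<omega> k m) x)"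
    unfolding local_mass_def set_lebesgue_integral_def
    using em M by (intro integral_mono' integrable_mult_right integrable_real_indicator) (auto simp: indicator_def)
  also have "\<dots> = M * ?l ^ CARD('n)" using em by (simp add: measure_def)
  finally show ?thesis .
qed

text \<open>
  On a fixed level one of the two masses is bounded by the total mass or by the volume, whichever is
  smaller, and the other one adds up to at most the total mass. The level sums then decay geometrically
  in both directions. The bound \<open>B\<close> must not depend on \<open>\<omega>\<close>, as it is integrated over the grids.
\<close>

lemma local_energy_summable:
  fixes f g :: "real^'n \<Rightarrow> complex"
  assumes lam: "0 < lam" "lam < real CARD('n)" and f: "test_function f" and g: "test_function g"
  obtains B where "\<And>\<omega>. local_energy lam f g \<omega> summable_on UNIV" "\<And>\<omega>. infsum (local_energy lam f g \<omega>) UNIV \<le> B"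
proof -
  let ?n = "CARD('n)"
  have fi: "integrable lborel f" and gi: "integrable lborel g" using f g by (simp_all add: test_functionD)
  obtain M where M0: "0 \<le> M" and M: "\<And>x. norm (f x) \<le> M" using test_functionD(3)[OF f] by auto
  define F where "F = (LINT x|lborel. norm (f x))"
  define G where "G = (LINT x|lborel. norm (g x))"
  have FG: "0 \<le> F" "0 \<le> G" by (auto simp: F_def G_def)
  \<comment> \<open>The ratios for the levels \<open>k \<ge> 0\<close> (small cubes) and \<open>k < 0\<close> (large cubes).\<close>
  define r where "r = max (2 powr (lam - real ?n)) (2 powr (- lam))"
  have "2 powr (lam - real ?n) < 2 powr 0" "2 powr (- lam) < 2 powr 0"
    using lam by (intro powr_less_mono; simp)+
  then have r: "0 \<le> r" "r < 1" by (auto simp: r_def le_max_iff_disj)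
  define Z where "Z = (M + F) * G"
  have Z: "0 \<le> Z" using M0 FG by (simp add: Z_def)
  define S where "S = infsum (\<lambda>k::int. r ^ nat \<bar>k\<bar>) UNIV"
  have level: "(\<Sum>m\<in>A. local_energy lam f g \<omega> (k, m)) \<le> Z * r ^ nat \<bar>k\<bar>" if A: "finite A" for A \<omega> k
  proof -
    let ?l = "2 powi (- k) :: real"
    have lp: "?l powr a = 2 powr (- real_of_int k * a)" for a
    proof -
      have "?l = 2 powr real_of_int (- k)" by (rule powr_real_of_int'[symmetric]) auto
      then show ?thesis by (simp only: powr_powr of_int_minus)
    qed
    have Gm: "(\<Sum>m\<in>A. local_mass g \<omega> k m) \<le> G" unfolding G_def by (rule sum_local_mass_le[OF gi A])
    have "local_mass f \<omega> k m \<le> F" for m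
      using sum_local_mass_le[OF fi, of "{m}" \<omega> k] by (simp add: F_def)
    then have bd: "local_mass f \<omega> k m \<le> c" if "c = F \<or> c = M * ?l ^ ?n" for c m
      using that local_mass_le[OF fi M, of \<omega> k m] by auto
    have gen: "(\<Sum>m\<in>A. local_energy lam f g \<omega> (k, m)) \<le> ?l powr (- lam) * (c * G)" if c: "c = F \<or> c = M * ?l ^ ?n" for c
    proof -
      have c0: "0 \<le> c" using c FG M0 by auto
      have "(\<Sum>m\<in>A. local_energy lam f g \<omega> (k, m)) \<le> (\<Sum>m\<in>A. ?l powr (- lam) * (c * local_mass g \<omega> k m))"
        unfolding local_energy_def prod.case using bd[OF c] local_mass_nonneg
        by (intro sum_mono mult_left_mono mult_right_mono) auto
      also have "\<dots> = ?l powr (- lam) * (c * (\<Sum>m\<in>A. local_mass g \<omega> k m))" by (simp add: sum_distrib_left)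
      also have "\<dots> \<le> ?l powr (- lam) * (c * G)" using c0 by (intro mult_left_mono Gm) auto
      finally show ?thesis .
    qed
    show ?thesis
    proof (cases "0 \<le> k")
      case True
      have "(\<Sum>m\<in>A. local_energy lam f g \<omega> (k, m)) \<le> (?l powr (- lam) * ?l powr real ?n) * (M * G)"
        using gen[of "M * ?l ^ ?n"] by (simp add: powr_realpow mult_ac)
      also have "?l powr (- lam) * ?l powr real ?n = ?l powr (real ?n - lam)" by (simp flip: powr_add)
      also have "\<dots> = (2 powr (lam - real ?n)) powr real (nat \<bar>k\<bar>)"
        unfolding lp using True by (simp add: powr_powr algebra_simps)
      also have "\<dots> = (2 powr (lam - real ?n)) ^ nat \<bar>k\<bar>" by (rule powr_realpow) simp
      also have "\<dots> * (M * G) \<le> r ^ nat \<bar>k\<bar> * Z"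
        unfolding Z_def using M0 FG r by (intro mult_mono power_mono) (auto simp: r_def distrib_right)
      finally show ?thesis by (simp add: mult.commute)
    next
      case False
      have "(\<Sum>m\<in>A. local_energy lam f g \<omega> (k, m)) \<le> ?l powr (- lam) * (F * G)" by (rule gen) simp
      also have "?l powr (- lam) = (2 powr (- lam)) powr real (nat \<bar>k\<bar>)"
        unfolding lp using False by (simp add: powr_powr mult.commute)
      also have "\<dots> = (2 powr (- lam)) ^ nat \<bar>k\<bar>" by (rule powr_realpow) simp
      also have "\<dots> * (F * G) \<le> r ^ nat \<bar>k\<bar> * Z"
        unfolding Z_def using M0 FG r by (intro mult_mono power_mono) (auto simp: r_def distrib_right)
      finally show ?thesis by (simp add: mult.commute)
    qed
  qed
  have fin: "sum (local_energy lam f g \<omega>) P \<le> Z * S" if P: "finite P" for P \<omega>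
  proof -
    have "sum (local_energy lam f g \<omega>) P \<le> sum (local_energy lam f g \<omega>) (fst ` P \<times> snd ` P)"
      by (rule sum_mono2) (use P local_energy_nonneg in \<open>auto simp: rev_image_eqI\<close>)
    also have "\<dots> = (\<Sum>k\<in>fst ` P. \<Sum>m\<in>snd ` P. local_energy lam f g \<omega> (k, m))"
      by (simp add: sum.cartesian_product)
    also have "\<dots> \<le> (\<Sum>k\<in>fst ` P. Z * r ^ nat \<bar>k\<bar>)" using P by (intro sum_mono level) simp
    also have "\<dots> = Z * (\<Sum>k\<in>fst ` P. r ^ nat \<bar>k\<bar>)" by (simp add: sum_distrib_left)
    also have "\<dots> \<le> Z * S"
      unfolding S_def using P Z r
      by (intro mult_left_mono finite_sum_le_infsum summable_two_sided_geometric) auto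
    finally show ?thesis .
  qed
  have s: "local_energy lam f g \<omega> summable_on UNIV" for \<omega>
    by (rule nonneg_bdd_above_summable_on) (auto simp: local_energy_nonneg intro!: bdd_aboveI2[where M="Z * S"] fin)
  show ?thesis
    by (rule that[of "Z * S"]) (auto intro!: s infsum_le_finite_sums fin)
qed

section \<open>The series of shifts for a fixed grid\<close>

lemma cube_center_grid: "cube_center (grid_cube \<omega> k m) = grid_corner \<omega> k m + (2 powi (- k) / 2) *\<^sub>R 1"
  by (simp add: cube_center_def cube_corner_grid side_length_grid_cube)

lemma wave_outside_cube:
  assumes s: "s \<in> scale_window (2 powi (- k))" and x: "x \<notin> grid_cube \<omega> k m"
  shows "wave s (cube_center (grid_cube \<omega> k m)) (x :: real^'n) = 0"
proof -
  let ?l = "2 powi (- k) :: real" and ?c = "cube_center (grid_cube \<omega> k m)"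
  have l: "0 < ?l" by simp
  have s': "0 < s" "s < ?l / 2" using s l by (auto simp: scale_window_def intro: less_le_trans[rotated])
  obtain r where r: "\<not> (grid_corner \<omega> k m $ r \<le> x $ r \<and> x $ r < grid_corner \<omega> k m $ r + ?l)"
    using x by (auto simp: grid_cube_def cube_def)
  have "?c $ r = grid_corner \<omega> k m $ r + ?l / 2" by (simp add: cube_center_grid)
  then have "s \<le> \<bar>(x - ?c) $ r\<bar>" using r s' unfolding vector_minus_component by linarith
  also have "\<dots> \<le> norm (x - ?c)" by (rule component_le_norm_cart)
  finally show ?thesis by (rule wave_outside[OF s'(1)])
qed

lemma window_pos: "s \<in> scale_window (2 powi (- k)) \<Longrightarrow> 0 < s"
  using zero_less_power_int[of "2::real" "- k"] by (auto simp: scale_window_def intro: less_le_trans[rotated])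

lemma haar_level_wave:
  fixes f :: "real^'n \<Rightarrow> complex"
  assumes s: "s \<in> scale_window (2 powi (- k))" and f: "test_function f"
  shows "norm (haar_level \<omega> k m i (wave s v) f) \<le> 2 ^ CARD('n) * osc_const TYPE('n) * (1/2) ^ i * local_mass f \<omega> k m"
    and "(\<lambda>i. haar_level \<omega> k m i (wave s (cube_center (grid_cube \<omega> k m))) f) sums wave_coeff s (cube_center (grid_cube \<omega> k m)) f"
proof -
  let ?L = "(1 + 2 * 2 ^ CARD('n)) / s" and ?c = "cube_center (grid_cube \<omega> k m)"
  have s0: "0 < s" by (rule window_pos[OF s])
  have fi: "integrable lborel f" using f by (rule test_functionD)
  have L: "0 \<le> ?L" using s0 by simp
  have wf: "integrable lborel (\<lambda>x. wave s v x *\<^sub>R f x)" for v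
    using integrable_wave_mult[OF f, of s v] by (simp add: scaleR_conv_of_real)
  have "norm (haar_level \<omega> k m i (wave s v) f) \<le> 2 ^ CARD('n) * (?L * (real CARD('n) * 2 powi (- (k + int i)))) * local_mass f \<omega> k m"
    unfolding local_mass_def
    by (rule norm_haar_level[OF integral_wave(1)[OF s0] fi L wave_lipschitz[OF s0] wf])
  also have "\<dots> \<le> 2 ^ CARD('n) * (osc_const TYPE('n) * (1/2) ^ i) * local_mass f \<omega> k m"
    unfolding powi_minus_add_nat
    by (intro mult_right_mono mult_left_mono window_lipschitz[OF s] local_mass_nonneg) auto
  finally show "norm (haar_level \<omega> k m i (wave s v) f) \<le> 2 ^ CARD('n) * osc_const TYPE('n) * (1/2) ^ i * local_mass f \<omega> k m"
    by (simp add: mult.assoc)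
  have out: "indicator (grid_cube \<omega> k m) x *\<^sub>R (wave s ?c x *\<^sub>R z) = wave s ?c x *\<^sub>R (z :: 'b::real_vector)" for x z
    using wave_outside_cube[OF s, of x \<omega> m] by (cases "x \<in> grid_cube \<omega> k m") auto
  have mean: "(LINT x:grid_cube \<omega> k m|lborel. wave s ?c x) = 0"
  proof -
    have "indicator (grid_cube \<omega> k m) x *\<^sub>R wave s ?c x = wave s ?c x" for x
      using wave_outside_cube[OF s, of x \<omega> m] by (cases "x \<in> grid_cube \<omega> k m") auto
    then show ?thesis unfolding set_lebesgue_integral_def by (simp only: integral_wave(2)[OF s0])
  qed
  have "(\<lambda>i. haar_level \<omega> k m i (wave s ?c) f) sums (LINT x:grid_cube \<omega> k m|lborel. wave s ?c x *\<^sub>R f x)"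
    by (rule haar_level_sums[OF integral_wave(1)[OF s0] fi L wave_lipschitz[OF s0] wf mean])
  also have "(LINT x:grid_cube \<omega> k m|lborel. wave s ?c x *\<^sub>R f x) = wave_coeff s ?c f"
    unfolding set_lebesgue_integral_def out wave_coeff_def by (simp add: scaleR_conv_of_real)
  finally show "(\<lambda>i. haar_level \<omega> k m i (wave s ?c) f) sums wave_coeff s ?c f" .
qed

lemma haar_level_measurable [measurable (raw)]:
  assumes [measurable]: "s \<in> borel_measurable M" "v \<in> borel_measurable M"
  shows "(\<lambda>x. haar_level \<omega> k m i (wave (s x) (v x)) f) \<in> borel_measurable M"
  unfolding haar_level_def by measurable

text \<open>
  The weighted contribution of the cube \<open>K\<close> to the pairing with the shift of type \<open>(i, j)\<close>, with the
  sum over the pairs of subcubes moved inside the integral over the scales; see \<open>shift_level_eq\<close>.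
\<close>

definition shift_level ::
    "real \<Rightarrow> (real^'n \<Rightarrow> complex) \<Rightarrow> (real^'n \<Rightarrow> complex) \<Rightarrow> (int \<Rightarrow> 'n \<Rightarrow> bool) \<Rightarrow> int \<times> ('n \<Rightarrow> int) \<Rightarrow> nat \<times> nat \<Rightarrow> complex" where
  "shift_level lam f g \<omega> = (\<lambda>(k, m) (i, j). (1 / shift_const lam TYPE('n)) *\<^sub>R ((2 powi (- k)) ^ CARD('n) *\<^sub>R
     (LINT s:scale_window (2 powi (- k))|lborel. scale_weight lam CARD('n) s *\<^sub>R
        (haar_level \<omega> k m i (wave s (cube_center (grid_cube \<omega> k m))) f *
         haar_level \<omega> k m j (wave s (cube_center (grid_cube \<omega> k m))) g))))"

lemma shift_level_eq:
  fixes f g :: "real^'n \<Rightarrow> complex"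
  assumes lam: "0 < lam" and f: "test_function f" and g: "test_function g"
  shows "of_real (2 powr (- real (max i j) / 2)) *
      (LINT x|lborel. g x * shift_block \<omega> i j (shift_coeff lam i j) (grid_cube \<omega> k m) f x)
    = shift_level lam f g \<omega> (k, m) (i, j)"
proof -
  let ?l = "2 powi (- k) :: real" and ?n = "CARD('n)" and ?c = "cube_center (grid_cube \<omega> k m)"
  let ?W = "scale_window ?l" and ?w = "scale_weight lam ?n" and ?H = "haar_indices :: ('n \<Rightarrow> bool) set"
  let ?D = "descendant_indices \<omega> i k m \<times> ?H" and ?E = "descendant_indices \<omega> j k m \<times> ?H"
  have fi: "integrable lborel f" and gi: "integrable lborel g" using f g by (simp_all add: test_functionD)
  define P where "P s p = wave_haar s ?c (snd p) (grid_cube \<omega> (k + int i) (fst p))" for s p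
  define Q where "Q s q = wave_haar s ?c (snd q) (grid_cube \<omega> (k + int j) (fst q))" for s q
  define X where "X p = haar_coeff (snd p) (grid_corner \<omega> (k + int i) (fst p)) (2 powi (- (k + int i))) f" for p
  define Y where "Y q = haar_coeff (snd q) (grid_corner \<omega> (k + int j) (fst q)) (2 powi (- (k + int j))) g" for q
  define T where "T p q = ?l ^ ?n * (LINT s:?W|lborel. ?w s * (P s p * Q s q))" for p q
  have [measurable]: "(\<lambda>s. P s p) \<in> borel_measurable borel" "(\<lambda>s. Q s p) \<in> borel_measurable borel" for p
    unfolding P_def Q_def wave_haar_grid by measurable
  have l: "0 < ?l" by simp
  have int: "set_integrable lborel ?W (\<lambda>s. ?w s *\<^sub>R (P s p * Q s q))" if "p \<in> ?D" "q \<in> ?E" for p q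
  proof (rule scale_window_integrable[OF l])
    fix s assume s: "s \<in> ?W"
    show "norm (P s p * Q s q) \<le>
      (osc_const TYPE('n) * (1/2) ^ i * measure lebesgue (grid_cube \<omega> (k + int i) (fst p) :: (real^'n) set) powr (1 / 2)) *
      (osc_const TYPE('n) * (1/2) ^ j * measure lebesgue (grid_cube \<omega> (k + int j) (fst q) :: (real^'n) set) powr (1 / 2))"
      unfolding P_def Q_def real_norm_def abs_mult using that osc_const_pos[where 'n='n]
      by (intro mult_mono wave_haar_bound[OF s]) auto
  qed measurable
  have lev: "haar_level \<omega> k m i (wave s ?c) f * haar_level \<omega> k m j (wave s ?c) g = (\<Sum>p\<in>?D. \<Sum>q\<in>?E. (P s p * Q s q) *\<^sub>R (X p * Y q))" for s
  proof -
    have "haar_level \<omega> k m i (wave s ?c) f = (\<Sum>p\<in>?D. P s p *\<^sub>R X p)"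
      "haar_level \<omega> k m j (wave s ?c) g = (\<Sum>q\<in>?E. Q s q *\<^sub>R Y q)"
      by (simp_all add: haar_level_def sum.cartesian_product P_def Q_def X_def Y_def wave_haar_grid split_beta')
    then show ?thesis by (simp add: sum_product mult.commute[of "Q s _"])
  qed
  have "shift_level lam f g \<omega> (k, m) (i, j) = (1 / shift_const lam TYPE('n)) *\<^sub>R (?l ^ ?n *\<^sub>R
     (LINT s|lborel. (\<Sum>p\<in>?D. \<Sum>q\<in>?E. (indicator ?W s *\<^sub>R (?w s *\<^sub>R (P s p * Q s q))) *\<^sub>R (X p * Y q))))"
    unfolding shift_level_def prod.case lev set_lebesgue_integral_def
    by (simp add: scaleR_sum_right mult.assoc)
  also have "(LINT s|lborel. (\<Sum>p\<in>?D. \<Sum>q\<in>?E. (indicator ?W s *\<^sub>R (?w s *\<^sub>R (P s p * Q s q))) *\<^sub>R (X p * Y q)))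
     = (\<Sum>p\<in>?D. \<Sum>q\<in>?E. (LINT s:?W|lborel. ?w s *\<^sub>R (P s p * Q s q)) *\<^sub>R (X p * Y q))"
    unfolding set_lebesgue_integral_def using int[unfolded set_integrable_def]
    by (simp add: Bochner_Integration.integral_sum Bochner_Integration.integrable_sum del: scaleR_scaleR)
  finally have 1: "shift_level lam f g \<omega> (k, m) (i, j) = (\<Sum>p\<in>?D. \<Sum>q\<in>?E. (T p q / shift_const lam TYPE('n)) *\<^sub>R (X p * Y q))"
    by (simp add: T_def scaleR_sum_right)
  have a: "shift_coeff lam i j (snd p) (snd q) (grid_cube \<omega> (k + int i) (fst p)) (grid_cube \<omega> (k + int j) (fst q)) (grid_cube \<omega> k m)
      = of_real (2 powr (real (max i j) / 2) * (T p q / shift_const lam TYPE('n)))" for p q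
    by (simp add: shift_coeff_def T_def P_def Q_def side_length_grid_cube)
  let ?t = "\<lambda>m1 \<eta> m2 \<theta>. of_real (2 powr (real (max i j) / 2) * (T (m1, \<eta>) (m2, \<theta>) / shift_const lam TYPE('n))) * X (m1, \<eta>) * Y (m2, \<theta>)"
  have a': "shift_coeff lam i j \<eta> \<theta> (grid_cube \<omega> (k + int i) m1) (grid_cube \<omega> (k + int j) m2) (grid_cube \<omega> k m)
      = of_real (2 powr (real (max i j) / 2) * (T (m1, \<eta>) (m2, \<theta>) / shift_const lam TYPE('n)))" for m1 m2 \<eta> \<theta>
    using a[of "(m1, \<eta>)" "(m2, \<theta>)"] by (simp only: fst_conv snd_conv)
  have "(LINT x|lborel. g x * shift_block \<omega> i j (shift_coeff lam i j) (grid_cube \<omega> k m) f x)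
     = (\<Sum>m1\<in>descendant_indices \<omega> i k m. \<Sum>m2\<in>descendant_indices \<omega> j k m. \<Sum>\<eta>\<in>?H. \<Sum>\<theta>\<in>?H. ?t m1 \<eta> m2 \<theta>)"
    unfolding integral_mult_block[OF fi gi] by (simp only: a' X_def Y_def fst_conv snd_conv)
  also have "\<dots> = (\<Sum>m1\<in>descendant_indices \<omega> i k m. \<Sum>\<eta>\<in>?H. \<Sum>m2\<in>descendant_indices \<omega> j k m. \<Sum>\<theta>\<in>?H. ?t m1 \<eta> m2 \<theta>)"
    by (rule sum.cong[OF refl], rule sum.swap)
  also have "\<dots> = (\<Sum>p\<in>?D. \<Sum>q\<in>?E. of_real (2 powr (real (max i j) / 2) * (T p q / shift_const lam TYPE('n))) * X p * Y q)"
  proof -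
    define R where "R p q = of_real (2 powr (real (max i j) / 2) * (T p q / shift_const lam TYPE('n))) * X p * Y q" for p q
    have pairs: "(\<Sum>x\<in>A. \<Sum>y\<in>B. h (x, y)) = sum h (A \<times> B)" for A :: "('n \<Rightarrow> int) set" and B :: "('n \<Rightarrow> bool) set" and h :: "_ \<Rightarrow> complex"
      by (simp add: sum.cartesian_product)
    have "(\<Sum>m1\<in>descendant_indices \<omega> i k m. \<Sum>\<eta>\<in>?H. \<Sum>m2\<in>descendant_indices \<omega> j k m. \<Sum>\<theta>\<in>?H. R (m1, \<eta>) (m2, \<theta>))
        = (\<Sum>p\<in>?D. \<Sum>q\<in>?E. R p q)"
      unfolding pairs[of "R _"] by (rule pairs)
    then show ?thesis unfolding R_def .
  qed
  also have "\<dots> = of_real (2 powr (real (max i j) / 2)) * shift_level lam f g \<omega> (k, m) (i, j)"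
    unfolding 1 sum_distrib_left by (intro sum.cong refl) (simp add: scaleR_conv_of_real)
  finally show ?thesis
    by (simp add: mult.assoc[symmetric] powr_minus flip: of_real_mult powr_add)
qed

lemma norm_shift_level:
  fixes f g :: "real^'n \<Rightarrow> complex"
  assumes lam: "0 < lam" and f: "test_function f" and g: "test_function g"
  shows "norm (shift_level lam f g \<omega> p (i, j)) \<le> (4 ^ CARD('n) * ((1/2) ^ i * (1/2) ^ j)) * local_energy lam f g \<omega> p"
proof -
  obtain k m where p: "p = (k, m)" by fastforce
  let ?l = "2 powi (- k) :: real" and ?n = "CARD('n)" and ?c = "cube_center (grid_cube \<omega> k m)"
  let ?B = "osc_const TYPE('n)" and ?F = "local_mass f \<omega> k m" and ?G = "local_mass g \<omega> k m"
  let ?M = "(2 ^ ?n * ?B * (1/2) ^ i * ?F) * (2 ^ ?n * ?B * (1/2) ^ j * ?G)"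
  have B: "0 < ?B" by (rule osc_const_pos)
  have "norm (?l ^ ?n *\<^sub>R (LINT s:scale_window ?l|lborel. scale_weight lam ?n s *\<^sub>R
        (haar_level \<omega> k m i (wave s ?c) f * haar_level \<omega> k m j (wave s ?c) g))) \<le> 4 powr (lam + real ?n) * ?l powr (- lam) * ?M"
  proof (rule scale_window_bound)
    fix s assume s: "s \<in> scale_window ?l"
    show "norm (haar_level \<omega> k m i (wave s ?c) f * haar_level \<omega> k m j (wave s ?c) g) \<le> ?M"
      unfolding norm_mult using B local_mass_nonneg
      by (intro mult_mono haar_level_wave(1)[OF s f] haar_level_wave(1)[OF s g]) (auto intro!: mult_nonneg_nonneg)
  qed (use lam in auto)
  then have "norm (shift_level lam f g \<omega> p (i, j)) \<le> (1 / shift_const lam TYPE('n)) * (4 powr (lam + real ?n) * ?l powr (- lam) * ?M)"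
    unfolding p shift_level_def prod.case norm_scaleR[of "1 / _"]
    using shift_const_pos[of lam, where 'n='n] by (simp add: mult_left_mono divide_right_mono)
  also have "\<dots> = (2 ^ ?n * 2 ^ ?n * ((1/2) ^ i * (1/2) ^ j)) * local_energy lam f g \<omega> p"
    using B by (simp add: p shift_const_def local_energy_def power2_eq_square)
  also have "(2 ^ ?n * 2 ^ ?n :: real) = 4 ^ ?n" by (simp flip: power_mult_distrib)
  finally show ?thesis .
qed

text \<open>
  As a function of the position \<open>v\<close> this involves the grid no longer: at the centre of a cube it is
  \<open>shift_const\<close> times the total contribution of the cube to the series.
\<close>

definition wave_product :: "real \<Rightarrow> (real^'n \<Rightarrow> complex) \<Rightarrow> (real^'n \<Rightarrow> complex) \<Rightarrow> int \<Rightarrow> real^'n \<Rightarrow> complex" where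
  "wave_product lam f g k v = (2 powi (- k)) ^ CARD('n) *\<^sub>R
     (LINT s:scale_window (2 powi (- k))|lborel. scale_weight lam CARD('n) s *\<^sub>R (wave_coeff s v f * wave_coeff s v g))"

lemma sums_imp_infsum:
  fixes a :: "nat \<Rightarrow> complex"
  assumes "a sums A" "\<And>i. norm (a i) \<le> c * (1/2) ^ i"
  shows "infsum a UNIV = A"
proof (rule infsumI, rule norm_summable_imp_has_sum[OF _ assms(1)])
  have "summable (\<lambda>i. c * (1/2 :: real) ^ i)" by (intro summable_mult summable_geometric) simp
  then show "summable (\<lambda>i. norm (a i))"
    by (rule summable_comparison_test'[where N=0]) (use assms(2) in simp)
qed

text \<open>
  Under the integral over the scales the double series factorizes into two Haar expansions, each of
  which sums to a wave coefficient.
\<close>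

lemma infsum_shift_level:
  fixes f g :: "real^'n \<Rightarrow> complex"
  assumes lam: "0 < lam" and f: "test_function f" and g: "test_function g"
  shows "(\<Sum>\<^sub>\<infinity>q. shift_level lam f g \<omega> (k, m) q) =
    (1 / shift_const lam TYPE('n)) *\<^sub>R wave_product lam f g k (cube_center (grid_cube \<omega> k m))"
proof -
  let ?l = "2 powi (- k) :: real" and ?n = "CARD('n)" and ?c = "cube_center (grid_cube \<omega> k m)"
  let ?B = "osc_const TYPE('n)" and ?W = "scale_window (2 powi (- k))" and ?w = "scale_weight lam CARD('n)"
  define cf where "cf = 2 ^ ?n * ?B * local_mass f \<omega> k m"
  define cg where "cg = 2 ^ ?n * ?B * local_mass g \<omega> k m"
  have c0: "0 \<le> cf" "0 \<le> cg"
    using osc_const_pos[where 'n='n] local_mass_nonneg[of f \<omega> k m] local_mass_nonneg[of g \<omega> k m]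
    by (simp_all add: cf_def cg_def)
  define a where "a s i = haar_level \<omega> k m i (wave s ?c) f" for s i
  define b where "b s j = haar_level \<omega> k m j (wave s ?c) g" for s j
  have a: "norm (a s i) \<le> cf * (1/2) ^ i" and b: "norm (b s i) \<le> cg * (1/2) ^ i" if "s \<in> ?W" for s i
    using haar_level_wave(1)[OF that f, of \<omega> m i ?c] haar_level_wave(1)[OF that g, of \<omega> m i ?c]
    by (simp_all add: a_def b_def cf_def cg_def mult_ac)
  have ab: "norm (a s i * b s j) \<le> cf * cg * ((1/2) ^ i * (1/2) ^ j)" if s: "s \<in> ?W" for s i j
    using mult_mono[OF a[OF s, of i] b[OF s, of j]] c0 by (simp add: norm_mult mult_ac)
  have [measurable]: "(\<lambda>s. a s i) \<in> borel_measurable borel" "(\<lambda>s. b s i) \<in> borel_measurable borel" for i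
    unfolding a_def b_def by measurable
  have l: "0 < ?l" by simp
  \<comment> \<open>The terms of the double series, before integration over the scales.\<close>
  define F where "F = (\<lambda>(i, j) s. indicator ?W s *\<^sub>R (?w s *\<^sub>R (a s i * b s j)))"
  have Fi: "integrable lborel (F q)" for q
  proof -
    obtain i j where q: "q = (i, j)" by fastforce
    show ?thesis
      using scale_window_integrable[OF l _ ab[of _ i j], where lam=lam and n="?n"] unfolding q F_def set_integrable_def by simp
  qed
  have Fn: "(LINT s|lborel. norm (F (i, j) s)) \<le> (4 powr (lam + real ?n) * ?l powr (- lam) * (cf * cg) / ?l ^ ?n) * ((1/2) ^ i * (1/2) ^ j)" for i j
  proof -
    have "norm (?l ^ ?n *\<^sub>R (LINT s:?W|lborel. ?w s *\<^sub>R norm (a s i * b s j))) \<le> 4 powr (lam + real ?n) * ?l powr (- lam) * (cf * cg * ((1/2) ^ i * (1/2) ^ j))"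
      by (rule scale_window_bound[OF l]) (use ab lam in auto)
    moreover have "(LINT s:?W|lborel. ?w s *\<^sub>R norm (a s i * b s j)) = (LINT s|lborel. norm (F (i, j) s))"
      unfolding set_lebesgue_integral_def F_def
      by (intro Bochner_Integration.integral_cong refl) (simp add: scale_weight_nonneg abs_mult)
    ultimately show ?thesis using l by (simp add: field_simps)
  qed
  have Fs: "(\<lambda>q. LINT s|lborel. norm (F q s)) summable_on UNIV"
  proof (rule summable_on_comparison_test)
    show "(\<lambda>q. (4 powr (lam + real ?n) * ?l powr (- lam) * (cf * cg) / ?l ^ ?n) * (case q of (i, j) \<Rightarrow> (1/2) ^ i * (1/2) ^ j)) summable_on UNIV"
      by (intro summable_on_cmult_right half_powers_summable)
    show "(LINT s|lborel. norm (F q s)) \<le> (4 powr (lam + real ?n) * ?l powr (- lam) * (cf * cg) / ?l ^ ?n) * (case q of (i, j) \<Rightarrow> (1/2) ^ i * (1/2) ^ j)" for q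
      using Fn[of "fst q" "snd q"] by (simp add: split_beta')
  qed simp
  have pt: "(\<Sum>\<^sub>\<infinity>q. F q s) = indicator ?W s *\<^sub>R (?w s *\<^sub>R (wave_coeff s ?c f * wave_coeff s ?c g))" for s
  proof (cases "s \<in> ?W")
    case s: True
    have sm: "(\<lambda>(i, j). a s i * b s j) summable_on UNIV"
    proof (rule summable_on_dominated)
      show "(\<lambda>q. cf * cg * (case q of (i, j) \<Rightarrow> (1/2) ^ i * (1/2) ^ j)) summable_on UNIV"
        by (intro summable_on_cmult_right half_powers_summable)
      show "norm (case q of (i, j) \<Rightarrow> a s i * b s j) \<le> cf * cg * (case q of (i, j) \<Rightarrow> (1/2) ^ i * (1/2) ^ j)" for q
        using ab[OF s, of "fst q" "snd q"] by (simp add: split_beta')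
    qed
    have "(\<Sum>\<^sub>\<infinity>q. F q s) = (\<Sum>\<^sub>\<infinity>q. of_real (?w s) * (case q of (i, j) \<Rightarrow> a s i * b s j))"
      using s by (intro infsum_cong) (simp add: F_def scaleR_conv_of_real split_beta')
    also have "\<dots> = of_real (?w s) * (infsum (a s) UNIV * infsum (b s) UNIV)"
      unfolding infsum_cmult_right' infsum_times[OF sm] ..
    also have "infsum (a s) UNIV = wave_coeff s ?c f"
      by (rule sums_imp_infsum[OF _ a[OF s]]) (use haar_level_wave(2)[OF s f, of \<omega> m] in \<open>simp add: a_def\<close>)
    also have "infsum (b s) UNIV = wave_coeff s ?c g"
      by (rule sums_imp_infsum[OF _ b[OF s]]) (use haar_level_wave(2)[OF s g, of \<omega> m] in \<open>simp add: b_def\<close>)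
    finally show ?thesis using s by (simp add: scaleR_conv_of_real)
  qed (simp add: F_def split_beta')
  have lev: "shift_level lam f g \<omega> (k, m) q = of_real (1 / shift_const lam TYPE('n) * ?l ^ ?n) * (LINT s|lborel. F q s)" for q
    by (cases q) (simp add: shift_level_def F_def a_def b_def set_lebesgue_integral_def scaleR_conv_of_real)
  have "(\<Sum>\<^sub>\<infinity>q. shift_level lam f g \<omega> (k, m) q) = of_real (1 / shift_const lam TYPE('n) * ?l ^ ?n) * (\<Sum>\<^sub>\<infinity>q. LINT s|lborel. F q s)"
    unfolding lev infsum_cmult_right' ..
  also have "(\<Sum>\<^sub>\<infinity>q. LINT s|lborel. F q s) = (LINT s|lborel. (\<Sum>\<^sub>\<infinity>q. F q s))"
    by (rule integral_infsum[OF lborel.sigma_finite_measure_axioms Fi Fs, symmetric])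
  finally show ?thesis
    unfolding pt wave_product_def set_lebesgue_integral_def by (simp add: scaleR_conv_of_real)
qed

definition haar_shift :: "real \<Rightarrow> (int \<Rightarrow> 'n::finite \<Rightarrow> bool) \<Rightarrow> nat \<Rightarrow> nat \<Rightarrow> (real^'n \<Rightarrow> complex) \<Rightarrow> real^'n \<Rightarrow> complex" where
  "haar_shift lam \<omega> i j = (\<lambda>f x. \<Sum>\<^sub>\<infinity>K\<in>dyadic \<omega>. shift_block \<omega> i j (shift_coeff lam i j) K f x)"

text \<open>
  The blocks are absolutely summable after integration against \<open>g\<close>, with majorant \<open>local_energy\<close>.
\<close>

lemma
  fixes f g :: "real^'n \<Rightarrow> complex"
  assumes lam: "0 < lam" "lam < real CARD('n)" and f: "test_function f" and g: "test_function g"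
  shows haar_shift_integrable: "integrable lborel (\<lambda>x. g x * haar_shift lam \<omega> i j f x)"
    and haar_shift_pairing: "(LINT x|lborel. g x * haar_shift lam \<omega> i j f x) =
      (\<Sum>\<^sub>\<infinity>(k, m). LINT x|lborel. g x * shift_block \<omega> i j (shift_coeff lam i j) (grid_cube \<omega> k m) f x)"
proof -
  have fi: "integrable lborel f" and gi: "integrable lborel g" using f g by (simp_all add: test_functionD)
  define F where "F = (\<lambda>(k, m) x. g x * shift_block \<omega> i j (shift_coeff lam i j) (grid_cube \<omega> k m) f x)"
  have eq: "g x * haar_shift lam \<omega> i j f x = (\<Sum>\<^sub>\<infinity>p. F p x)" for x
    unfolding haar_shift_def dyadic_eq infsum_reindex[OF inj_grid_cube] o_def F_def
    by (simp add: infsum_cmult_right'[symmetric] split_beta')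
  have Fi: "integrable lborel (F p)" for p
    unfolding F_def by (cases p) (simp add: integrable_mult_block[OF fi gi])
  have sm: "local_energy lam f g \<omega> summable_on UNIV"
    by (rule local_energy_summable[OF lam f g]) blast
  have Fs: "(\<lambda>p. LINT x|lborel. norm (F p x)) summable_on UNIV"
  proof (rule summable_on_comparison_test)
    show "(\<lambda>p. 4 ^ CARD('n) * local_energy lam f g \<omega> p) summable_on UNIV"
      by (intro summable_on_cmult_right sm)
    show "(LINT x|lborel. norm (F p x)) \<le> 4 ^ CARD('n) * local_energy lam f g \<omega> p" for p
      using integral_norm_mult_block[OF fi gi shift_coeff_bounded[OF less_imp_le[OF lam(1)]], where k="fst p" and m="snd p"]
      by (simp add: F_def local_energy_def split_beta')
  qed simp
  show "integrable lborel (\<lambda>x. g x * haar_shift lam \<omega> i j f x)"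
    unfolding eq by (rule integrable_infsum[OF lborel.sigma_finite_measure_axioms Fi Fs])
  show "(LINT x|lborel. g x * haar_shift lam \<omega> i j f x) =
      (\<Sum>\<^sub>\<infinity>(k, m). LINT x|lborel. g x * shift_block \<omega> i j (shift_coeff lam i j) (grid_cube \<omega> k m) f x)"
    unfolding eq integral_infsum[OF lborel.sigma_finite_measure_axioms Fi Fs] by (simp add: F_def split_beta')
qed

text \<open>
  The family over \<open>(i, j)\<close> and all cubes is absolutely summable, being dominated by the product of
  \<open>2\<^sup>-\<^sup>i\<^sup>-\<^sup>j\<close> and \<open>local_energy\<close>; so the sum over \<open>(i, j)\<close> can be taken first.
\<close>

lemma
  fixes f g :: "real^'n \<Rightarrow> complex"
  assumes lam: "0 < lam" "lam < real CARD('n)" and f: "test_function f" and g: "test_function g"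
  shows haar_shift_series_summable: "(\<lambda>(i, j). of_real (2 powr (- real (max i j) / 2)) * (LINT x|lborel. g x * haar_shift lam \<omega> i j f x)) summable_on UNIV"
    and haar_shift_series: "(\<Sum>\<^sub>\<infinity>(i, j). of_real (2 powr (- real (max i j) / 2)) * (LINT x|lborel. g x * haar_shift lam \<omega> i j f x))
      = (\<Sum>\<^sub>\<infinity>(k, m). (1 / shift_const lam TYPE('n)) *\<^sub>R wave_product lam f g k (cube_center (grid_cube \<omega> k m)))"
    and wave_product_le: "norm ((1 / shift_const lam TYPE('n)) *\<^sub>R wave_product lam f g k (cube_center (grid_cube \<omega> k m)))
      \<le> (4 ^ CARD('n) * (\<Sum>\<^sub>\<infinity>(i, j). (1/2 :: real) ^ i * (1/2) ^ j)) * local_energy lam f g \<omega> (k, m)"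
proof -
  have sm: "local_energy lam f g \<omega> summable_on UNIV"
    by (rule local_energy_summable[OF lam f g]) blast
  let ?h = "\<lambda>q. 4 ^ CARD('n) * (case q of (i, j) \<Rightarrow> (1/2 :: real) ^ i * (1/2) ^ j)"
  have hs: "?h summable_on UNIV" by (intro summable_on_cmult_right half_powers_summable)
  have h0: "0 \<le> ?h q" for q by (simp add: split_beta')
  have nl: "norm (shift_level lam f g \<omega> p q) \<le> ?h q * local_energy lam f g \<omega> p" for p q
    using norm_shift_level[OF lam(1) f g, of \<omega> p "fst q" "snd q"] by (simp add: split_beta')
  have prod: "(\<lambda>(q, p). shift_level lam f g \<omega> p q) summable_on UNIV \<times> UNIV"
  proof (rule summable_on_dominated)
    show "(\<lambda>(q, p). ?h q * local_energy lam f g \<omega> p) summable_on UNIV \<times> UNIV"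
      using summable_on_times[OF hs h0 sm local_energy_nonneg] by (simp add: split_beta')
    show "norm (case z of (q, p) \<Rightarrow> shift_level lam f g \<omega> p q) \<le> (case z of (q, p) \<Rightarrow> ?h q * local_energy lam f g \<omega> p)" for z
      using nl[of "snd z" "fst z"] by (simp add: split_beta')
  qed
  have entry: "(case q of (i, j) \<Rightarrow> of_real (2 powr (- real (max i j) / 2)) * (LINT x|lborel. g x * haar_shift lam \<omega> i j f x))
      = (\<Sum>\<^sub>\<infinity>p. shift_level lam f g \<omega> p q)" for q
  proof -
    obtain i j where q: "q = (i, j)" by fastforce
    show ?thesis
      unfolding q prod.case haar_shift_pairing[OF lam f g] infsum_cmult_right'[symmetric]
    proof (rule infsum_cong)
      fix p
      show "of_real (2 powr (- real (max i j) / 2)) *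
          (case p of (k, m) \<Rightarrow> LINT x|lborel. g x * shift_block \<omega> i j (shift_coeff lam i j) (grid_cube \<omega> k m) f x)
        = shift_level lam f g \<omega> p (i, j)"
        using shift_level_eq[OF lam(1) f g, where k="fst p" and m="snd p" and \<omega>=\<omega> and i=i and j=j]
        by (simp add: split_beta')
    qed
  qed
  show "(\<lambda>(i, j). of_real (2 powr (- real (max i j) / 2)) * (LINT x|lborel. g x * haar_shift lam \<omega> i j f x)) summable_on UNIV"
    unfolding entry by (rule summable_on_Sigma_banach[OF prod])
  have "(\<Sum>\<^sub>\<infinity>(i, j). of_real (2 powr (- real (max i j) / 2)) * (LINT x|lborel. g x * haar_shift lam \<omega> i j f x))
      = (\<Sum>\<^sub>\<infinity>p. \<Sum>\<^sub>\<infinity>q. shift_level lam f g \<omega> p q)"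
    unfolding entry by (rule infsum_swap_banach[OF prod])
  also have "\<dots> = (\<Sum>\<^sub>\<infinity>(k, m). (1 / shift_const lam TYPE('n)) *\<^sub>R wave_product lam f g k (cube_center (grid_cube \<omega> k m)))"
    by (intro infsum_cong) (auto simp: infsum_shift_level[OF lam(1) f g] split: prod.split)
  finally show "(\<Sum>\<^sub>\<infinity>(i, j). of_real (2 powr (- real (max i j) / 2)) * (LINT x|lborel. g x * haar_shift lam \<omega> i j f x))
      = (\<Sum>\<^sub>\<infinity>(k, m). (1 / shift_const lam TYPE('n)) *\<^sub>R wave_product lam f g k (cube_center (grid_cube \<omega> k m)))" .
  have hE: "(\<lambda>q. ?h q * local_energy lam f g \<omega> (k, m)) summable_on UNIV" by (intro summable_on_cmult_left hs)
  have nsum: "(\<lambda>q. norm (shift_level lam f g \<omega> (k, m) q)) summable_on UNIV"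
    by (rule summable_on_comparison_test[OF hE nl]) auto
  have "norm (\<Sum>\<^sub>\<infinity>q. shift_level lam f g \<omega> (k, m) q) \<le> (\<Sum>\<^sub>\<infinity>q. norm (shift_level lam f g \<omega> (k, m) q))"
    by (rule norm_infsum_bound[OF nsum])
  also have "\<dots> \<le> (\<Sum>\<^sub>\<infinity>q. ?h q * local_energy lam f g \<omega> (k, m))"
    by (rule infsum_mono[OF nsum hE nl])
  also have "\<dots> = (4 ^ CARD('n) * (\<Sum>\<^sub>\<infinity>(i, j). (1/2 :: real) ^ i * (1/2) ^ j)) * local_energy lam f g \<omega> (k, m)"
    unfolding infsum_cmult_left' infsum_cmult_right' ..
  finally show "norm ((1 / shift_const lam TYPE('n)) *\<^sub>R wave_product lam f g k (cube_center (grid_cube \<omega> k m)))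
      \<le> (4 ^ CARD('n) * (\<Sum>\<^sub>\<infinity>(i, j). (1/2 :: real) ^ i * (1/2) ^ j)) * local_energy lam f g \<omega> (k, m)"
    unfolding infsum_shift_level[OF lam(1) f g] .
qed

section \<open>Averaging over the grids\<close>

lemma wave_coeff_bounds:
  fixes f :: "real^'n \<Rightarrow> complex"
  assumes f: "test_function f" and s: "0 < s"
  shows "norm (wave_coeff s v f) \<le> 2 ^ CARD('n) * (LINT x|lborel. norm (f x))"
    and "norm (wave_coeff s v f - wave_coeff s v' f) \<le> ((1 + 2 * 2 ^ CARD('n)) / s * (LINT x|lborel. norm (f x))) * norm (v - v')"
proof -
  have fi: "integrable lborel f" using f by (rule test_functionD)
  have fn: "integrable lborel (\<lambda>x. c * norm (f x))" for c :: real
    by (rule integrable_mult_right[OF integrable_norm[OF fi]])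
  have i: "integrable lborel (\<lambda>x. of_real (wave s v x) * f x)" for v by (rule integrable_wave_mult[OF f])
  have "norm (wave_coeff s v f) \<le> (LINT x|lborel. 2 ^ CARD('n) * norm (f x))"
    unfolding wave_coeff_def
    by (rule order_trans[OF integral_norm_bound integral_mono[OF integrable_norm[OF i] fn]])
      (simp add: norm_mult mult_right_mono wave_bound)
  then show "norm (wave_coeff s v f) \<le> 2 ^ CARD('n) * (LINT x|lborel. norm (f x))" by simp
  let ?L = "(1 + 2 * 2 ^ CARD('n)) / s"
  have w: "\<bar>wave s v x - wave s v' x\<bar> \<le> ?L * norm (v - v')" for x
  proof -
    have "wave s v x = wave s 0 (x - v)" "wave s v' x = wave s 0 (x - v')" by (simp_all add: wave_def)
    moreover have "norm (x - v - (x - v')) = norm (v - v')" by (simp add: norm_minus_commute)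
    ultimately show ?thesis using wave_lipschitz[OF s, of 0 "x - v" "x - v'"] by simp
  qed
  have d: "wave_coeff s v f - wave_coeff s v' f = (LINT x|lborel. of_real (wave s v x - wave s v' x) * f x)"
    unfolding wave_coeff_def Bochner_Integration.integral_diff[OF i i, symmetric]
    by (simp add: left_diff_distrib)
  have i2: "integrable lborel (\<lambda>x. of_real (wave s v x - wave s v' x) * f x)"
    using Bochner_Integration.integrable_diff[OF i[of v] i[of v']] by (simp add: left_diff_distrib)
  have "norm (wave_coeff s v f - wave_coeff s v' f) \<le> (LINT x|lborel. (?L * norm (v - v')) * norm (f x))"
    unfolding d
  proof (rule order_trans[OF integral_norm_bound integral_mono[OF integrable_norm[OF i2] fn]])
    fix x
    show "norm (of_real (wave s v x - wave s v' x) * f x) \<le> (?L * norm (v - v')) * norm (f x)"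
      unfolding norm_mult norm_of_real by (rule mult_right_mono[OF w]) simp
  qed
  then show "norm (wave_coeff s v f - wave_coeff s v' f) \<le> (?L * (LINT x|lborel. norm (f x))) * norm (v - v')"
    by (simp add: mult_ac)
qed

lemma wave_coeff_tendsto:
  assumes f: "test_function f" and s: "0 < s" and u: "u \<longlonglongrightarrow> a"
  shows "(\<lambda>N. wave_coeff s (u N) f) \<longlonglongrightarrow> wave_coeff s a f"
proof (rule LIM_zero_cancel, rule Lim_null_comparison)
  let ?c = "(1 + 2 * 2 ^ CARD('a)) / s * (LINT x|lborel. norm (f x))"
  show "\<forall>\<^sub>F N in sequentially. norm (wave_coeff s (u N) f - wave_coeff s a f) \<le> ?c * norm (u N - a)"
    by (intro always_eventually allI wave_coeff_bounds(2)[OF f s])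
  have "(\<lambda>N. norm (u N - a)) \<longlonglongrightarrow> 0" using u by (simp add: LIM_zero tendsto_norm_zero)
  then show "(\<lambda>N. ?c * norm (u N - a)) \<longlonglongrightarrow> 0" by (rule tendsto_mult_right_zero)
qed

lemma wave_coeff_measurable [measurable (raw)]:
  assumes "f \<in> borel_measurable borel"
    and [measurable]: "s \<in> borel_measurable M" "v \<in> borel_measurable M"
  shows "(\<lambda>x. wave_coeff (s x) (v x) f) \<in> borel_measurable M"
proof -
  note assms(1)[measurable]
  show ?thesis unfolding wave_coeff_def by (rule lborel.borel_measurable_lebesgue_integral) measurable
qed

text \<open>
  Continuity and boundedness in the position are what \<open>expectation_grid_offset\<close> asks for.
\<close>

lemma
  fixes f g :: "real^'n \<Rightarrow> complex"
  assumes lam: "0 < lam" and f: "test_function f" and g: "test_function g"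
  shows wave_product_continuous: "continuous_on UNIV (wave_product lam f g k)"
    and wave_product_bounded: "\<exists>M. \<forall>v. norm (wave_product lam f g k v) \<le> M"
proof -
  let ?l = "2 powi (- k) :: real" and ?n = "CARD('n)"
  let ?W = "scale_window (2 powi (- k))" and ?w = "scale_weight lam CARD('n)"
  have [measurable]: "f \<in> borel_measurable borel" "g \<in> borel_measurable borel"
    using f g by (simp_all add: test_functionD)
  define Z where "Z = (2 ^ ?n * (LINT x|lborel. norm (f x))) * (2 ^ ?n * (LINT x|lborel. norm (g x)))"
  have Z: "norm (wave_coeff s v f * wave_coeff s v g) \<le> Z" if s: "s \<in> ?W" for s v
    unfolding Z_def norm_mult
    by (intro mult_mono wave_coeff_bounds(1)[OF f window_pos[OF s]] wave_coeff_bounds(1)[OF g window_pos[OF s]]) auto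
  have l: "0 < ?l" by simp
  have "norm (wave_product lam f g k v) \<le> 4 powr (lam + real ?n) * ?l powr (- lam) * Z" for v
    unfolding wave_product_def by (rule scale_window_bound[OF l]) (use Z lam in auto)
  then show "\<exists>M. \<forall>v. norm (wave_product lam f g k v) \<le> M" by blast
  have Z0: "0 \<le> Z" by (simp add: Z_def)
  have iZ: "integrable lborel (\<lambda>s. indicator ?W s *\<^sub>R (?w s *\<^sub>R Z))"
    using scale_window_integrable[OF l, of "\<lambda>_. Z" Z lam ?n] Z0 unfolding set_integrable_def by simp
  show "continuous_on UNIV (wave_product lam f g k)"
  proof (rule continuous_on_sequentiallyI)
    fix u :: "nat \<Rightarrow> real^'n" and a assume u: "u \<longlonglongrightarrow> a"
    show "(\<lambda>N. wave_product lam f g k (u N)) \<longlonglongrightarrow> wave_product lam f g k a"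
      unfolding wave_product_def set_lebesgue_integral_def
    proof (intro tendsto_scaleR tendsto_const, rule integral_dominated_convergence[OF _ _ iZ])
      show "AE s in lborel. (\<lambda>N. indicat_real ?W s *\<^sub>R (?w s *\<^sub>R (wave_coeff s (u N) f * wave_coeff s (u N) g)))
        \<longlonglongrightarrow> indicat_real ?W s *\<^sub>R (?w s *\<^sub>R (wave_coeff s a f * wave_coeff s a g))"
      proof (rule AE_I2)
        fix s
        show "(\<lambda>N. indicat_real ?W s *\<^sub>R (?w s *\<^sub>R (wave_coeff s (u N) f * wave_coeff s (u N) g)))
          \<longlonglongrightarrow> indicat_real ?W s *\<^sub>R (?w s *\<^sub>R (wave_coeff s a f * wave_coeff s a g))"
        proof (cases "s \<in> ?W")
          case True
          then show ?thesis
            by (intro tendsto_scaleR tendsto_const tendsto_mult wave_coeff_tendsto[OF f _ u] wave_coeff_tendsto[OF g _ u] window_pos[of s k])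
        qed simp
      qed
      show "AE s in lborel. norm (indicat_real ?W s *\<^sub>R (?w s *\<^sub>R (wave_coeff s (u N) f * wave_coeff s (u N) g)))
          \<le> indicator ?W s *\<^sub>R (?w s *\<^sub>R Z)" for N
      proof (rule AE_I2)
        fix s
        show "norm (indicat_real ?W s *\<^sub>R (?w s *\<^sub>R (wave_coeff s (u N) f * wave_coeff s (u N) g))) \<le> indicator ?W s *\<^sub>R (?w s *\<^sub>R Z)"
          using mult_left_mono[OF Z[of s "u N"] scale_weight_nonneg[of lam ?n s]]
          by (cases "s \<in> ?W") (auto simp: scale_weight_nonneg)
      qed
    qed measurable
  qed
qed

lemma scale_window_unique:
  assumes s: "0 < s"
  shows "\<exists>!k. s \<in> scale_window (2 powi (- k))"
proof -
  have half: "(2 powi (- k)) / 2 = (2::real) powi (- k - 1)" "(2 powi (- k)) / 4 = (2::real) powi (- k - 2)" for k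
    by (simp_all add: power_int_diff)
  have "s \<in> scale_window (2 powi (- k)) \<longleftrightarrow> k = - \<lfloor>log 2 s\<rfloor> - 2" for k
  proof -
    have p: "(2::real) powi i = 2 powr real_of_int i" for i by (rule powr_real_of_int'[symmetric]) auto
    have "scale_window (2 powi (- k)) = {2 powr real_of_int (- k - 2)..<2 powr real_of_int (- k - 1)}"
      unfolding scale_window_def half by (simp only: p)
    then have "s \<in> scale_window (2 powi (- k)) \<longleftrightarrow> 2 powr real_of_int (- k - 2) \<le> s \<and> s < 2 powr real_of_int (- k - 1)"
      by (simp only: atLeastLessThan_iff)
    also have "\<dots> \<longleftrightarrow> real_of_int (- k - 2) \<le> log 2 s \<and> log 2 s < real_of_int (- k - 1)"
      using s by (simp add: le_log_iff log_less_iff)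
    also have "\<dots> \<longleftrightarrow> k = - \<lfloor>log 2 s\<rfloor> - 2" by linarith
    finally show ?thesis .
  qed
  then show ?thesis by auto
qed

text \<open>
  The corner of the cube of side \<open>2\<^sup>-\<^sup>k\<close> that is swept out by the centre of \<open>grid_cube \<omega> k m\<close> when the
  offset of the grid varies.
\<close>

definition std_center_corner :: "int \<Rightarrow> ('n \<Rightarrow> int) \<Rightarrow> real^'n" where
  "std_center_corner k m = 2 powi (- k) *\<^sub>R (\<chi> r. of_int (m r)) + (2 powi (- k) / 2) *\<^sub>R 1"

text \<open>
  The pairs of scale and centre that the cubes with index \<open>(k, m)\<close> account for, over all grids.
\<close>

definition scale_space_cell :: "int \<times> ('n \<Rightarrow> int) \<Rightarrow> (real \<times> (real^'n)) set" where
  "scale_space_cell = (\<lambda>(k, m). scale_window (2 powi (- k)) \<times> cube (std_center_corner k m) (2 powi (- k)))"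

lemma scale_space_cell_measurable [measurable]: "scale_space_cell p \<in> sets (borel \<Otimes>\<^sub>M borel)"
  by (cases p) (simp add: scale_space_cell_def)

lemma scale_space_cell_unique:
  fixes v :: "real^'n"
  assumes s: "0 < s"
  shows "\<exists>!p. (s, v) \<in> scale_space_cell p"
proof -
  \<comment> \<open>The sequence of zero digits gives the standard grid, whose partition property is reused.\<close>
  define z where "z = (\<lambda>(_::int) (_::'n). False)"
  have off: "grid_offset z k = 0" for k
  proof -
    have b0: "bits_vec (\<lambda>_. False) = (0 :: real^'n)" by (simp add: bits_vec_def vec_eq_iff)
    show ?thesis unfolding grid_offset_def z_def b0 by simp
  qed
  have mem: "v \<in> cube (std_center_corner k m) (2 powi (- k)) \<longleftrightarrow> v - (2 powi (- k) / 2) *\<^sub>R 1 \<in> grid_cube z k m" for k m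
    by (auto simp: std_center_corner_def grid_cube_def grid_corner_def off cube_def algebra_simps)
  obtain k where k: "s \<in> scale_window (2 powi (- k))" and ku: "\<And>k'. s \<in> scale_window (2 powi (- k')) \<Longrightarrow> k' = k"
    using scale_window_unique[OF s] by metis
  obtain m where m: "v - (2 powi (- k) / 2) *\<^sub>R 1 \<in> grid_cube z k m" using grid_cube_cover by blast
  show ?thesis
  proof (rule ex1I[of _ "(k, m)"])
    show "(s, v) \<in> scale_space_cell (k, m)" using k m mem by (simp add: scale_space_cell_def)
    fix p assume p: "(s, v) \<in> scale_space_cell p"
    obtain k' m' where p': "p = (k', m')" by fastforce
    have "k' = k" using p ku by (auto simp: p' scale_space_cell_def)
    moreover have "m' = m"
      using p m mem grid_cube_disjoint[of _ z k m' m] \<open>k' = k\<close> by (auto simp: p' scale_space_cell_def)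
    ultimately show "p = (k, m)" by (simp add: p')
  qed
qed

context
  fixes lam :: real and f g :: "real^'n \<Rightarrow> complex"
  assumes lam: "0 < lam" "lam < real CARD('n)" and f: "test_function f" and g: "test_function g"
begin

abbreviation (input) energy_density :: "real \<times> (real^'n) \<Rightarrow> complex" where
  "energy_density \<equiv> \<lambda>(s, v). of_real (scale_weight lam CARD('n) s) * wave_coeff s v g * wave_coeff s v f"

text \<open>
  The centre of the cube is uniformly distributed over a cube of the same size, and the factor \<open>\<bar>K\<bar>\<close> in
  \<open>wave_product\<close> turns the average over that cube into an integral.
\<close>

lemma expectation_wave_product:
  "(LINT \<omega>|omega_measure. wave_product lam f g k (cube_center (grid_cube \<omega> k m))) =
     (LINT q|(lborel \<Otimes>\<^sub>M lborel). indicator (scale_space_cell (k, m)) q *\<^sub>R energy_density q)"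
proof -
  let ?l = "2 powi (- k) :: real" and ?n = "CARD('n)" and ?b = "std_center_corner k m :: real^'n"
  let ?W = "scale_window (2 powi (- k))" and ?w = "scale_weight lam CARD('n)"
  have l: "0 < ?l" by simp
  have cont: "continuous_on UNIV (wave_product lam f g k)" by (rule wave_product_continuous[OF lam(1) f g])
  have m: "wave_product lam f g k \<in> borel_measurable borel" using cont by (rule borel_measurable_continuous_onI)
  obtain M where M: "\<And>v. norm (wave_product lam f g k v) \<le> M"
    using wave_product_bounded[OF lam(1) f g] by blast
  have "(LINT \<omega>|omega_measure. wave_product lam f g k (cube_center (grid_cube \<omega> k m)))
      = (LINT \<omega>|omega_measure. (\<lambda>y. wave_product lam f g k (?b + y)) (grid_offset \<omega> k))"
    by (simp add: cube_center_grid grid_corner_def std_center_corner_def algebra_simps)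
  also have "\<dots> = (LINT x:cube 0 1|lborel. wave_product lam f g k (?b + ?l *\<^sub>R x))"
  proof (rule expectation_grid_offset)
    show "continuous_on UNIV (\<lambda>y. wave_product lam f g k (?b + y))"
      by (rule continuous_on_compose2[OF cont]) (auto intro!: continuous_intros)
  qed (rule M)
  also have "\<dots> = (1 / ?l ^ ?n) *\<^sub>R (LINT v:cube ?b ?l|lborel. wave_product lam f g k v)"
    using integral_cube_affine[OF l m, of ?b] by simp
  also have "\<dots> = (LINT v|lborel. LINT s|lborel. indicator (scale_space_cell (k, m)) (s, v) *\<^sub>R energy_density (s, v))"
  proof -
    have "indicator (cube ?b ?l) v *\<^sub>R wave_product lam f g k v
        = ?l ^ ?n *\<^sub>R (LINT s|lborel. indicator (scale_space_cell (k, m)) (s, v) *\<^sub>R energy_density (s, v))" for v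
    proof -
      have cell: "indicator (scale_space_cell (k, m)) (s, v) *\<^sub>R energy_density (s, v)
          = indicator (cube ?b ?l) v *\<^sub>R (indicator ?W s *\<^sub>R (?w s *\<^sub>R (wave_coeff s v f * wave_coeff s v g)))" for s
        by (auto simp: scale_space_cell_def indicator_def scaleR_conv_of_real mult_ac)
      show ?thesis
        unfolding cell integral_scaleR_right wave_product_def set_lebesgue_integral_def by (rule scaleR_left_commute)
    qed
    then show ?thesis unfolding set_lebesgue_integral_def by simp
  qed
  also have "\<dots> = (LINT q|(lborel \<Otimes>\<^sub>M lborel). indicator (scale_space_cell (k, m)) q *\<^sub>R energy_density q)"
  proof -
    have "integrable (lborel \<Otimes>\<^sub>M lborel) (\<lambda>q. indicator (scale_space_cell (k, m)) q *\<^sub>R energy_density q)"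
      using scale_space_cell_measurable[of "(k, m)"]
      by (intro integrable_mult_indicator wave_energy_integrable[OF lam f g]) (simp cong: measurable_cong_sets sets_pair_measure_cong)
    then have i: "integrable (lborel \<Otimes>\<^sub>M lborel) (\<lambda>(s, v). indicator (scale_space_cell (k, m)) (s, v) *\<^sub>R energy_density (s, v))"
      by (simp add: split_beta')
    show ?thesis using lborel_pair.integral_snd[OF i] by (simp add: split_beta')
  qed
  finally show ?thesis .
qed

text \<open>
  The cells tile the whole half-space of positive scales, so the expectations of the terms add up to
  the integral over all scales and positions.
\<close>

lemma
  shows expectation_series_integrable: "integrable omega_measure (\<lambda>\<omega>. \<Sum>\<^sub>\<infinity>(k, m).
      (1 / shift_const lam TYPE('n)) *\<^sub>R wave_product lam f g k (cube_center (grid_cube \<omega> k m)))"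
    and expectation_series: "(LINT \<omega>|omega_measure. (\<Sum>\<^sub>\<infinity>(k, m).
      (1 / shift_const lam TYPE('n)) *\<^sub>R wave_product lam f g k (cube_center (grid_cube \<omega> k m))))
      = (1 / shift_const lam TYPE('n)) *\<^sub>R integral\<^sup>L (lborel \<Otimes>\<^sub>M lborel) energy_density"
proof -
  let ?C = "shift_const lam TYPE('n)"
  interpret O: prob_space "omega_measure :: (int \<Rightarrow> 'n \<Rightarrow> bool) measure" by (rule prob_space_omega)
  define F where "F = (\<lambda>(k, m) \<omega>. (1 / ?C) *\<^sub>R wave_product lam f g k (cube_center (grid_cube \<omega> k m)))"
  have Fi: "integrable omega_measure (F p)" for p
  proof -
    obtain k m where p: "p = (k, m)" by fastforce
    have m: "wave_product lam f g k \<in> borel_measurable borel"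
      by (rule borel_measurable_continuous_onI[OF wave_product_continuous[OF lam(1) f g]])
    obtain M where M: "\<And>v. norm (wave_product lam f g k v) \<le> M"
      using wave_product_bounded[OF lam(1) f g] by blast
    have "(\<lambda>\<omega>. cube_center (grid_cube \<omega> k m) :: real^'n) \<in> borel_measurable omega_measure"
      unfolding cube_center_grid grid_corner_def by measurable
    then have "(\<lambda>\<omega>. wave_product lam f g k (cube_center (grid_cube \<omega> k m))) \<in> borel_measurable omega_measure"
      by (rule measurable_compose[OF _ m])
    then have "integrable omega_measure (\<lambda>\<omega>. wave_product lam f g k (cube_center (grid_cube \<omega> k m)))"
      by (intro O.integrable_const_bound[of _ M]) (use M in auto)
    then show ?thesis unfolding p F_def prod.case by (rule integrable_scaleR_right)
  qed
  obtain B where sm: "\<And>\<omega>. local_energy lam f g \<omega> summable_on UNIV" and B: "\<And>\<omega>. infsum (local_energy lam f g \<omega>) UNIV \<le> B"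
    by (rule local_energy_summable[OF lam f g]) blast
  define D where "D = 4 ^ CARD('n) * (\<Sum>\<^sub>\<infinity>(i, j). (1/2 :: real) ^ i * (1/2) ^ j)"
  have D: "0 \<le> D" unfolding D_def by (intro mult_nonneg_nonneg infsum_nonneg) auto
  have FD: "norm (F p \<omega>) \<le> D * local_energy lam f g \<omega> p" for p \<omega>
    using wave_product_le[OF lam f g, of "fst p" \<omega> "snd p"] unfolding F_def D_def by (simp add: split_beta')
  have Fs: "(\<lambda>p. LINT \<omega>|omega_measure. norm (F p \<omega>)) summable_on UNIV"
  proof (rule nonneg_bdd_above_summable_on)
    show "bdd_above (sum (\<lambda>p. LINT \<omega>|omega_measure. norm (F p \<omega>)) ` {P. P \<subseteq> UNIV \<and> finite P})"
    proof (rule bdd_aboveI2)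
      fix P :: "(int \<times> ('n \<Rightarrow> int)) set" assume "P \<in> {P. P \<subseteq> UNIV \<and> finite P}"
      then have P: "finite P" by simp
      have pt: "(\<Sum>p\<in>P. norm (F p \<omega>)) \<le> D * B" for \<omega>
      proof -
        have "(\<Sum>p\<in>P. norm (F p \<omega>)) \<le> (\<Sum>p\<in>P. D * local_energy lam f g \<omega> p)" by (intro sum_mono FD)
        also have "\<dots> = D * (\<Sum>p\<in>P. local_energy lam f g \<omega> p)" by (simp add: sum_distrib_left)
        also have "\<dots> \<le> D * infsum (local_energy lam f g \<omega>) UNIV"
          using P D by (intro mult_left_mono finite_sum_le_infsum sm) (auto simp: local_energy_nonneg)
        also have "\<dots> \<le> D * B" using D by (intro mult_left_mono B)
        finally show ?thesis .
      qed
      have "(\<Sum>p\<in>P. LINT \<omega>|omega_measure. norm (F p \<omega>)) = (LINT \<omega>|omega_measure. (\<Sum>p\<in>P. norm (F p \<omega>)))"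
        by (rule Bochner_Integration.integral_sum[symmetric]) (intro integrable_norm Fi)
      also have "\<dots> \<le> (LINT \<omega>|(omega_measure :: (int \<Rightarrow> 'n \<Rightarrow> bool) measure). D * B)"
        by (intro integral_mono Bochner_Integration.integrable_sum integrable_norm Fi pt) simp
      also have "\<dots> = D * B" by (simp add: O.prob_space)
      finally show "(\<Sum>p\<in>P. LINT \<omega>|omega_measure. norm (F p \<omega>)) \<le> D * B" .
    qed
  qed simp
  have eq: "(\<Sum>\<^sub>\<infinity>(k, m). (1 / ?C) *\<^sub>R wave_product lam f g k (cube_center (grid_cube \<omega> k m))) = (\<Sum>\<^sub>\<infinity>p. F p \<omega>)" for \<omega>
    by (simp add: F_def split_beta')
  show "integrable omega_measure (\<lambda>\<omega>. \<Sum>\<^sub>\<infinity>(k, m). (1 / ?C) *\<^sub>R wave_product lam f g k (cube_center (grid_cube \<omega> k m)))"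
    unfolding eq by (rule integrable_infsum[OF O.sigma_finite_measure_axioms Fi Fs])
  define h where "h = energy_density"
  have hi: "integrable (lborel \<Otimes>\<^sub>M lborel) h" unfolding h_def by (rule wave_energy_integrable[OF lam f g])
  define G where "G p q = indicator (scale_space_cell p) q *\<^sub>R h q" for p q
  have cell: "scale_space_cell p \<in> sets (lborel \<Otimes>\<^sub>M lborel)" for p :: "int \<times> ('n \<Rightarrow> int)"
    using scale_space_cell_measurable[of p] by (simp cong: sets_pair_measure_cong)
  have Gi: "integrable (lborel \<Otimes>\<^sub>M lborel) (G p)" for p
    unfolding G_def by (rule integrable_mult_indicator[OF cell hi])
  have hz: "h (s, v) = 0" if "\<not> 0 < s" for s v using that by (simp add: h_def scale_weight_def)
  have Gsum: "(\<Sum>\<^sub>\<infinity>p. G p q) = h q" and Gle: "finite P \<Longrightarrow> (\<Sum>p\<in>P. norm (G p q)) \<le> norm (h q)" for q P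
  proof -
    obtain s v where q: "q = (s, v)" by fastforce
    have "(\<Sum>\<^sub>\<infinity>p. G p q) = h q \<and> (finite P \<longrightarrow> (\<Sum>p\<in>P. norm (G p q)) \<le> norm (h q))"
    proof (cases "0 < s")
      case True
      obtain p0 where p0: "q \<in> scale_space_cell p0" and u: "\<And>p. q \<in> scale_space_cell p \<Longrightarrow> p = p0"
        using scale_space_cell_unique[OF True, of v] unfolding q by metis
      have G: "G p q = (if p = p0 then h q else 0)" for p
      proof (cases "q \<in> scale_space_cell p")
        case True
        then show ?thesis using u[OF True] by (simp add: G_def)
      next
        case False
        then show ?thesis using p0 by (auto simp: G_def)
      qed
      have "((\<lambda>p. G p q) has_sum h q) UNIV"
        by (rule has_sum_finite_neutralI[of "{p0}"]) (simp_all add: G)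
      moreover have "(\<Sum>p\<in>P. norm (G p q)) \<le> norm (h q)" if "finite P"
      proof -
        have "(\<Sum>p\<in>P. norm (G p q)) = (\<Sum>p\<in>P. if p = p0 then norm (h q) else 0)" by (intro sum.cong refl) (simp add: G)
        also have "\<dots> \<le> norm (h q)" using that by simp
        finally show ?thesis .
      qed
      ultimately show ?thesis by (auto intro: infsumI)
    next
      case False
      then show ?thesis using hz[of s v] by (simp add: q G_def)
    qed
    then show "(\<Sum>\<^sub>\<infinity>p. G p q) = h q" "finite P \<Longrightarrow> (\<Sum>p\<in>P. norm (G p q)) \<le> norm (h q)" by auto
  qed
  have Gs: "(\<lambda>p. LINT q|(lborel \<Otimes>\<^sub>M lborel). norm (G p q)) summable_on UNIV"
  proof (rule nonneg_bdd_above_summable_on)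
    show "bdd_above (sum (\<lambda>p. LINT q|(lborel \<Otimes>\<^sub>M lborel). norm (G p q)) ` {P. P \<subseteq> UNIV \<and> finite P})"
    proof (rule bdd_aboveI2)
      fix P :: "(int \<times> ('n \<Rightarrow> int)) set" assume "P \<in> {P. P \<subseteq> UNIV \<and> finite P}"
      then have P: "finite P" by simp
      have "(\<Sum>p\<in>P. LINT q|(lborel \<Otimes>\<^sub>M lborel). norm (G p q)) = (LINT q|(lborel \<Otimes>\<^sub>M lborel). (\<Sum>p\<in>P. norm (G p q)))"
        by (rule Bochner_Integration.integral_sum[symmetric]) (intro integrable_norm Gi)
      also have "\<dots> \<le> (LINT q|(lborel \<Otimes>\<^sub>M lborel). norm (h q))"
        by (intro integral_mono Bochner_Integration.integrable_sum integrable_norm Gi hi Gle P)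
      finally show "(\<Sum>p\<in>P. LINT q|(lborel \<Otimes>\<^sub>M lborel). norm (G p q)) \<le> (LINT q|(lborel \<Otimes>\<^sub>M lborel). norm (h q))" .
    qed
  qed simp
  have sf: "sigma_finite_measure (lborel \<Otimes>\<^sub>M lborel :: (real \<times> (real^'n)) measure)"
    unfolding lborel_prod by (rule lborel.sigma_finite_measure_axioms)
  have EF: "(LINT \<omega>|omega_measure. F p \<omega>) = of_real (1 / ?C) * (LINT q|(lborel \<Otimes>\<^sub>M lborel). G p q)" for p
  proof -
    obtain k m where p: "p = (k, m)" by fastforce
    show ?thesis unfolding p F_def G_def h_def prod.case expectation_wave_product[symmetric]
      by (simp add: scaleR_conv_of_real)
  qed
  have "(LINT \<omega>|omega_measure. (\<Sum>\<^sub>\<infinity>p. F p \<omega>)) = (\<Sum>\<^sub>\<infinity>p. LINT \<omega>|omega_measure. F p \<omega>)"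
    by (rule integral_infsum[OF O.sigma_finite_measure_axioms Fi Fs])
  also have "\<dots> = of_real (1 / ?C) * (\<Sum>\<^sub>\<infinity>p. LINT q|(lborel \<Otimes>\<^sub>M lborel). G p q)"
    unfolding EF infsum_cmult_right' ..
  also have "(\<Sum>\<^sub>\<infinity>p. LINT q|(lborel \<Otimes>\<^sub>M lborel). G p q) = (LINT q|(lborel \<Otimes>\<^sub>M lborel). (\<Sum>\<^sub>\<infinity>p. G p q))"
    by (rule integral_infsum[OF sf Gi Gs, symmetric])
  also have "\<dots> = integral\<^sup>L (lborel \<Otimes>\<^sub>M lborel) h" unfolding Gsum ..
  finally show "(LINT \<omega>|omega_measure. (\<Sum>\<^sub>\<infinity>(k, m). (1 / ?C) *\<^sub>R wave_product lam f g k (cube_center (grid_cube \<omega> k m))))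
      = (1 / ?C) *\<^sub>R integral\<^sup>L (lborel \<Otimes>\<^sub>M lborel) energy_density"
    unfolding eq h_def by (simp add: scaleR_conv_of_real)
qed

end

section \<open>Bounded, compactly supported functions\<close>

lemma Linf_c_test_function:
  fixes f :: "real^'n \<Rightarrow> complex"
  assumes "f \<in> Linf_c"
  obtains f' where "test_function f'" "AE x in lebesgue. f x = f' x"
proof -
  from assms obtain M B where f: "f \<in> borel_measurable lebesgue" and M: "AE x in lebesgue. norm (f x) \<le> M"
    and B: "compact B" "AE x in lebesgue. x \<notin> B \<longrightarrow> f x = 0" unfolding Linf_c_def by blast
  have re: "(\<lambda>x. Re (f x)) \<in> borel_measurable lebesgue" and im: "(\<lambda>x. Im (f x)) \<in> borel_measurable lebesgue"
    using f by simp_all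
  obtain u where u: "u \<in> borel_measurable lborel" "AE x in lborel. Re (f x) = u x"
    using completion_ex_borel_measurable_real[OF re] by blast
  obtain v where v: "v \<in> borel_measurable lborel" "AE x in lborel. Im (f x) = v x"
    using completion_ex_borel_measurable_real[OF im] by blast
  define h where "h x = complex_of_real (u x) + \<i> * complex_of_real (v x)" for x
  define f' where "f' x = (if x \<in> B \<and> norm (h x) \<le> M then h x else 0)" for x
  have [measurable]: "u \<in> borel_measurable borel" "v \<in> borel_measurable borel" using u v by simp_all
  have [measurable]: "h \<in> borel_measurable borel" unfolding h_def by measurable
  have [measurable]: "B \<in> sets borel" using B(1) by (intro borel_closed compact_imp_closed)
  obtain R where R: "\<And>x. x \<in> B \<Longrightarrow> norm x \<le> R" using compact_imp_bounded[OF B(1)] unfolding bounded_iff by blast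
  have "test_function f'"
    unfolding test_function_def
  proof (intro conjI)
    show "f' \<in> borel_measurable borel" unfolding f'_def by measurable
    show "\<exists>M. \<forall>x. norm (f' x) \<le> M" by (rule exI[of _ "\<bar>M\<bar>"]) (auto simp: f'_def)
    show "\<exists>R. \<forall>x. R < norm x \<longrightarrow> f' x = 0"
    proof (intro exI allI impI)
      fix x :: "real^'n" assume "R < norm x"
      then have "x \<notin> B" using R[of x] by auto
      then show "f' x = 0" by (simp add: f'_def)
    qed
  qed
  moreover have "AE x in lebesgue. f x = f' x"
    using AE_completion[OF u(2)] AE_completion[OF v(2)] M B(2)
  proof eventually_elim
    case (elim x)
    have "h x = f x" using elim(1,2) by (simp add: h_def complex_eq_iff)
    then show ?case using elim(3,4) by (auto simp: f'_def)
  qed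
  ultimately show ?thesis by (rule that)
qed

lemma
  fixes h :: "real^'n \<Rightarrow> complex"
  assumes g: "g \<in> borel_measurable lebesgue" and g': "g' \<in> borel_measurable borel" and AE: "AE x in lebesgue. g x = g' x"
    and h: "h \<in> borel_measurable borel"
  shows integrable_lebesgue_iff: "integrable lebesgue (\<lambda>x. g x * h x) \<longleftrightarrow> integrable lborel (\<lambda>x. g' x * h x)"
    and pairing_lborel: "pairing g h = (LINT x|lborel. g' x * h x)"
proof -
  have hl: "h \<in> borel_measurable lebesgue" using h by (intro measurable_completion) simp
  have gl: "g' \<in> borel_measurable lebesgue" using g' by (intro measurable_completion) simp
  have m: "(\<lambda>x. g x * h x) \<in> borel_measurable lebesgue" "(\<lambda>x. g' x * h x) \<in> borel_measurable lebesgue"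
    by (rule borel_measurable_times[OF g hl], rule borel_measurable_times[OF gl hl])
  have ml: "(\<lambda>x. g' x * h x) \<in> borel_measurable lborel" using borel_measurable_times[OF g' h] by simp
  have AE': "AE x in lebesgue. g x * h x = g' x * h x" using AE by (rule eventually_mono) simp
  show "integrable lebesgue (\<lambda>x. g x * h x) \<longleftrightarrow> integrable lborel (\<lambda>x. g' x * h x)"
    using integrable_cong_AE[OF m AE'] integrable_completion[OF ml] by simp
  show "pairing g h = (LINT x|lborel. g' x * h x)"
    unfolding pairing_def using integral_cong_AE[OF m AE'] integral_completion[OF ml] by simp
qed

lemma frac_integral_lborel:
  assumes f: "f \<in> borel_measurable lebesgue" and f': "f' \<in> borel_measurable borel" and AE: "AE x in lebesgue. f x = f' x"
  shows "frac_integral lam f x = (LINT y|lborel. f' y / of_real (norm (x - y) powr lam))"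
proof -
  have "(\<lambda>y. complex_of_real (1 / norm (x - y) powr lam)) \<in> borel_measurable borel" by measurable
  from pairing_lborel[OF f f' AE this] show ?thesis
    by (simp add: frac_integral_def pairing_def)
qed

lemma borel_measurable_infsum:
  fixes F :: "'i::countable \<Rightarrow> 'a \<Rightarrow> complex"
  assumes "\<And>i. F i \<in> borel_measurable M"
  shows "(\<lambda>x. \<Sum>\<^sub>\<infinity>i. F i x) \<in> borel_measurable M"
proof -
  let ?N = "count_space (UNIV :: 'i set)"
  have "(\<lambda>(i, x). F i x) \<in> borel_measurable (?N \<Otimes>\<^sub>M M)"
    by (rule measurable_pair_measure_countable1) (use assms in auto)
  then have "(\<lambda>(x, i). F i x) \<in> borel_measurable (M \<Otimes>\<^sub>M ?N)"
    by (subst measurable_pair_swap_iff) simp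
  then have "(\<lambda>x. LINT i|?N. F i x) \<in> borel_measurable M"
    by (rule sigma_finite_measure.borel_measurable_lebesgue_integral[OF sigma_finite_measure_count_space_countable, rotated]) simp
  then show ?thesis by (simp only: integral_count_space_eq_infsum)
qed

lemma haar_grid_measurable [measurable]: "haar \<eta> (grid_cube \<omega> k (m :: 'n::finite \<Rightarrow> int)) \<in> borel_measurable borel"
proof -
  have eq: "haar \<eta> (grid_cube \<omega> k m) = (\<lambda>x. ((2 powi (- k)) ^ CARD('n)) powr (- 1 / 2) *
      (\<Sum>b\<in>UNIV. haar_sign \<eta> b * indicator (subcube (grid_corner \<omega> k m) (2 powi (- k)) b) x))"
    unfolding grid_cube_def by (rule ext, rule haar_cube) simp
  show ?thesis unfolding eq by measurable
qed

lemma haar_shift_measurable: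
  assumes f: "integrable lborel f"
  shows "haar_shift lam \<omega> i j (f :: real^'n \<Rightarrow> complex) \<in> borel_measurable borel"
proof -
  define F where "F p x = shift_block \<omega> i j (shift_coeff lam i j) (grid_cube \<omega> (fst p) (snd p)) f x" for p x
  have eq: "haar_shift lam \<omega> i j f = (\<lambda>x. \<Sum>\<^sub>\<infinity>p. F p x)"
    unfolding haar_shift_def dyadic_eq infsum_reindex[OF inj_grid_cube] o_def F_def by (simp add: split_beta')
  have "F p \<in> borel_measurable borel" for p
    unfolding F_def shift_block_grid[OF f] by measurable
  then show ?thesis unfolding eq by (rule borel_measurable_infsum)
qed

text \<open>
  A shift depends on \<open>f\<close> only through integrals.
\<close>

lemma haar_shift_cong_AE:
  fixes f f' :: "real^'n \<Rightarrow> complex"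
  assumes f: "f \<in> borel_measurable lebesgue" and f': "f' \<in> borel_measurable borel" and AE: "AE x in lebesgue. f x = f' x"
  shows "haar_shift lam \<omega> i j f = haar_shift lam \<omega> i j f'"
proof -
  have fl': "f' \<in> borel_measurable lebesgue" using f' by (intro measurable_completion) simp
  have p: "pairing f (\<lambda>y. of_real (haar \<eta> I y)) = pairing f' (\<lambda>y. of_real (haar \<eta> I y))" if I: "I \<in> dyadic \<omega>" for I \<eta>
  proof -
    obtain k m where I': "I = grid_cube \<omega> k m" using I by (auto simp: dyadic_eq)
    have m: "(\<lambda>y. complex_of_real (haar \<eta> I y)) \<in> borel_measurable borel" unfolding I' by measurable
    show ?thesis
      unfolding pairing_lborel[OF f f' AE m] by (rule pairing_lborel[OF fl' f' _ m, symmetric]) simp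
  qed
  have "shift_block \<omega> i j a K f x = shift_block \<omega> i j a K f' x" for a K x
    unfolding shift_block_def by (intro sum.cong refl) (auto simp: shift_pairs_def p)
  then show ?thesis by (simp add: haar_shift_def)
qed

section \<open>The representation\<close>

theorem theorem1p2:
  fixes lam :: real
  assumes "0 < lam" and "lam < real CARD('n::finite)"
  shows "\<exists>C::real.
    \<exists>S :: (int \<Rightarrow> 'n \<Rightarrow> bool) \<Rightarrow> nat \<Rightarrow> nat \<Rightarrow> (real^'n \<Rightarrow> complex) \<Rightarrow> real^'n \<Rightarrow> complex.
      (\<forall>\<omega> i j. fractional_dyadic_shift lam \<omega> i j (S \<omega> i j)) \<and>
      (\<forall>f\<in>Linf_c. \<forall>g\<in>Linf_c.
         integrable lebesgue (\<lambda>x. g x * frac_integral lam f x) \<and>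
         (\<forall>\<omega> i j. integrable lebesgue (\<lambda>x. g x * S \<omega> i j f x)) \<and>
         (\<forall>\<omega>. (\<lambda>(i, j). of_real (2 powr (- real (max i j) / 2)) * pairing g (S \<omega> i j f))
            summable_on UNIV) \<and>
         integrable omega_measure (\<lambda>\<omega>. \<Sum>\<^sub>\<infinity>(i, j)\<in>UNIV.
            of_real (2 powr (- real (max i j) / 2)) * pairing g (S \<omega> i j f)) \<and>
         pairing g (frac_integral lam f) =
           of_real C * (LINT \<omega>|omega_measure. (\<Sum>\<^sub>\<infinity>(i, j)\<in>UNIV.
             of_real (2 powr (- real (max i j) / 2)) * pairing g (S \<omega> i j f))))"
proof -
  let ?C1 = "shift_const lam TYPE('n)" and ?c = "kernel_const lam TYPE('n)"
  have C1: "?C1 \<noteq> 0" using shift_const_pos[of lam, where 'n='n] by simp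
  have c: "?c \<noteq> 0" by (rule kernel_const_nonzero[OF assms])
  let ?S = "haar_shift lam :: (int \<Rightarrow> 'n \<Rightarrow> bool) \<Rightarrow> _"
  have shift: "fractional_dyadic_shift lam \<omega> i j (?S \<omega> i j)" for \<omega> i j
    unfolding fractional_dyadic_shift_def haar_shift_def
    using shift_coeff_bounded[of lam \<omega> i j] assms(1) by (intro exI[of _ "shift_coeff lam i j"]) simp
  have main: "integrable lebesgue (\<lambda>x. g x * frac_integral lam f x) \<and>
         (\<forall>\<omega> i j. integrable lebesgue (\<lambda>x. g x * ?S \<omega> i j f x)) \<and>
         (\<forall>\<omega>. (\<lambda>(i, j). of_real (2 powr (- real (max i j) / 2)) * pairing g (?S \<omega> i j f))
            summable_on UNIV) \<and>
         integrable omega_measure (\<lambda>\<omega>. \<Sum>\<^sub>\<infinity>(i, j)\<in>UNIV.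
            of_real (2 powr (- real (max i j) / 2)) * pairing g (?S \<omega> i j f)) \<and>
         pairing g (frac_integral lam f) =
           of_real (?C1 / ?c) * (LINT \<omega>|omega_measure. (\<Sum>\<^sub>\<infinity>(i, j)\<in>UNIV.
             of_real (2 powr (- real (max i j) / 2)) * pairing g (?S \<omega> i j f)))"
    if F: "f \<in> Linf_c" and G: "g \<in> Linf_c" for f g :: "real^'n \<Rightarrow> complex"
  proof -
    obtain f' where f': "test_function f'" and fAE: "AE x in lebesgue. f x = f' x"
      by (rule Linf_c_test_function[OF F])
    obtain g' where g': "test_function g'" and gAE: "AE x in lebesgue. g x = g' x"
      by (rule Linf_c_test_function[OF G])
    have fm: "f \<in> borel_measurable lebesgue" and gm: "g \<in> borel_measurable lebesgue"
      using F G by (auto simp: Linf_c_def)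
    have [measurable]: "f' \<in> borel_measurable borel" "g' \<in> borel_measurable borel"
      using f' g' by (simp_all add: test_functionD)
    have fi: "integrable lborel f'" using f' by (rule test_functionD)
    have S: "?S \<omega> i j f = ?S \<omega> i j f'" for \<omega> i j
      by (rule haar_shift_cong_AE[OF fm _ fAE]) measurable
    have Sm: "?S \<omega> i j f' \<in> borel_measurable borel" for \<omega> i j by (rule haar_shift_measurable[OF fi])
    have Ieq: "frac_integral lam f = (\<lambda>x. LINT y|lborel. f' y / of_real (norm (x - y) powr lam))"
      by (rule ext, rule frac_integral_lborel[OF fm _ fAE]) measurable
    have Im: "frac_integral lam f \<in> borel_measurable borel"
      unfolding Ieq by (rule lborel.borel_measurable_lebesgue_integral) measurable
    have gb: "g' \<in> borel_measurable borel" by measurable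
    have pS: "pairing g (?S \<omega> i j f) = (LINT x|lborel. g' x * ?S \<omega> i j f' x)" for \<omega> i j
      unfolding S by (rule pairing_lborel[OF gm gb gAE Sm])
    have Iint: "integrable lborel (\<lambda>x. g' x * frac_integral lam f x)"
      using lborel_pair.integrable_fst[OF kernel_pairing_integrable[OF assms f' g']]
      unfolding Ieq by (simp only: integral_mult_right_zero)
    have Ipair: "(LINT x|lborel. g' x * frac_integral lam f x) =
        integral\<^sup>L (lborel \<Otimes>\<^sub>M lborel) (\<lambda>(x, y). g' x * (f' y / of_real (norm (x - y) powr lam)))"
      using lborel_pair.integral_fst[OF kernel_pairing_integrable[OF assms f' g']]
      unfolding Ieq by (simp only: integral_mult_right_zero)
    have series: "(\<Sum>\<^sub>\<infinity>(i, j). of_real (2 powr (- real (max i j) / 2)) * pairing g (?S \<omega> i j f)) =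
        (\<Sum>\<^sub>\<infinity>(k, m). (1 / ?C1) *\<^sub>R wave_product lam f' g' k (cube_center (grid_cube \<omega> k m)))" for \<omega>
      unfolding pS by (rule haar_shift_series[OF assms f' g'])
    have "(LINT \<omega>|omega_measure. (\<Sum>\<^sub>\<infinity>(i, j). of_real (2 powr (- real (max i j) / 2)) * pairing g (?S \<omega> i j f)))
        = (1 / ?C1) *\<^sub>R (of_real ?c * (LINT x|lborel. g' x * frac_integral lam f x))"
      unfolding series expectation_series[OF assms f' g'] wave_reproducing[OF assms f' g'] Ipair ..
    then have "pairing g (frac_integral lam f) = of_real (?C1 / ?c) * (LINT \<omega>|omega_measure. (\<Sum>\<^sub>\<infinity>(i, j).
             of_real (2 powr (- real (max i j) / 2)) * pairing g (?S \<omega> i j f)))"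
      using C1 c unfolding pairing_lborel[OF gm gb gAE Im] by (simp add: scaleR_conv_of_real)
    moreover have "integrable lebesgue (\<lambda>x. g x * frac_integral lam f x)"
      using Iint integrable_lebesgue_iff[OF gm gb gAE Im] by simp
    moreover have "integrable lebesgue (\<lambda>x. g x * ?S \<omega> i j f x)" for \<omega> i j
      unfolding S using haar_shift_integrable[OF assms f' g'] integrable_lebesgue_iff[OF gm gb gAE Sm] by simp
    moreover have "(\<lambda>(i, j). of_real (2 powr (- real (max i j) / 2)) * pairing g (?S \<omega> i j f)) summable_on UNIV" for \<omega>
      unfolding pS by (rule haar_shift_series_summable[OF assms f' g'])
    moreover have "integrable omega_measure (\<lambda>\<omega>. \<Sum>\<^sub>\<infinity>(i, j).
            of_real (2 powr (- real (max i j) / 2)) * pairing g (?S \<omega> i j f))"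
      unfolding series by (rule expectation_series_integrable[OF assms f' g'])
    ultimately show ?thesis by blast
  qed
  show ?thesis
    by (intro exI[of _ "?C1 / ?c"] exI[of _ ?S] conjI allI ballI shift) (use main in auto)
qed

end
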